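(* Let $\varepsilon>0$ and let $X=(X_t)_{t\in[0,1]}$ be a real-valued, nondeterministic Lévy process with triplet $(\nu,\sigma^2,b)$. Define $b_\varepsilon := b-\int_{[-1,1]\setminus[-\varepsilon,\varepsilon]}x\,\nu(dx)$ and, for $u\in\mathbb{R}$, $$\Lambda_\varepsilon(u)=\frac12\sigma^2u^2+b_\varepsilon u+\int_{-\varepsilon}^{\varepsilon}\left[e^{ux}-1-ux\right]\nu(dx).$$ Suppose that there is a solution $u_\varepsilon\in\mathbb{R}$ to the equation $\Lambda_\varepsilon'(u_\varepsilon)=0$, and put $$\bar F(\varepsilon)=\frac1{\varepsilon^2}\left[\sigma^2+\int_{-\varepsilon}^{\varepsilon}x^2e^{u_\varepsilon x}\,\nu(dx)\right]=\varepsilon^{-2}\Lambda_\varepsilon''(u_\varepsilon).$$ Then $$-\log\mathbb{P}(\|X\|\le 3\varepsilon)\le \nu([-\varepsilon,\varepsilon]^c)-\Lambda_\varepsilon(u_\varepsilon)+3\varepsilon|u_\varepsilon|+10\bar F(\varepsilon)+3$$ and $$-\log\mathbb{P}(\|X\|\le \varepsilon/2)\ge \nu([-\varepsilon,\varepsilon]^c)-\Lambda_\varepsilon(u_\varepsilon)-\frac{\varepsilon}{2}|u_\varepsilon|+\frac1{12}\bar F(\varepsilon)-1.$$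
   Context: $\|X\|:=\sup_{t\in[0,1]}|X_t|$. A $(\nu,\sigma^2,b)$-Lévy process $X=(X_t)_{t\in[0,1]}$ (a Lévy process with triplet $(\nu,\sigma^2,b)$) is a process with independent stationary increments, $X_0=0$, stochastic continuity and càdlàg paths such that $\mathbb{E}e^{iuX_t}=e^{-t\psi(u)}$ with $$\psi(u)=\frac{\sigma^2}{2}u^2-ibu+\int_{\mathbb{R}\setminus\{0\}}\left(1-e^{iux}+\mathbf 1_{\{|x|\le1\}}iux\right)\nu(dx),$$ where $\sigma^2\in[0,\infty)$, $b\in\mathbb{R}$ and $\nu$ (the Lévy measure) is a positive measure on $\mathbb{R}\setminus\{0\}$ with $\int 1\wedge x^2\,\nu(dx)<\infty$. $[-\varepsilon,\varepsilon]^c$ is the complement of $[-\varepsilon,\varepsilon]$, and $\int_{-\varepsilon}^{\varepsilon}$ denotes integration over $[-\varepsilon,\varepsilon]\setminus\{0\}$.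
   Formalization: For ε > 1 the drift b_ε is corrected to b + ∫_{[-ε,ε]\[-1,1]} x ν(dx); with the literal formula (b_ε = b) the upper bound fails, e.g. ν = 10⁴δ₂, σ² = 0, b = 0, ε = 100, u_ε = 0. For ε ≤ 1 nothing changes. *)

theory Defs
  imports "HOL-Probability.Probability"
begin

text \<open>
  A measure on the punctured real line is identified with a Borel measure on the whole
  line that does not charge the origin.
\<close>

definition levy_measure :: "real measure \<Rightarrow> bool" where
  "levy_measure \<nu> \<longleftrightarrow>
     sets \<nu> = sets borel \<and> emeasure \<nu> {0} = 0 \<and>
     (\<integral>\<^sup>+x. ennreal (min 1 (x\<^sup>2)) \<partial>\<nu>) < \<infinity>"

definition levy_exponent :: "real measure \<Rightarrow> real \<Rightarrow> real \<Rightarrow> real \<Rightarrow> complex" where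
  "levy_exponent \<nu> \<sigma>2 b u =
     complex_of_real (\<sigma>2 / 2 * u\<^sup>2) - \<i> * complex_of_real (b * u) +
     (LINT x:-{0}|\<nu>. 1 - exp (\<i> * complex_of_real (u * x)) +
        complex_of_real (indicator {y. \<bar>y\<bar> \<le> 1} x) * (\<i> * complex_of_real (u * x)))"

definition independent_increments :: "'a measure \<Rightarrow> (real \<Rightarrow> 'a \<Rightarrow> real) \<Rightarrow> bool" where
  "independent_increments M X \<longleftrightarrow>
     (\<forall>(n::nat) (t::nat \<Rightarrow> real).
        (\<forall>i\<le>n. t i \<in> {0..1}) \<and> (\<forall>i<n. t i \<le> t (Suc i)) \<longrightarrow>
        prob_space.indep_vars M (\<lambda>_. borel) (\<lambda>i \<omega>. X (t (Suc i)) \<omega> - X (t i) \<omega>) {..<n})"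

definition stationary_increments :: "'a measure \<Rightarrow> (real \<Rightarrow> 'a \<Rightarrow> real) \<Rightarrow> bool" where
  "stationary_increments M X \<longleftrightarrow>
     (\<forall>s h. 0 \<le> s \<and> 0 \<le> h \<and> s + h \<le> 1 \<longrightarrow>
        distr M borel (\<lambda>\<omega>. X (s + h) \<omega> - X s \<omega>) = distr M borel (\<lambda>\<omega>. X h \<omega> - X 0 \<omega>))"

definition stochastically_continuous :: "'a measure \<Rightarrow> (real \<Rightarrow> 'a \<Rightarrow> real) \<Rightarrow> bool" where
  "stochastically_continuous M X \<longleftrightarrow>
     (\<forall>t\<in>{0..1}. \<forall>\<delta>>0.
        ((\<lambda>s. measure M {\<omega> \<in> space M. \<bar>X s \<omega> - X t \<omega>\<bar> > \<delta>}) \<longlongrightarrow> 0) (at t within {0..1}))"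

definition cadlag_on_unit :: "(real \<Rightarrow> real) \<Rightarrow> bool" where
  "cadlag_on_unit f \<longleftrightarrow>
     (\<forall>t\<in>{0..<1}. (f \<longlongrightarrow> f t) (at_right t)) \<and>
     (\<forall>t\<in>{0<..1}. \<exists>l. (f \<longlongrightarrow> l) (at_left t))"

text \<open>
  Only the time parameters in the unit interval matter; the values of \<^term>\<open>X t\<close> for other
  \<^term>\<open>t\<close> are unconstrained. The parameter \<open>\<sigma>2\<close> is the variance $\sigma^2$ itself, not its root.
\<close>

definition levy_process ::
  "'a measure \<Rightarrow> (real \<Rightarrow> 'a \<Rightarrow> real) \<Rightarrow> real measure \<Rightarrow> real \<Rightarrow> real \<Rightarrow> bool" where
  "levy_process M X \<nu> \<sigma>2 b \<longleftrightarrow>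
     prob_space M \<and> levy_measure \<nu> \<and> 0 \<le> \<sigma>2 \<and>
     (\<forall>t\<in>{0..1}. X t \<in> borel_measurable M) \<and>
     (\<forall>\<omega>\<in>space M. X 0 \<omega> = 0) \<and>
     independent_increments M X \<and>
     stationary_increments M X \<and>
     stochastically_continuous M X \<and>
     (\<forall>\<omega>\<in>space M. cadlag_on_unit (\<lambda>t. X t \<omega>)) \<and>
     (\<forall>t\<in>{0..1}. \<forall>u. char (distr M borel (X t)) u =
        exp (- (complex_of_real t * levy_exponent \<nu> \<sigma>2 b u)))"

definition deterministic_process :: "'a measure \<Rightarrow> (real \<Rightarrow> 'a \<Rightarrow> real) \<Rightarrow> bool" where
  "deterministic_process M X \<longleftrightarrow>
     (\<exists>f::real \<Rightarrow> real. \<forall>t\<in>{0..1}. AE \<omega> in M. X t \<omega> = f t)"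

text \<open>
  The supremum is a real number, since a cadlag path on a compact interval is bounded.
\<close>

definition sup_norm_path :: "(real \<Rightarrow> 'a \<Rightarrow> real) \<Rightarrow> 'a \<Rightarrow> real" where
  "sup_norm_path X \<omega> = (SUP t\<in>{0..1}. \<bar>X t \<omega>\<bar>)"

text \<open>
  The negative logarithm takes the value \<open>\<infinity>\<close> at 0 (whereas \<^term>\<open>ln (0::real)\<close> is 0).
  This matters: the small ball probability vanishes, for instance, for a Poisson process
  with jumps of size \<open>\<epsilon>\<close> and a strong enough negative drift, in a ball of radius \<open>\<epsilon>/2\<close>.
\<close>

definition neg_log :: "real \<Rightarrow> ereal" where
  "neg_log p = (if p = 0 then \<infinity> else ereal (- ln p))"

text \<open>
  The drift of the process with jumps larger than \<open>\<epsilon>\<close> removed and the remaining ones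
  compensated. For \<open>\<epsilon> \<le> 1\<close> the second integral runs over the empty set. For \<open>\<epsilon> > 1\<close>
  the first one does, and the second one accounts for the jumps of size in \<open>(1, \<epsilon>]\<close>, which
  are not compensated in the Levy exponent; this is the usual convention that the integral
  from \<open>\<epsilon>\<close> to 1 changes sign when its bounds are swapped.
\<close>

definition drift_eps :: "real measure \<Rightarrow> real \<Rightarrow> real \<Rightarrow> real" where
  "drift_eps \<nu> b \<epsilon> =
     b - (LINT x:{-1..1} - {-\<epsilon>..\<epsilon>}|\<nu>. x) + (LINT x:{-\<epsilon>..\<epsilon>} - {-1..1}|\<nu>. x)"

definition Lambda_eps ::
  "real measure \<Rightarrow> real \<Rightarrow> real \<Rightarrow> real \<Rightarrow> real \<Rightarrow> real" where
  "Lambda_eps \<nu> \<sigma>2 b \<epsilon> u =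
     1 / 2 * \<sigma>2 * u\<^sup>2 + drift_eps \<nu> b \<epsilon> * u +
     (LINT x:{-\<epsilon>..\<epsilon>} - {0}|\<nu>. exp (u * x) - 1 - u * x)"

definition F_bar ::
  "real measure \<Rightarrow> real \<Rightarrow> real \<Rightarrow> real \<Rightarrow> real" where
  "F_bar \<nu> \<sigma>2 \<epsilon> u =
     1 / \<epsilon>\<^sup>2 * (\<sigma>2 + (LINT x:{-\<epsilon>..\<epsilon>} - {0}|\<nu>. x\<^sup>2 * exp (u * x)))"

end

theory Submission
  imports Defs
begin

text \<open>
  The two bounds come from one sub- and one supersolution of the equation killed at the exit from
  the ball, so no decomposition of the process into small and large jumps and no change of measure
  is needed. Let \<open>L\<close> be the generator. For \<open>f x = exp (u * x) * g x\<close> with \<open>\<Lambda>' u = 0\<close>, the jumps of size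
  at most \<open>\<epsilon>\<close> and the Gaussian part contribute \<open>exp (u * x) * (\<Lambda> u * g x + L' g x)\<close>, where the tilted
  generator \<open>L'\<close> has no drift and has second moment \<open>\<epsilon>\<^sup>2 * F\<close>; the larger jumps contribute
  \<open>- \<nu>([-\<epsilon>,\<epsilon>]\<^sup>c) * f x\<close> plus a non-negative term. A compactly supported bump \<open>g\<close> with \<open>L' g \<ge> - 10 F g\<close>
  gives the lower bound for the probability of the ball of radius \<open>3\<epsilon>\<close>. On the ball of radius \<open>\<epsilon>/2\<close>
  the function \<open>g x = 1 + cos (x / \<epsilon>)\<close>, cut off outside, satisfies \<open>L' g \<le> - F g / 12\<close>, and the larger jumps
  leave this ball.

  The killed process is observed along dyadic times, where it is a killed random walk whose
  steps have the law \<open>\<mu>\<^sub>h\<close> of \<open>X\<^sub>h\<close>. The expansion \<open>E f (x + X\<^sub>h) = f x + h * L f x + o(h)\<close>, uniform on bounded sets,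
  follows from the weak convergence of \<open>(1 - exp (- y\<^sup>2 / 2)) \<mu>\<^sub>h(dy) / h\<close>.
\<close>

section \<open>The characteristic exponent\<close>

text \<open>Weak convergence only tests continuous functions, so the test functions must be C^2 with
  compact support and cannot be cut off sharply at the boundary of a ball. The bump for the lower
  bound decays smoothly inside its ball and does not mind; the upper bound pays with a thin collar,
  which is shrunk at the very end. The radii fit the jump size. From near the edge of the large ball
  a jump of at most \<epsilon> passes only through points where the bump is convex; from the small
  ball a jump larger than \<epsilon> always leaves it. The walk may sit anywhere in the ball, so the
  expansion must be uniform in the starting point: \<open>2 ^ n\<close> steps with an error of
  smaller order than \<open>1 / 2 ^ n\<close> each then add up to a vanishing error. The terms with
  |u| come from the weight exp (u * x), which is 1 at the start and lies between exp (- r |u|) and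
  exp (r |u|) on a ball of radius r. Without \<Lambda>' u = 0 a multiple of g' would remain, which a
  symmetric g could not control with the same sign on both sides of 0.\<close>

locale levy_triplet =
  fixes \<nu> :: "real measure" and \<sigma>2 b :: real
  assumes levy_measure: "levy_measure \<nu>" and variance_nonneg: "0 \<le> \<sigma>2"
begin

lemma sets_levy [measurable_cong, simp]: "sets \<nu> = sets borel"
  using levy_measure by (simp add: levy_measure_def)

lemma space_levy [simp]: "space \<nu> = UNIV"
  using sets_eq_imp_space_eq[OF sets_levy] by simp

lemma AE_levy_nonzero: "AE y in \<nu>. y \<noteq> 0"
  using levy_measure by (intro AE_I[where N="{0}"]) (auto simp: levy_measure_def)

lemma integrable_min_levy: "integrable \<nu> (\<lambda>y. min 1 (y\<^sup>2))"
  using levy_measure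
  by (intro integrableI_bounded) (auto simp: levy_measure_def)

lemma integrable_levyI:
  fixes f :: "real \<Rightarrow> 'b::{banach, second_countable_topology}"
  assumes "f \<in> borel_measurable borel" "\<And>y. y \<noteq> 0 \<Longrightarrow> norm (f y) \<le> C * min 1 (y\<^sup>2)"
  shows "integrable \<nu> f"
proof (rule Bochner_Integration.integrable_bound)
  show "integrable \<nu> (\<lambda>y. C * min 1 (y\<^sup>2))"
    using integrable_min_levy by simp
  show "AE y in \<nu>. norm (f y) \<le> norm (C * min 1 (y\<^sup>2))"
    using AE_levy_nonzero by eventually_elim (use assms(2) in force)
qed (use assms(1) in simp)

lemma emeasure_levy_away_finite:
  assumes "d > 0"
  shows "emeasure \<nu> (- {-d..d}) < \<infinity>"
proof -
  have *: "indicator (- {-d..d}) y \<le> ennreal (1 / min 1 (d\<^sup>2)) * ennreal (min 1 (y\<^sup>2))" for y :: real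
  proof (cases "y \<in> - {-d..d}")
    case True
    then have "d \<le> \<bar>y\<bar>" by auto
    then have "d\<^sup>2 \<le> y\<^sup>2" using assms by (metis abs_le_square_iff abs_of_pos)
    then have "min 1 (d\<^sup>2) \<le> min 1 (y\<^sup>2)" by auto
    then have "1 \<le> 1 / min 1 (d\<^sup>2) * min 1 (y\<^sup>2)"
      using assms by (simp add: field_simps)
    then show ?thesis using True assms by (simp add: ennreal_mult[symmetric])
  qed auto
  have "emeasure \<nu> (- {-d..d}) = (\<integral>\<^sup>+y. indicator (- {-d..d}) y \<partial>\<nu>)" by simp
  also have "\<dots> \<le> (\<integral>\<^sup>+y. ennreal (1 / min 1 (d\<^sup>2)) * ennreal (min 1 (y\<^sup>2)) \<partial>\<nu>)"
    by (intro nn_integral_mono *)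
  also have "\<dots> = ennreal (1 / min 1 (d\<^sup>2)) * (\<integral>\<^sup>+y. ennreal (min 1 (y\<^sup>2)) \<partial>\<nu>)"
    by (intro nn_integral_cmult) simp
  also have "\<dots> < \<infinity>"
    using levy_measure by (auto simp: levy_measure_def ennreal_mult_less_top)
  finally show ?thesis .
qed

text \<open>Needed for Fubini on the product with the Gaussian shift. The set {0} joins the cover
  because all the complements of symmetric intervals miss it.\<close>

lemma sigma_finite_levy: "sigma_finite_measure \<nu>"
proof
  let ?A = "insert {0} (range (\<lambda>n::nat. - {- (1 / Suc n) .. 1 / Suc n}))"
  have "\<Union>?A = UNIV"
  proof (intro equalityI subsetI)
    fix y :: real
    show "y \<in> \<Union>?A"
    proof (cases "y = 0")
      case False
      then obtain n where "inverse (Suc n) < \<bar>y\<bar>" using reals_Archimedean[of "\<bar>y\<bar>"] by auto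
      then have "y \<in> - {- (1 / Suc n) .. 1 / Suc n}" by (auto simp: inverse_eq_divide)
      then show ?thesis by blast
    qed auto
  qed auto
  moreover have "emeasure \<nu> a \<noteq> \<infinity>" if "a \<in> ?A" for a
    using that emeasure_levy_away_finite[of "1 / Suc _"] levy_measure
    by (auto simp: levy_measure_def less_top[symmetric])
  ultimately show "\<exists>A. countable A \<and> A \<subseteq> sets \<nu> \<and> \<Union>A = space \<nu> \<and> (\<forall>a\<in>A. emeasure \<nu> a \<noteq> \<infinity>)"
    by (intro exI[of _ ?A]) auto
qed

definition psi_kernel :: "real \<Rightarrow> real \<Rightarrow> complex" where
  "psi_kernel u y = 1 - iexp (u * y) + complex_of_real (indicator {y. \<bar>y\<bar> \<le> 1} y) * (\<i> * complex_of_real (u * y))"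

lemma psi_kernel_measurable [measurable]: "(\<lambda>(u, y). psi_kernel u y) \<in> borel_measurable (borel \<Otimes>\<^sub>M borel)"
  "(\<lambda>y. psi_kernel u y) \<in> borel_measurable borel" "(\<lambda>u. psi_kernel u y) \<in> borel_measurable borel"
  unfolding psi_kernel_def by measurable

text \<open>The bound separates the variables: the factor in y is \<nu>-integrable and the factor in
  u is integrable for a Gaussian. For |y| <= 1 the kernel is, up to sign, a Taylor remainder of
  second order of the exponential.\<close>

lemma psi_kernel_bound: "norm (psi_kernel u y) \<le> 2 * (1 + u\<^sup>2) * min 1 (y\<^sup>2)"
proof (cases "\<bar>y\<bar> \<le> 1")
  case True
  have "norm (psi_kernel u y) = norm (iexp (u * y) - (\<Sum>k \<le> 1. (\<i> * (u * y))^k / fact k))"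
    using True by (subst norm_minus_cancel[symmetric]) (simp add: psi_kernel_def algebra_simps)
  also have "\<dots> \<le> \<bar>u * y\<bar>^2 / 2"
    using iexp_approx1[of "u * y" 1] by (simp add: numeral_2_eq_2)
  also have "\<dots> = u\<^sup>2 / 2 * y\<^sup>2" by (simp add: power_mult_distrib)
  also have "\<dots> \<le> 2 * (1 + u\<^sup>2) * y\<^sup>2" by (intro mult_right_mono) auto
  also have "y\<^sup>2 = min 1 (y\<^sup>2)" using True abs_square_le_1[of y] by simp
  finally show ?thesis .
next
  case False
  then have y: "min 1 (y\<^sup>2) = 1" using abs_square_le_1[of y] by (simp add: min_def)
  have "norm (psi_kernel u y) = norm (1 - iexp (u * y))"
    using False by (simp add: psi_kernel_def)
  also have "\<dots> \<le> 2" by (rule order_trans[OF norm_triangle_ineq4]) (simp del: of_real_mult)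
  also have "\<dots> \<le> 2 * (1 + u\<^sup>2)" by auto
  finally show ?thesis using y by simp
qed

lemma integrable_psi_kernel: "integrable \<nu> (psi_kernel u)"
  by (rule integrable_levyI[OF _ psi_kernel_bound]) simp

lemma levy_exponent_eq:
  "levy_exponent \<nu> \<sigma>2 b u = complex_of_real (\<sigma>2 / 2 * u\<^sup>2) - \<i> * complex_of_real (b * u) + (CLINT y|\<nu>. psi_kernel u y)"
proof -
  have "indicator (- {0}) y *\<^sub>R psi_kernel u y = psi_kernel u y" for y
    by (cases "y = 0") (auto simp: psi_kernel_def)
  then show ?thesis
    unfolding levy_exponent_def set_lebesgue_integral_def psi_kernel_def[symmetric] by simp
qed

text \<open>Quadratic growth gives the Gaussian-integrable majorant for the dominated convergence in
  \<open>iexp_gauss_defect_tendsto\<close>.\<close>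

lemma levy_exponent_bound: "\<exists>C. \<forall>u. norm (levy_exponent \<nu> \<sigma>2 b u) \<le> C * (1 + u\<^sup>2)"
proof (intro exI allI)
  fix u
  have "norm (CLINT y|\<nu>. psi_kernel u y) \<le> (LINT y|\<nu>. norm (psi_kernel u y))"
    by (rule integral_norm_bound)
  also have "\<dots> \<le> (LINT y|\<nu>. 2 * (1 + u\<^sup>2) * min 1 (y\<^sup>2))"
    by (intro integral_mono integrable_norm integrable_psi_kernel psi_kernel_bound)
       (use integrable_min_levy in simp)
  also have "\<dots> = 2 * (LINT y|\<nu>. min 1 (y\<^sup>2)) * (1 + u\<^sup>2)" by simp
  finally have 1: "norm (CLINT y|\<nu>. psi_kernel u y) \<le> 2 * (LINT y|\<nu>. min 1 (y\<^sup>2)) * (1 + u\<^sup>2)" .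
  have "0 \<le> (\<bar>u\<bar> - 1)\<^sup>2" by simp
  then have "\<bar>u\<bar> \<le> 1 + u\<^sup>2" using zero_le_power2[of u] unfolding power2_diff by simp
  then have 2: "\<bar>b\<bar> * \<bar>u\<bar> \<le> \<bar>b\<bar> * (1 + u\<^sup>2)" by (intro mult_left_mono) auto
  have 3: "\<sigma>2 / 2 * u\<^sup>2 \<le> \<sigma>2 / 2 * (1 + u\<^sup>2)" using variance_nonneg by (intro mult_left_mono) auto
  have "norm (levy_exponent \<nu> \<sigma>2 b u) \<le> norm (complex_of_real (\<sigma>2 / 2 * u\<^sup>2)) + norm (\<i> * complex_of_real (b * u))
      + norm (CLINT y|\<nu>. psi_kernel u y)"
    unfolding levy_exponent_eq by (intro order_trans[OF norm_triangle_ineq] add_right_mono norm_triangle_ineq4)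
  also have "\<dots> = \<sigma>2 / 2 * u\<^sup>2 + \<bar>b\<bar> * \<bar>u\<bar> + norm (CLINT y|\<nu>. psi_kernel u y)"
    using variance_nonneg by (simp add: norm_mult norm_power abs_mult)
  also have "\<dots> \<le> (\<sigma>2 / 2 + \<bar>b\<bar> + 2 * (LINT y|\<nu>. min 1 (y\<^sup>2))) * (1 + u\<^sup>2)"
    using 1 2 3 by (simp add: algebra_simps)
  finally show "norm (levy_exponent \<nu> \<sigma>2 b u) \<le> (\<sigma>2 / 2 + \<bar>b\<bar> + 2 * (LINT y|\<nu>. min 1 (y\<^sup>2))) * (1 + u\<^sup>2)" .
qed

text \<open>Keeps the exponent in the half-plane where \<open>norm_one_minus_exp_le\<close>
  applies.\<close>

lemma Re_levy_exponent_nonneg: "0 \<le> Re (levy_exponent \<nu> \<sigma>2 b u)"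
proof -
  have "Re (CLINT y|\<nu>. psi_kernel u y) = (LINT y|\<nu>. Re (psi_kernel u y))"
    using integral_Re[OF integrable_psi_kernel] by simp
  also have "\<dots> \<ge> 0" by (intro integral_nonneg_AE) (auto simp: psi_kernel_def Re_exp)
  finally show ?thesis using variance_nonneg by (simp add: levy_exponent_eq)
qed

end

text \<open>
  Averaging the characteristic exponent over a standard Gaussian shift of its argument and
  subtracting its value turns the Levy measure into the finite measure with this density.
\<close>

definition gauss_defect :: "real \<Rightarrow> real" where
  "gauss_defect y = 1 - exp (- (y\<^sup>2) / 2)"

lemma gauss_defect_measurable [measurable]: "gauss_defect \<in> borel_measurable borel"
  unfolding gauss_defect_def by measurable

lemma gauss_defect_0 [simp]: "gauss_defect 0 = 0"
  by (simp add: gauss_defect_def)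

lemma gauss_defect_nonneg [simp]: "0 \<le> gauss_defect y"
  by (simp add: gauss_defect_def)

lemma gauss_defect_le: "gauss_defect y \<le> min 1 (y\<^sup>2)"
proof -
  have "1 + (- (y\<^sup>2) / 2) \<le> exp (- (y\<^sup>2) / 2)" by (rule exp_ge_add_one_self)
  moreover have "y\<^sup>2 / 2 \<le> y\<^sup>2" by simp
  ultimately have "gauss_defect y \<le> y\<^sup>2" unfolding gauss_defect_def by linarith
  then show ?thesis by (simp add: gauss_defect_def)
qed

text \<open>With \<open>gauss_defect_le\<close> this makes the defect comparable to
  \<open>min 1 (y\<^sup>2)\<close>, so that it can serve as a smooth weight in its place. Put t =
  y^2 / 2: on [0, 1/2] one has 1 - exp (- t) >= 3 t / 4, and for larger t monotonicity and the value
  at 1/2 give the same constant.\<close>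

lemma gauss_defect_ge: "3 / 8 * min 1 (y\<^sup>2) \<le> gauss_defect y"
proof -
  have *: "1 - exp (- t) \<ge> 3 / 4 * t" if "0 \<le> t" "t \<le> 1 / 2" for t :: real
  proof -
    have "1 + t + t\<^sup>2 / 2 \<le> exp t" using that by (intro exp_lower_Taylor_quadratic)
    moreover have "(1 - 3 / 4 * t) * (1 + t + t\<^sup>2 / 2) \<ge> 1"
    proof -
      have "(1 - 3 / 4 * t) * (1 + t + t\<^sup>2 / 2) - 1 = t * (1 / 4 - t / 4 - 3 / 8 * t\<^sup>2)"
        by (simp add: field_simps power2_eq_square)
      moreover have "t\<^sup>2 \<le> 1 / 2 * (1 / 2)" unfolding power2_eq_square using that by (intro mult_mono) auto
      then have "0 \<le> 1 / 4 - t / 4 - 3 / 8 * t\<^sup>2" using that by simp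
      ultimately show ?thesis using that by (metis diff_ge_0_iff_ge mult_nonneg_nonneg)
    qed
    moreover have "(1 - 3 / 4 * t) * (1 + t + t\<^sup>2 / 2) \<le> (1 - 3 / 4 * t) * exp t"
      using calculation(1) that by (intro mult_left_mono) auto
    ultimately have "1 \<le> (1 - 3 / 4 * t) * exp t" by linarith
    then show ?thesis by (simp add: exp_minus field_simps)
  qed
  show ?thesis
  proof (cases "y\<^sup>2 \<le> 1")
    case True then show ?thesis using *[of "y\<^sup>2 / 2"] by (simp add: gauss_defect_def)
  next
    case False
    have "exp (- (y\<^sup>2) / 2) \<le> exp (- (1 / 2))" using False by simp
    moreover have "1 - exp (- (1 / 2)) \<ge> (3 / 8 :: real)" using *[of "1/2"] by simp
    ultimately have "3 / 8 \<le> gauss_defect y" unfolding gauss_defect_def by linarith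
    then show ?thesis using False by simp
  qed
qed

lemma gauss_defect_pos: "y \<noteq> 0 \<Longrightarrow> 0 < gauss_defect y"
  by (simp add: gauss_defect_def)

lemma iexp_gaussian_average:
  "(CLINT s|std_normal_distribution. iexp ((u + s) * y)) = iexp (u * y) * complex_of_real (exp (- (y\<^sup>2) / 2))"
proof -
  have "(CLINT s|std_normal_distribution. iexp ((u + s) * y)) = (CLINT s|std_normal_distribution. iexp (u * y) * iexp (y * s))"
    by (simp add: algebra_simps exp_add)
  also have "\<dots> = iexp (u * y) * char std_normal_distribution y"
    unfolding char_def by (rule integral_mult_right_zero)
  finally show ?thesis by (simp add: char_std_normal_distribution)
qed

lemma (in real_distribution) char_gaussian_average:
  "(CLINT s|std_normal_distribution. char M (u + s)) =
     (CLINT y|M. iexp (u * y) * complex_of_real (exp (- (y\<^sup>2) / 2)))"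
proof -
  interpret N: real_distribution std_normal_distribution by (rule real_dist_normal_dist)
  interpret P: pair_prob_space M std_normal_distribution ..
  have "integrable (M \<Otimes>\<^sub>M std_normal_distribution) (\<lambda>(y, s). iexp ((u + s) * y))"
    by (intro P.integrable_const_bound[where B=1]) (auto simp del: of_real_mult of_real_add)
  from P.Fubini_integral[OF this]
  have "(CLINT s|std_normal_distribution. char M (u + s)) =
    (CLINT y|M. CLINT s|std_normal_distribution. iexp ((u + s) * y))"
    by (simp add: char_def)
  then show ?thesis by (simp only: iexp_gaussian_average)
qed

lemma std_normal_integrals:
  "integrable std_normal_distribution (\<lambda>s. s)" "(LINT s|std_normal_distribution. s) = 0"
  "integrable std_normal_distribution (\<lambda>s. s\<^sup>2)" "(LINT s|std_normal_distribution. s\<^sup>2) = 1"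
  using integrable_std_normal_distribution_moment[of 1] integral_std_normal_distribution_moment_odd[of 1]
    std_normal_distribution_even_moments[of 1]
  by simp_all

lemma std_normal_shift:
  "integrable std_normal_distribution (\<lambda>s. u + s)" "(LINT s|std_normal_distribution. u + s) = u"
  "integrable std_normal_distribution (\<lambda>s. (u + s)\<^sup>2)" "(LINT s|std_normal_distribution. (u + s)\<^sup>2) = u\<^sup>2 + 1"
proof -
  interpret N: real_distribution std_normal_distribution by (rule real_dist_normal_dist)
  note [simp] = std_normal_integrals N.prob_space[simplified]
  show "integrable std_normal_distribution (\<lambda>s. u + s)" by simp
  show "(LINT s|std_normal_distribution. u + s) = u" by simp
  have "(\<lambda>s. (u + s)\<^sup>2) = (\<lambda>s. u\<^sup>2 + s\<^sup>2 + 2 * u * s)" by (simp add: power2_sum)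
  then show "integrable std_normal_distribution (\<lambda>s. (u + s)\<^sup>2)" "(LINT s|std_normal_distribution. (u + s)\<^sup>2) = u\<^sup>2 + 1"
    by simp_all
qed

context levy_triplet begin

lemma integrable_gauss_defect: "integrable \<nu> gauss_defect"
  by (rule integrable_levyI[where C=1]) (use gauss_defect_le in auto)

text \<open>A centred shift of u does not change the compensator, which is linear in u, and
  multiplies the exponential by exp (- y^2 / 2). The loss in the exponential is the defect.\<close>

lemma psi_kernel_average:
  "(CLINT s|std_normal_distribution. psi_kernel (u + s) y) =
     psi_kernel u y + iexp (u * y) * complex_of_real (gauss_defect y)"
proof -
  interpret N: real_distribution std_normal_distribution by (rule real_dist_normal_dist)
  have int: "integrable std_normal_distribution (\<lambda>s. iexp ((u + s) * y))"
    by (intro N.integrable_const_bound[where B=1]) (auto simp del: of_real_mult of_real_add)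
  note 1 = iexp_gaussian_average[of u y]
  define c where "c = complex_of_real (indicator {y. \<bar>y\<bar> \<le> 1} y) * \<i> * complex_of_real y"
  have eq: "psi_kernel v y = 1 - iexp (v * y) + c * complex_of_real v" for v
    by (simp add: psi_kernel_def c_def)
  have 2: "(CLINT s|std_normal_distribution. c * complex_of_real (u + s)) = c * complex_of_real u"
    by (subst integral_mult_right_zero, subst integral_complex_of_real) (simp only: std_normal_shift)
  have 3: "integrable std_normal_distribution (\<lambda>s. c * complex_of_real (u + s))"
    by (intro integrable_mult_right integrable_of_real std_normal_shift)
  have "(CLINT s|std_normal_distribution. psi_kernel (u + s) y) =
      1 - iexp (u * y) * complex_of_real (exp (- (y\<^sup>2) / 2)) + c * complex_of_real u"
    unfolding eq using int 1 2 3 N.prob_space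
    by (subst Bochner_Integration.integral_add | subst Bochner_Integration.integral_diff | simp)+
  then show ?thesis by (simp add: eq gauss_defect_def algebra_simps)
qed

text \<open>The quadratic term grows by \<open>\<sigma>2 / 2\<close> because the shift has variance
  1; the linear drift stays. The total gain is the Fourier transform of a finite measure: the defect
  times \<nu>, plus an atom of mass \<open>\<sigma>2 / 2\<close> at 0.\<close>

lemma levy_exponent_average:
  "(CLINT s|std_normal_distribution. levy_exponent \<nu> \<sigma>2 b (u + s)) =
     levy_exponent \<nu> \<sigma>2 b u + complex_of_real (\<sigma>2 / 2)
       + (CLINT y|\<nu>. iexp (u * y) * complex_of_real (gauss_defect y))"
proof -
  interpret N: real_distribution std_normal_distribution by (rule real_dist_normal_dist)
  interpret L: sigma_finite_measure \<nu> by (rule sigma_finite_levy)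
  interpret P: pair_sigma_finite \<nu> std_normal_distribution ..
  let ?N = std_normal_distribution
  have int_N: "integrable ?N (\<lambda>s. 2 * (1 + (u + s)\<^sup>2) * m)" for m
    using std_normal_shift(3)[of u] by simp
  have int_psi: "integrable ?N (\<lambda>s. psi_kernel (u + s) y)" for y
    by (rule Bochner_Integration.integrable_bound[OF int_N[of "min 1 (y\<^sup>2)"]])
       (use psi_kernel_bound[of "u + _" y] in \<open>auto intro!: AE_I2 simp: abs_mult\<close>)
  have P: "integrable (\<nu> \<Otimes>\<^sub>M ?N) (\<lambda>(y, s). psi_kernel (u + s) y)"
  proof (rule P.Fubini_integrable)
    have m: "(\<lambda>p. psi_kernel (u + snd p) (fst p)) \<in> borel_measurable (\<nu> \<Otimes>\<^sub>M ?N)"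
      unfolding psi_kernel_def by measurable
    then show m': "(\<lambda>(y, s). psi_kernel (u + s) y) \<in> borel_measurable (\<nu> \<Otimes>\<^sub>M ?N)"
      by (simp add: case_prod_beta')
    have "(LINT s|?N. norm (psi_kernel (u + s) y)) \<le> 2 * (u\<^sup>2 + 2) * min 1 (y\<^sup>2)" for y
    proof -
      have "(LINT s|?N. norm (psi_kernel (u + s) y)) \<le> (LINT s|?N. 2 * (1 + (u + s)\<^sup>2) * min 1 (y\<^sup>2))"
        by (intro integral_mono integrable_norm int_psi int_N psi_kernel_bound)
      also have "\<dots> = 2 * (u\<^sup>2 + 2) * min 1 (y\<^sup>2)"
        using std_normal_shift(3,4)[of u] N.prob_space by simp
      finally show ?thesis .
    qed
    then show "integrable \<nu> (\<lambda>y. LINT s|?N. norm ((\<lambda>(y, s). psi_kernel (u + s) y) (y, s)))"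
      using m' by (intro integrable_levyI[where C="2 * (u\<^sup>2 + 2)"]) (auto simp: case_prod_beta')
  qed (use int_psi in auto)
  have int_snd: "integrable ?N (\<lambda>s. CLINT y|\<nu>. psi_kernel (u + s) y)"
    using P.integrable_snd[OF P] by simp
  have int_k: "integrable \<nu> (\<lambda>y. iexp (u * y) * complex_of_real (gauss_defect y))"
    by (rule integrable_levyI[where C=1]) (use gauss_defect_le in \<open>auto simp: norm_mult simp del: of_real_mult\<close>)
  have 1: "(CLINT s|?N. CLINT y|\<nu>. psi_kernel (u + s) y) =
      (CLINT y|\<nu>. psi_kernel u y) + (CLINT y|\<nu>. iexp (u * y) * complex_of_real (gauss_defect y))"
    using P.Fubini_integral[OF P] int_k integrable_psi_kernel
    by (simp add: psi_kernel_average)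
  have 2: "integrable ?N (\<lambda>s. complex_of_real (\<sigma>2 / 2 * (u + s)\<^sup>2))"
       "(CLINT s|?N. complex_of_real (\<sigma>2 / 2 * (u + s)\<^sup>2)) = complex_of_real (\<sigma>2 / 2 * (u\<^sup>2 + 1))"
    by (intro integrable_of_real integrable_mult_right std_normal_shift,
        subst integral_complex_of_real, subst integral_mult_right_zero, simp only: std_normal_shift)
  have 3: "integrable ?N (\<lambda>s. \<i> * complex_of_real (b * (u + s)))"
       "(CLINT s|?N. \<i> * complex_of_real (b * (u + s))) = \<i> * complex_of_real (b * u)"
    by (intro integrable_of_real integrable_mult_right std_normal_shift,
        subst integral_mult_right_zero, subst integral_complex_of_real, subst integral_mult_right_zero, simp only: std_normal_shift)
  have "(CLINT s|?N. levy_exponent \<nu> \<sigma>2 b (u + s)) =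
     complex_of_real (\<sigma>2 / 2 * (u\<^sup>2 + 1)) - \<i> * complex_of_real (b * u) + (CLINT s|?N. CLINT y|\<nu>. psi_kernel (u + s) y)"
    unfolding levy_exponent_eq 2(2)[symmetric] 3(2)[symmetric]
    by (subst Bochner_Integration.integral_add[OF _ int_snd], intro Bochner_Integration.integrable_diff 2 3,
        subst Bochner_Integration.integral_diff[OF 2(1) 3(1)], rule refl)
  then show ?thesis unfolding 1 levy_exponent_eq by (simp add: algebra_simps)
qed

end

section \<open>Small time behaviour of the increments\<close>

text \<open>Levy's continuity theorem speaks of probability laws, so a density plus an atom at 0 has
  to be normalised. A Bernoulli mixture of the two normalised pieces yields such a law; later only
  the integral formula is used.\<close>

lemma density_plus_atom:
  fixes M :: "real measure" and w :: "real \<Rightarrow> real" and c :: real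
  assumes sets: "sets M = sets borel" and w: "integrable M w" "\<And>y. 0 \<le> w y"
    and c: "0 \<le> c" and pos: "0 < (LINT y|M. w y) + c"
  obtains Q where "real_distribution Q"
    "\<And>(g :: real \<Rightarrow> complex) B. g \<in> borel_measurable borel \<Longrightarrow> (\<And>y. norm (g y) \<le> B) \<Longrightarrow>
       integral\<^sup>L Q g = ((CLINT y|M. g y * complex_of_real (w y)) + g 0 * complex_of_real c) / complex_of_real ((LINT y|M. w y) + c)"
proof -
  note [measurable_cong, simp] = sets
  have [measurable]: "w \<in> borel_measurable borel"
    using borel_measurable_integrable[OF w(1)] measurable_cong_sets[OF sets refl] by auto
  define W where "W = (LINT y|M. w y)"
  define p where "p = W / (W + c)"
  \<comment> \<open>If the density has mass 0 it cannot be normalised; the substitute is then drawn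
    with probability \<open>p = 0\<close>.\<close>
  define D where "D = (if W = 0 then return borel 0 else density M (\<lambda>y. ennreal (w y / W)))"
  define K where "K z = (if z then D else return borel (0::real))" for z :: bool
  define Q where "Q = measure_pmf (bernoulli_pmf p) \<bind> K"
  have W: "0 \<le> W" unfolding W_def by (rule integral_nonneg_AE) (use w in auto)
  then have p: "0 \<le> p" "p \<le> 1" using c by (auto simp: p_def divide_le_eq)
  have pos': "0 < W + c" using pos by (simp add: W_def)
  have D: "prob_space D" "sets D = sets borel"
  proof -
    have "(\<integral>\<^sup>+y. ennreal (w y / W) \<partial>M) = ennreal (LINT y|M. w y / W)"
      by (intro nn_integral_eq_integral) (use w W in auto)
    also have "(LINT y|M. w y / W) = W / W" unfolding W_def by simp
    finally have 1: "(\<integral>\<^sup>+y. ennreal (w y / W) \<partial>M) = ennreal (W / W)" .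
    show "prob_space D" unfolding D_def
      by (auto intro!: prob_space_return prob_spaceI simp: emeasure_density 1 sets_eq_imp_space_eq[OF sets])
    show "sets D = sets borel" by (simp add: D_def)
  qed
  have K: "prob_space (K z)" "sets (K z) = sets borel" for z
    using D by (auto simp: K_def intro: prob_space_return)
  have Km: "K \<in> measurable (measure_pmf (bernoulli_pmf p)) (subprob_algebra borel)"
    using K by (auto simp: measurable_pmf_measure1 space_subprob_algebra intro!: prob_space_imp_subprob_space)
  have sets_Q: "sets Q = sets borel"
    unfolding Q_def by (rule sets_bind) (use K in auto)
  show ?thesis
  proof
    have "prob_space Q" unfolding Q_def
      by (rule measure_pmf.prob_space_bind[OF _ Km]) (use K in auto)
    then show "real_distribution Q" using sets_Q by (simp add: real_distribution_def real_distribution_axioms_def)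
    have real: "integral\<^sup>L Q g = ((LINT y|M. g y * w y) + g 0 * c) / (W + c)"
      if g[measurable]: "g \<in> borel_measurable borel" and B: "\<And>y. \<bar>g y\<bar> \<le> B" for g :: "real \<Rightarrow> real" and B
    proof -
      have "integral\<^sup>L Q g = (LINT z|measure_pmf (bernoulli_pmf p). integral\<^sup>L (K z) g)"
        unfolding Q_def
        by (rule integral_bind[where K=borel and B=B and B'=1])
           (use B Km K in \<open>auto intro!: prob_space.finite_measure measure_pmf.finite_measure prob_space.emeasure_le_1\<close>)
      also have "\<dots> = p * integral\<^sup>L D g + (1 - p) * integral\<^sup>L (return borel 0) g"
        using p by (simp add: K_def)
      also have "integral\<^sup>L (return borel 0) g = g 0" by (simp add: integral_return)
      also have "p * integral\<^sup>L D g = (LINT y|M. g y * w y) / (W + c)"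
      proof (cases "W = 0")
        case True
        have "AE y in M. w y = 0"
          using True integral_nonneg_eq_0_iff_AE[OF w(1)] w(2) by (auto simp: W_def)
        then have "(LINT y|M. g y * w y) = 0"
          by (intro integral_eq_zero_AE) auto
        then show ?thesis using True by (simp add: p_def)
      next
        case False
        have "integral\<^sup>L D g = (LINT y|M. (w y / W) *\<^sub>R g y)"
          unfolding D_def using False by (simp, subst integral_density) (use w W in auto)
        also have "\<dots> = (LINT y|M. g y * w y / W)" by (simp add: mult.commute)
        also have "\<dots> = (LINT y|M. g y * w y) / W" by simp
        finally show ?thesis using False pos' by (simp add: p_def)
      qed
      also have "1 - p = c / (W + c)" using pos' by (simp add: p_def field_simps)
      finally show ?thesis by (simp add: add_divide_distrib mult.commute)
    qed
    fix g :: "real \<Rightarrow> complex" and B assume g[measurable]: "g \<in> borel_measurable borel" and B: "\<And>y. norm (g y) \<le> B"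
    have part: "\<bar>Re (g y)\<bar> \<le> B" "\<bar>Im (g y)\<bar> \<le> B" for y
      using B[of y] abs_Re_le_cmod[of "g y"] abs_Im_le_cmod[of "g y"] by linarith+
    have intQ: "integrable Q g"
      using \<open>prob_space Q\<close> sets_Q B
      by (intro finite_measure.integrable_const_bound[where B=B] prob_space.finite_measure)
         (auto simp: measurable_cong_sets[OF sets_Q refl])
    have intM: "integrable M (\<lambda>y. g y * complex_of_real (w y))"
      by (rule Bochner_Integration.integrable_bound[OF integrable_mult_right[OF w(1), of B]])
         (use B w(2) in \<open>auto simp: norm_mult abs_mult intro!: mult_right_mono intro: order_trans[OF _ abs_ge_self]\<close>)
    show "integral\<^sup>L Q g = ((CLINT y|M. g y * complex_of_real (w y)) + g 0 * complex_of_real c) / complex_of_real ((LINT y|M. w y) + c)"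
      using real[of "\<lambda>y. Re (g y)", OF _ part(1)] real[of "\<lambda>y. Im (g y)", OF _ part(2)]
        integral_Re[OF intQ] integral_Im[OF intQ] integral_Re[OF intM] integral_Im[OF intM]
      by (intro complex_eqI) (simp_all add: W_def Re_divide_of_real Im_divide_of_real del: of_real_add)
  qed
qed

text \<open>Mean value inequality on the convex right half-plane, where the derivative of exp (- z)
  has norm at most 1.\<close>

lemma norm_one_minus_exp_le:
  assumes "0 \<le> Re z"
  shows "norm (1 - exp (- z)) \<le> norm z"
proof -
  have "norm (exp (- 0) - exp (- z)) \<le> 1 * norm (0 - z)"
  proof (rule field_differentiable_bound)
    show "convex {z. 0 \<le> Re z}" by (rule convex_halfspace_Re_ge)
    show "((\<lambda>z. exp (- z)) has_field_derivative - exp (- x)) (at x within {z. 0 \<le> Re z})" for x :: complex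
      by (auto intro!: derivative_eq_intros)
  qed (use assms in auto)
  then show ?thesis by simp
qed

text \<open>Separates the analysis at small times from the process: only the one-dimensional laws
  enter. It is instantiated with the law of X at time \<open>1 / 2 ^ n\<close>.\<close>

locale levy_small_time = levy_triplet +
  fixes \<mu> :: "nat \<Rightarrow> real measure" and h :: "nat \<Rightarrow> real"
  assumes real_distribution_\<mu>: "real_distribution (\<mu> n)"
    and char_\<mu>: "char (\<mu> n) u = exp (- (complex_of_real (h n) * levy_exponent \<nu> \<sigma>2 b u))"
    and h_pos: "0 < h n" and h_tendsto: "h \<longlonglongrightarrow> 0"
begin

lemma sets_\<mu> [measurable_cong, simp]: "sets (\<mu> n) = sets borel"
  using real_distribution_\<mu> by (simp add: real_distribution_def real_distribution_axioms_def)

lemma prob_space_\<mu>: "prob_space (\<mu> n)"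
  using real_distribution_\<mu> by (simp add: real_distribution_def)

lemma integrable_\<mu>I:
  fixes f :: "real \<Rightarrow> 'b::{banach, second_countable_topology}"
  assumes "f \<in> borel_measurable borel" "\<And>y. norm (f y) \<le> B"
  shows "integrable (\<mu> n) f"
proof -
  interpret real_distribution "\<mu> n" by (rule real_distribution_\<mu>)
  show ?thesis by (rule integrable_const_bound[where B=B]) (use assms in auto)
qed

abbreviation "\<psi> \<equiv> levy_exponent \<nu> \<sigma>2 b"

lemma char_quotient_bound: "norm ((1 - char (\<mu> n) u) / complex_of_real (h n)) \<le> norm (\<psi> u)"
proof -
  have "norm (1 - char (\<mu> n) u) \<le> norm (complex_of_real (h n) * \<psi> u)"
    unfolding char_\<mu> using h_pos[of n] Re_levy_exponent_nonneg[of u]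
    by (intro norm_one_minus_exp_le) simp
  then show ?thesis using h_pos[of n] by (simp add: norm_divide norm_mult field_simps)
qed

text \<open>This is the derivative of exp at 0. A zero of the exponent is treated apart because the
  difference quotient would have increment 0.\<close>

lemma char_quotient_tendsto: "(\<lambda>n. (1 - char (\<mu> n) u) / complex_of_real (h n)) \<longlonglongrightarrow> \<psi> u"
proof (cases "\<psi> u = 0")
  case True then show ?thesis by (simp add: char_\<mu>)
next
  case False
  let ?z = "\<lambda>n. - (complex_of_real (h n) * \<psi> u)"
  have "((\<lambda>z::complex. (exp z - 1) / z) \<longlongrightarrow> 1) (at 0)"
    using DERIV_exp[of "0::complex"] unfolding DERIV_def by simp
  moreover have "filterlim ?z (at 0) sequentially"
    unfolding filterlim_at
  proof
    show "\<forall>\<^sub>F n in sequentially. ?z n \<in> UNIV \<and> ?z n \<noteq> 0"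
      using False h_pos by (auto intro!: always_eventually simp: less_imp_neq[symmetric])
    have "?z \<longlonglongrightarrow> - (complex_of_real 0 * \<psi> u)" by (intro tendsto_intros h_tendsto)
    then show "?z \<longlonglongrightarrow> 0" by simp
  qed
  ultimately have "(\<lambda>n. (exp (?z n) - 1) / ?z n) \<longlonglongrightarrow> 1" by (rule filterlim_compose)
  from tendsto_mult[OF this tendsto_const[of "\<psi> u"]]
  have "(\<lambda>n. (exp (?z n) - 1) / ?z n * \<psi> u) \<longlonglongrightarrow> \<psi> u" by simp
  moreover have "(exp (?z n) - 1) / ?z n * \<psi> u = (1 - char (\<mu> n) u) / complex_of_real (h n)" for n
    using False h_pos[of n] unfolding char_\<mu> by (simp add: field_simps)
  ultimately show ?thesis by simp
qed

lemma levy_exponent_measurable: "\<psi> \<in> borel_measurable borel"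
proof (rule borel_measurable_LIMSEQ_metric[OF _ char_quotient_tendsto])
  fix n
  interpret real_distribution "\<mu> n" by (rule real_distribution_\<mu>)
  show "(\<lambda>u. (1 - char (\<mu> n) u) / complex_of_real (h n)) \<in> borel_measurable borel" by simp
qed

text \<open>Averaging (1 - char) / h over the Gaussian shift and subtracting its value at u leaves
  exactly the left-hand side. The same operation on the limit, the exponent, is
  \<open>levy_exponent_average\<close>; dominated convergence exchanges the limit with the
  average.\<close>

lemma iexp_gauss_defect_tendsto:
  "(\<lambda>n. (CLINT y|\<mu> n. iexp (u * y) * complex_of_real (gauss_defect y)) / complex_of_real (h n))
     \<longlonglongrightarrow> (CLINT y|\<nu>. iexp (u * y) * complex_of_real (gauss_defect y)) + complex_of_real (\<sigma>2 / 2)"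
proof -
  let ?N = std_normal_distribution
  interpret N: real_distribution ?N by (rule real_dist_normal_dist)
  obtain C where C: "\<And>u. norm (\<psi> u) \<le> C * (1 + u\<^sup>2)" using levy_exponent_bound by blast
  let ?q = "\<lambda>n s. (1 - char (\<mu> n) (u + s)) / complex_of_real (h n)"
  have q_meas: "?q n \<in> borel_measurable ?N" for n
  proof -
    interpret real_distribution "\<mu> n" by (rule real_distribution_\<mu>)
    show ?thesis by simp
  qed
  have \<psi>_meas: "(\<lambda>s. \<psi> (u + s)) \<in> borel_measurable ?N"
    using measurable_compose[OF _ levy_exponent_measurable, of "\<lambda>s. u + s"] by simp
  have int_b: "integrable ?N (\<lambda>s. C * (1 + (u + s)\<^sup>2))" using std_normal_shift(3)[of u] by simp
  have lim: "(\<lambda>n. CLINT s|?N. ?q n s) \<longlonglongrightarrow> (CLINT s|?N. \<psi> (u + s))"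
    by (rule integral_dominated_convergence[OF \<psi>_meas q_meas int_b])
       (auto intro: char_quotient_tendsto order_trans[OF char_quotient_bound C])
  have eq: "(CLINT s|?N. ?q n s) - (1 - char (\<mu> n) u) / complex_of_real (h n) =
      (CLINT y|\<mu> n. iexp (u * y) * complex_of_real (gauss_defect y)) / complex_of_real (h n)" for n
  proof -
    interpret M: real_distribution "\<mu> n" by (rule real_distribution_\<mu>)
    have int1: "integrable ?N (\<lambda>s. char (\<mu> n) (u + s))"
      by (rule N.integrable_const_bound[where B=1]) (use M.cmod_char_le_1 in auto)
    have int2: "integrable (\<mu> n) (\<lambda>y. iexp (u * y))"
       "integrable (\<mu> n) (\<lambda>y. iexp (u * y) * complex_of_real (exp (- (y\<^sup>2) / 2)))"
      by (rule integrable_\<mu>I[where B=1]; simp add: norm_mult del: of_real_mult)+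
    have "(CLINT s|?N. ?q n s) = (1 - (CLINT s|?N. char (\<mu> n) (u + s))) / complex_of_real (h n)"
      using int1 N.prob_space by simp
    moreover have "char (\<mu> n) u - (CLINT s|?N. char (\<mu> n) (u + s)) =
        (CLINT y|\<mu> n. iexp (u * y) * complex_of_real (gauss_defect y))"
      unfolding M.char_gaussian_average unfolding char_def
      by (subst Bochner_Integration.integral_diff[symmetric, OF int2]) (simp add: gauss_defect_def algebra_simps)
    ultimately show ?thesis by (simp only: diff_divide_distrib[symmetric]) (simp add: algebra_simps)
  qed
  show ?thesis
    using tendsto_diff[OF lim char_quotient_tendsto[of u]] unfolding eq levy_exponent_average
    by (simp add: algebra_simps)
qed

lemma gauss_defect_mass_tendsto:
  "(\<lambda>n. (LINT y|\<mu> n. gauss_defect y) / h n) \<longlonglongrightarrow> (LINT y|\<nu>. gauss_defect y) + \<sigma>2 / 2"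
  using tendsto_Re[OF iexp_gauss_defect_tendsto[of 0]]
  by (simp add: integral_complex_of_real flip: of_real_divide)

text \<open>
  The measures on the left converge weakly, by Levy's continuity theorem applied after
  normalisation to total mass one; the Gaussian part contributes the atom at the origin.
\<close>

lemma gauss_defect_weak_limit:
  fixes \<Phi> :: "real \<Rightarrow> real"
  assumes cont: "\<And>y. isCont \<Phi> y" and bound: "\<And>y. \<bar>\<Phi> y\<bar> \<le> B"
  shows "(\<lambda>n. (LINT y|\<mu> n. \<Phi> y * gauss_defect y) / h n)
     \<longlonglongrightarrow> (LINT y|\<nu>. \<Phi> y * gauss_defect y) + \<sigma>2 / 2 * \<Phi> 0"
proof -
  define m where "m n = (LINT y|\<mu> n. gauss_defect y) / h n" for n
  define m' where "m' = (LINT y|\<nu>. gauss_defect y) + \<sigma>2 / 2"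
  have m: "m \<longlonglongrightarrow> m'" using gauss_defect_mass_tendsto by (simp add: m_def[abs_def] m'_def)
  have [measurable]: "\<Phi> \<in> borel_measurable borel"
    by (intro borel_measurable_continuous_onI continuous_at_imp_continuous_on ballI cont)
  have g1: "\<bar>gauss_defect y\<bar> \<le> 1" for y by (simp add: gauss_defect_def)
  have int_k: "integrable (\<mu> n) gauss_defect" for n
    by (rule integrable_\<mu>I[where B=1]) (use g1 in auto)
  have B: "0 \<le> B" using bound[of 0] by linarith
  have b: "\<bar>\<Phi> y * gauss_defect y\<bar> \<le> B * gauss_defect y" for y
    using bound[of y] by (simp add: abs_mult mult_right_mono)
  have int_\<mu>: "integrable (\<mu> n) (\<lambda>y. \<Phi> y * gauss_defect y)" for n
    by (rule Bochner_Integration.integrable_bound[OF integrable_mult_right[OF int_k[of n], of B]])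
       (use b B in \<open>auto simp: abs_mult\<close>)
  have int_\<nu>: "integrable \<nu> (\<lambda>y. \<Phi> y * gauss_defect y)"
    by (rule Bochner_Integration.integrable_bound[OF integrable_mult_right[OF integrable_gauss_defect, of B]])
       (use b B in \<open>auto simp: abs_mult\<close>)
  have m'_nonneg: "0 \<le> (LINT y|\<nu>. gauss_defect y)" by (intro integral_nonneg_AE) simp
  show ?thesis
  proof (cases "m' = 0")
    \<comment> \<open>The limiting measure is zero and has no normalisation; here the integrals are
      at most B times the masses, which tend to 0.\<close>
    case True
    then have z: "(LINT y|\<nu>. gauss_defect y) = 0" "\<sigma>2 = 0"
      using m'_nonneg variance_nonneg unfolding m'_def by linarith+
    have "\<bar>(LINT y|\<nu>. \<Phi> y * gauss_defect y)\<bar> \<le> (LINT y|\<nu>. B * gauss_defect y)"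
      using b by (intro order_trans[OF integral_abs_bound] integral_mono integrable_abs int_\<nu>) (simp_all add: integrable_gauss_defect)
    then have "(LINT y|\<nu>. \<Phi> y * gauss_defect y) = 0" using z by simp
    moreover have "(\<lambda>n. (LINT y|\<mu> n. \<Phi> y * gauss_defect y) / h n) \<longlonglongrightarrow> 0"
    proof (rule Lim_null_comparison)
      have "\<bar>(LINT y|\<mu> n. \<Phi> y * gauss_defect y)\<bar> \<le> (LINT y|\<mu> n. B * gauss_defect y)" for n
        using b by (intro order_trans[OF integral_abs_bound] integral_mono integrable_abs int_\<mu>) (simp_all add: int_k)
      then show "\<forall>\<^sub>F n in sequentially. norm ((LINT y|\<mu> n. \<Phi> y * gauss_defect y) / h n) \<le> B * m n"
        using h_pos by (intro always_eventually allI) (simp add: m_def abs_divide abs_of_pos divide_right_mono less_imp_le)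
      show "(\<lambda>n. B * m n) \<longlonglongrightarrow> 0" using tendsto_mult[OF tendsto_const m, of B] True by simp
    qed
    ultimately show ?thesis using z by simp
  next
    case False
    then have m'_pos: "0 < m'" using m'_nonneg variance_nonneg unfolding m'_def by linarith
    obtain Q' where Q': "real_distribution Q'"
      "\<And>(g :: real \<Rightarrow> complex) B. g \<in> borel_measurable borel \<Longrightarrow> (\<And>y. norm (g y) \<le> B) \<Longrightarrow>
         integral\<^sup>L Q' g = ((CLINT y|\<nu>. g y * complex_of_real (gauss_defect y)) + g 0 * complex_of_real (\<sigma>2 / 2)) / complex_of_real m'"
      using density_plus_atom[of \<nu> gauss_defect "\<sigma>2 / 2"] m'_pos integrable_gauss_defect variance_nonneg
      by (auto simp: m'_def)
    \<comment> \<open>For an n with mass 0 any law serves as a placeholder; since the masses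
      converge to a positive number, this concerns finitely many n.\<close>
    have "\<exists>Q. real_distribution Q \<and> (0 < m n \<longrightarrow> (\<forall>(g :: real \<Rightarrow> complex) B. g \<in> borel_measurable borel \<longrightarrow> (\<forall>y. norm (g y) \<le> B) \<longrightarrow>
         integral\<^sup>L Q g = ((CLINT y|\<mu> n. g y * complex_of_real (gauss_defect y)) / complex_of_real (h n)) / complex_of_real (m n)))" for n
    proof (cases "0 < m n")
      case True
      have *: "(LINT y|\<mu> n. gauss_defect y) = m n * h n" using h_pos[of n] by (simp add: m_def)
      obtain Q where Q: "real_distribution Q"
      "\<And>(g :: real \<Rightarrow> complex) B. g \<in> borel_measurable borel \<Longrightarrow> (\<And>y. norm (g y) \<le> B) \<Longrightarrow>
         integral\<^sup>L Q g = ((CLINT y|\<mu> n. g y * complex_of_real (gauss_defect y)) + g 0 * complex_of_real 0) / complex_of_real (m n * h n + 0)"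
        using density_plus_atom[of "\<mu> n" gauss_defect 0] True int_k * h_pos[of n]
        by (auto simp: zero_less_mult_iff)
      then show ?thesis by (intro exI[of _ Q]) (auto simp: mult.commute)
    next
      case False then show ?thesis using Q'(1) by blast
    qed
    then obtain Q where Q: "\<And>n. real_distribution (Q n)"
      "\<And>n (g :: real \<Rightarrow> complex) B. 0 < m n \<Longrightarrow> g \<in> borel_measurable borel \<Longrightarrow> (\<And>y. norm (g y) \<le> B) \<Longrightarrow>
         integral\<^sup>L (Q n) g = ((CLINT y|\<mu> n. g y * complex_of_real (gauss_defect y)) / complex_of_real (h n)) / complex_of_real (m n)"
      by metis
    have ev: "\<forall>\<^sub>F n in sequentially. 0 < m n" using m m'_pos by (rule order_tendstoD)
    have m_c: "(\<lambda>n. complex_of_real (m n)) \<longlonglongrightarrow> complex_of_real m'" by (rule tendsto_of_real[OF m])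
    have "(\<lambda>n. char (Q n) u) \<longlonglongrightarrow> char Q' u" for u
    proof -
      have iexp_meas: "(\<lambda>y. iexp (u * y)) \<in> borel_measurable borel" by simp
      have iexp_bd: "norm (iexp (u * y)) \<le> 1" for y by (simp del: of_real_mult)
      have "(\<lambda>n. ((CLINT y|\<mu> n. iexp (u * y) * complex_of_real (gauss_defect y)) / complex_of_real (h n)) / complex_of_real (m n))
          \<longlonglongrightarrow> ((CLINT y|\<nu>. iexp (u * y) * complex_of_real (gauss_defect y)) + complex_of_real (\<sigma>2 / 2)) / complex_of_real m'"
        by (intro tendsto_divide iexp_gauss_defect_tendsto m_c) (use m'_pos in simp)
      also have "((CLINT y|\<nu>. iexp (u * y) * complex_of_real (gauss_defect y)) + complex_of_real (\<sigma>2 / 2)) / complex_of_real m' = char Q' u"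
        unfolding char_def by (subst Q'(2)[OF iexp_meas iexp_bd]) simp
      finally show ?thesis
        by (rule Lim_transform_eventually)
           (use ev in eventually_elim, simp only: char_def Q(2)[OF _ iexp_meas iexp_bd])
    qed
    from levy_continuity[OF Q(1) Q'(1) this] have weak: "weak_conv_m Q Q'" .
    define \<Phi>' where "\<Phi>' y = complex_of_real (\<Phi> y)" for y
    have \<Phi>': "\<Phi>' \<in> borel_measurable borel" "norm (\<Phi>' y) \<le> B" "isCont \<Phi>' y" for y
      using bound cont by (auto simp: \<Phi>'_def[abs_def] intro!: continuous_intros)
    have "(\<lambda>n. integral\<^sup>L (Q n) \<Phi>') \<longlonglongrightarrow> integral\<^sup>L Q' \<Phi>'"
      by (rule weak_conv_imp_integral_bdd_continuous_conv[OF Q(1) Q'(1) weak \<Phi>'(3,2)])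
    from tendsto_mult[OF this m_c]
    have "(\<lambda>n. integral\<^sup>L (Q n) \<Phi>' * complex_of_real (m n)) \<longlonglongrightarrow> integral\<^sup>L Q' \<Phi>' * complex_of_real m'" .
    also have "integral\<^sup>L Q' \<Phi>' * complex_of_real m' = (CLINT y|\<nu>. \<Phi>' y * complex_of_real (gauss_defect y)) + \<Phi>' 0 * complex_of_real (\<sigma>2 / 2)"
      using m'_pos by (subst Q'(2)[OF \<Phi>'(1,2)]) simp
    also have "\<dots> = complex_of_real ((LINT y|\<nu>. \<Phi> y * gauss_defect y) + \<sigma>2 / 2 * \<Phi> 0)"
      unfolding \<Phi>'_def of_real_mult[symmetric] integral_complex_of_real by simp
    finally have "(\<lambda>n. complex_of_real ((LINT y|\<mu> n. \<Phi> y * gauss_defect y) / h n)) \<longlonglongrightarrow> complex_of_real ((LINT y|\<nu>. \<Phi> y * gauss_defect y) + \<sigma>2 / 2 * \<Phi> 0)"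
    proof (rule Lim_transform_eventually, use ev in eventually_elim)
      fix n assume "0 < m n"
      then show "integral\<^sup>L (Q n) \<Phi>' * complex_of_real (m n) = complex_of_real ((LINT y|\<mu> n. \<Phi> y * gauss_defect y) / h n)"
        unfolding \<Phi>'_def of_real_divide integral_complex_of_real[symmetric]
        by (subst Q(2)[OF _ \<Phi>'(1,2), unfolded \<Phi>'_def]) auto
    qed
    then show ?thesis by (simp only: tendsto_of_real_iff)
  qed
qed

end

section \<open>Taylor estimates and compactly supported C^2 functions\<close>

lemma taylor_second_order:
  fixes f :: "real \<Rightarrow> real"
  assumes f: "\<And>x. (f has_real_derivative f1 x) (at x)" "\<And>x. (f1 has_real_derivative f2 x) (at x)"
  obtains z where "min x (x + y) \<le> z" "z \<le> max x (x + y)" "f (x + y) = f x + y * f1 x + y\<^sup>2 / 2 * f2 z"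
proof (cases "y = 0")
  case True then show ?thesis by (intro that[of x]) auto
next
  case False
  \<comment> \<open>\<open>Taylor\<close> expects a whole sequence of derivatives; it is used up to
    order 2 only, so f2 also fills the later entries.\<close>
  define diff where "diff m = (if m = 0 then f else if m = 1 then f1 else f2)" for m :: nat
  obtain t where t: "if x + y < x then x + y < t \<and> t < x else x < t \<and> t < x + y"
      "f (x + y) = (\<Sum>m<2. (diff m x / fact m) * (x + y - x)^m) + (diff 2 t / fact 2) * (x + y - x)^2"
  proof -
    have "\<forall>m t. m < 2 \<and> min x (x + y) \<le> t \<and> t \<le> max x (x + y) \<longrightarrow> (diff m has_real_derivative diff (Suc m) t) (at t)"
      using f by (auto simp: diff_def less_2_cases_iff)
    then have "\<exists>t. (if x + y < x then x + y < t \<and> t < x else x < t \<and> t < x + y) \<and>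
      f (x + y) = (\<Sum>m<2. (diff m x / fact m) * (x + y - x)^m) + (diff 2 t / fact 2) * (x + y - x)^2"
      using False by (intro Taylor[where a="min x (x + y)" and b="max x (x + y)"]) (auto simp: diff_def)
    then show ?thesis using that by blast
  qed
  show ?thesis
    by (rule that[of t]) (use t in \<open>auto simp: diff_def numeral_2_eq_2 split: if_splits\<close>)
qed

lemma abs_sin_minus_self_cubic: "\<bar>sin y - y\<bar> \<le> \<bar>y\<bar> ^ 3 / 6" for y :: real
proof -
  have "(\<Sum>m<3. sin_coeff m * y ^ m) = y" by (simp add: sin_coeff_def eval_nat_numeral)
  moreover have "(fact 3 :: real) = 6" by (simp add: fact_numeral)
  ultimately show ?thesis using Maclaurin_sin_bound[of y 3] by simp
qed

lemma abs_sin_minus_self_le: "\<bar>sin y - y\<bar> \<le> \<bar>y\<bar> * y\<^sup>2 / 2" for y :: real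
proof -
  have "\<bar>y\<bar> ^ 3 = \<bar>y\<bar> * y\<^sup>2" by (simp add: power3_eq_cube power2_eq_square)
  then show ?thesis using abs_sin_minus_self_cubic[of y] zero_le_power[of "\<bar>y\<bar>" 3] by linarith
qed

text \<open>The function sin serves as truncation: it is bounded, differs from y by a cubic term,
  and its mean can be read off the characteristic function. The factor 8 is 3 divided by the 3/8 of
  \<open>gauss_defect_ge\<close>.\<close>

lemma increment_bound_gauss_defect:
  fixes g :: "real \<Rightarrow> real"
  assumes g: "\<And>x. (g has_real_derivative g1 x) (at x)" "\<And>x. (g1 has_real_derivative g2 x) (at x)"
    and A: "\<And>x. \<bar>g x\<bar> \<le> A" "\<And>x. \<bar>g1 x\<bar> \<le> A" "\<And>x. \<bar>g2 x\<bar> \<le> A"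
  shows "\<bar>g (x + y) - g x - sin y * g1 x\<bar> \<le> 8 * A * gauss_defect y"
proof -
  have A0: "0 \<le> A" using A(1)[of 0] by linarith
  have "\<bar>g (x + y) - g x - sin y * g1 x\<bar> \<le> 3 * A * min 1 (y\<^sup>2)"
  proof (cases "\<bar>y\<bar> \<le> 1")
    case True
    then have y: "min 1 (y\<^sup>2) = y\<^sup>2" using abs_square_le_1[of y] by simp
    obtain z where z: "g (x + y) = g x + y * g1 x + y\<^sup>2 / 2 * g2 z"
      by (rule taylor_second_order[OF g])
    have "g (x + y) - g x - sin y * g1 x = y\<^sup>2 / 2 * g2 z - (sin y - y) * g1 x"
      unfolding z by (simp add: algebra_simps)
    also have "\<bar>\<dots>\<bar> \<le> y\<^sup>2 / 2 * \<bar>g2 z\<bar> + \<bar>sin y - y\<bar> * \<bar>g1 x\<bar>"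
      by (rule order_trans[OF abs_triangle_ineq4]) (simp add: abs_mult)
    also have "\<dots> \<le> y\<^sup>2 / 2 * A + y\<^sup>2 / 2 * A"
    proof (intro add_mono mult_mono)
      have "\<bar>y\<bar> * y\<^sup>2 \<le> 1 * y\<^sup>2" using True by (intro mult_right_mono) auto
      then show "\<bar>sin y - y\<bar> \<le> y\<^sup>2 / 2" using abs_sin_minus_self_le[of y] by simp
    qed (use A A0 in auto)
    also have "\<dots> \<le> 3 * A * y\<^sup>2" using A0 by (simp add: algebra_simps)
    finally show ?thesis using y by simp
  next
    case False
    then have y: "min 1 (y\<^sup>2) = 1" using abs_square_le_1[of y] by simp
    have "\<bar>sin y * g1 x\<bar> \<le> 1 * A" unfolding abs_mult by (intro mult_mono) (use A A0 in auto)
    then show ?thesis using A(1)[of x] A(1)[of "x + y"] y by linarith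
  qed
  also have "\<dots> = 8 * A * (3 / 8 * min 1 (y\<^sup>2))" by simp
  also have "\<dots> \<le> 8 * A * gauss_defect y"
    using A0 gauss_defect_ge[of y] by (intro mult_left_mono) auto
  finally show ?thesis .
qed

lemma gauss_defect_over_square: "((\<lambda>y. gauss_defect y / y\<^sup>2) \<longlongrightarrow> 1 / 2) (at 0)"
proof -
  have "((\<lambda>z::real. (exp z - 1) / z) \<longlongrightarrow> 1) (at 0)"
    using DERIV_exp[of "0::real"] unfolding DERIV_def by simp
  moreover have "filterlim (\<lambda>y::real. - (y\<^sup>2) / 2) (at 0) (at 0)"
    unfolding filterlim_at
  proof
    show "\<forall>\<^sub>F y in at 0. - (y\<^sup>2) / 2 \<in> UNIV \<and> - (y\<^sup>2) / 2 \<noteq> (0::real)"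
      by (auto simp: eventually_at_filter)
    have "((\<lambda>y::real. - (y\<^sup>2) / 2) \<longlongrightarrow> - (0\<^sup>2) / 2) (at 0)" by (intro tendsto_intros) auto
    then show "((\<lambda>y::real. - (y\<^sup>2) / 2) \<longlongrightarrow> 0) (at 0)" by simp
  qed
  ultimately have "((\<lambda>y::real. (exp (- (y\<^sup>2) / 2) - 1) / (- (y\<^sup>2) / 2)) \<longlongrightarrow> 1) (at 0)" by (rule filterlim_compose)
  from tendsto_mult[OF this tendsto_const[of "1/2"]]
  have "((\<lambda>y::real. (exp (- (y\<^sup>2) / 2) - 1) / (- (y\<^sup>2) / 2) * (1 / 2)) \<longlongrightarrow> 1 / 2) (at 0)" by simp
  then show ?thesis
    by (rule Lim_transform_eventually) (auto simp: eventually_at_filter gauss_defect_def field_simps)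
qed

text \<open>Numerator and defect are y^2 / 2 * g2 x and y^2 / 2 to leading order. So the quotient
  extends continuously by g2 x at 0, and the atom there turns into the second-order term of the
  generator.\<close>

lemma increment_quotient_tendsto:
  fixes g :: "real \<Rightarrow> real"
  assumes g: "\<And>x. (g has_real_derivative g1 x) (at x)" "\<And>x. (g1 has_real_derivative g2 x) (at x)"
    and cont: "isCont g2 x"
  shows "((\<lambda>y. (g (x + y) - g x - sin y * g1 x) / gauss_defect y) \<longlongrightarrow> g2 x) (at 0)"
proof -
  have "\<exists>z. min x (x + y) \<le> z \<and> z \<le> max x (x + y) \<and> g (x + y) = g x + y * g1 x + y\<^sup>2 / 2 * g2 z" for y
    using taylor_second_order[OF g] by metis
  then obtain z where z: "\<And>y. min x (x + y) \<le> z y" "\<And>y. z y \<le> max x (x + y)"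
    "\<And>y. g (x + y) = g x + y * g1 x + y\<^sup>2 / 2 * g2 (z y)" by metis
  have "\<bar>z y - x\<bar> \<le> \<bar>y\<bar>" for y using z(1,2)[of y] by (auto simp: min_def max_def split: if_splits)
  moreover have abs0: "((\<lambda>y::real. \<bar>y\<bar>) \<longlongrightarrow> 0) (at 0)" by (rule tendsto_rabs_zero[OF tendsto_ident_at])
  ultimately have "((\<lambda>y. z y - x) \<longlongrightarrow> 0) (at 0)"
    by (intro Lim_null_comparison[OF always_eventually abs0]) simp
  then have "(z \<longlongrightarrow> x) (at 0)" by (simp add: LIM_zero_iff)
  with cont have g2: "((\<lambda>y. g2 (z y)) \<longlongrightarrow> g2 x) (at 0)" by (rule isCont_tendsto_compose)
  have s: "((\<lambda>y::real. (sin y - y) / y\<^sup>2) \<longlongrightarrow> 0) (at 0)"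
  proof (rule Lim_null_comparison[where g="\<lambda>y. \<bar>y\<bar> / 2"])
    show "\<forall>\<^sub>F y::real in at 0. norm ((sin y - y) / y\<^sup>2) \<le> \<bar>y\<bar> / 2"
      using abs_sin_minus_self_le by (auto simp: eventually_at_filter field_simps)
    show "((\<lambda>y::real. \<bar>y\<bar> / 2) \<longlongrightarrow> 0) (at 0)" using tendsto_divide_zero[OF abs0] .
  qed
  have "((\<lambda>y. (1 / 2 * g2 (z y) - (sin y - y) / y\<^sup>2 * g1 x) / (gauss_defect y / y\<^sup>2)) \<longlongrightarrow> (1 / 2 * g2 x - 0 * g1 x) / (1 / 2)) (at 0)"
    by (intro tendsto_intros g2 s gauss_defect_over_square) auto
  then have "((\<lambda>y. (1 / 2 * g2 (z y) - (sin y - y) / y\<^sup>2 * g1 x) / (gauss_defect y / y\<^sup>2)) \<longlongrightarrow> g2 x) (at 0)" by simp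
  then show ?thesis
  proof (rule Lim_transform_eventually)
    show "\<forall>\<^sub>F y in at 0. (1 / 2 * g2 (z y) - (sin y - y) / y\<^sup>2 * g1 x) / (gauss_defect y / y\<^sup>2)
        = (g (x + y) - g x - sin y * g1 x) / gauss_defect y"
      unfolding eventually_at_filter
    proof (intro always_eventually allI impI)
      fix y :: real assume "y \<noteq> 0"
      then have "1 / 2 * g2 (z y) - (sin y - y) / y\<^sup>2 * g1 x = (g (x + y) - g x - sin y * g1 x) / y\<^sup>2"
        unfolding z(3) by (simp add: field_simps)
      then show "(1 / 2 * g2 (z y) - (sin y - y) / y\<^sup>2 * g1 x) / (gauss_defect y / y\<^sup>2)
          = (g (x + y) - g x - sin y * g1 x) / gauss_defect y"
        using \<open>y \<noteq> 0\<close> by simp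
    qed
  qed
qed

text \<open>The Arzela-Ascoli argument: the limit inherits the modulus of continuity, and a finite
  net of the interval reduces uniform convergence to finitely many points, with e / 3 for each of
  the three differences.\<close>

lemma equicontinuous_pointwise_imp_uniform:
  fixes D :: "nat \<Rightarrow> real \<Rightarrow> real"
  assumes equi: "\<And>e. 0 < e \<Longrightarrow> \<exists>d>0. \<forall>n x x'. \<bar>x - x'\<bar> < d \<longrightarrow> \<bar>D n x - D n x'\<bar> \<le> e"
    and lim: "\<And>x. (\<lambda>n. D n x) \<longlonglongrightarrow> L x" and "0 < e"
  shows "\<forall>\<^sub>F n in sequentially. \<forall>x\<in>{-R..R}. \<bar>D n x - L x\<bar> \<le> e"
proof -
  obtain d where d: "d > 0" "\<And>n x x'. \<bar>x - x'\<bar> < d \<Longrightarrow> \<bar>D n x - D n x'\<bar> \<le> e / 3"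
    using equi[of "e / 3"] \<open>0 < e\<close> by auto
  have dL: "\<bar>L x - L x'\<bar> \<le> e / 3" if "\<bar>x - x'\<bar> < d" for x x'
    by (rule tendsto_le[OF trivial_limit_sequentially tendsto_const tendsto_rabs[OF tendsto_diff[OF lim lim]]])
       (use d(2)[OF that] in auto)
  obtain k where k: "finite k" "{-R..R} \<subseteq> (\<Union>x\<in>k. ball x d)"
    using compact_Icc[of "-R" R] d(1) unfolding compact_eq_totally_bounded by blast
  have "\<forall>\<^sub>F n in sequentially. \<forall>x\<in>k. \<bar>D n x - L x\<bar> < e / 3"
    using k(1) tendstoD[OF lim, of "e / 3"] \<open>0 < e\<close> by (intro eventually_ball_finite ballI) (simp_all add: dist_real_def)
  then show ?thesis
  proof eventually_elim
    case (elim n)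
    show ?case
    proof
      fix x assume "x \<in> {-R..R}"
      then obtain x' where x': "x' \<in> k" "\<bar>x - x'\<bar> < d"
        using k(2) by (force simp: dist_real_def abs_minus_commute)
      have "\<bar>D n x' - L x'\<bar> < e / 3" using elim x' by blast
      then show "\<bar>D n x - L x\<bar> \<le> e" using d(2)[OF x'(2), of n] dL[OF x'(2)] by linarith
    qed
  qed
qed

text \<open>The derivatives are explicit arguments so that the generator can be written with them
  and computed for products and rescalings.\<close>

definition C2_compact :: "(real \<Rightarrow> real) \<Rightarrow> (real \<Rightarrow> real) \<Rightarrow> (real \<Rightarrow> real) \<Rightarrow> bool" where
  "C2_compact f f1 f2 \<longleftrightarrow> (\<forall>x. (f has_real_derivative f1 x) (at x)) \<and> (\<forall>x. (f1 has_real_derivative f2 x) (at x))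
     \<and> continuous_on UNIV f2 \<and> (\<exists>R. \<forall>x. R < \<bar>x\<bar> \<longrightarrow> f x = 0)"

lemma compact_support_bounded:
  fixes g :: "real \<Rightarrow> real"
  assumes "continuous_on UNIV g" "\<And>x. R < \<bar>x\<bar> \<Longrightarrow> g x = 0"
  shows "\<exists>A. \<forall>x. \<bar>g x\<bar> \<le> A"
proof -
  have "compact (g ` {-R..R})"
    using assms(1) by (intro compact_continuous_image) (auto intro: continuous_on_subset)
  then obtain A where A: "\<forall>y\<in>{-R..R}. \<bar>g y\<bar> \<le> A"
    by (auto dest!: compact_imp_bounded simp: bounded_iff)
  have "\<bar>g x\<bar> \<le> max A 0" for x
    using A assms(2)[of x] by (cases "R < \<bar>x\<bar>") (force simp: le_max_iff_disj)+
  then show ?thesis by blast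
qed

lemma compact_support_uniformly_continuous:
  fixes g :: "real \<Rightarrow> real"
  assumes "continuous_on UNIV g" "\<And>x. R < \<bar>x\<bar> \<Longrightarrow> g x = 0" "0 < e"
  shows "\<exists>d>0. \<forall>x x'. \<bar>x - x'\<bar> < d \<longrightarrow> \<bar>g x - g x'\<bar> < e"
proof -
  have "uniformly_continuous_on {-R-1..R+1} g"
    using assms(1) by (intro compact_uniformly_continuous) (auto intro: continuous_on_subset)
  then obtain d where d: "d > 0" "\<And>x x'. x \<in> {-R-1..R+1} \<Longrightarrow> x' \<in> {-R-1..R+1} \<Longrightarrow> \<bar>x' - x\<bar> < d \<Longrightarrow> \<bar>g x' - g x\<bar> < e"
    using \<open>0 < e\<close> unfolding uniformly_continuous_on_def dist_real_def by meson
  have "\<bar>g x - g x'\<bar> < e" if "\<bar>x - x'\<bar> < min d 1" for x x'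
  proof (cases "x \<in> {-R-1..R+1} \<and> x' \<in> {-R-1..R+1}")
    case True then show ?thesis using d(2)[of x' x] that by auto
  next
    case False
    then have "R < \<bar>x\<bar>" "R < \<bar>x'\<bar>" using that by auto
    then show ?thesis using assms by simp
  qed
  then show ?thesis using d(1) by (intro exI[of _ "min d 1"]) auto
qed

lemma C2_compact_facts:
  assumes "C2_compact f f1 f2"
  shows "continuous_on UNIV f" "continuous_on UNIV f1" "continuous_on UNIV f2"
    and "\<exists>R. \<forall>x. R < \<bar>x\<bar> \<longrightarrow> f x = 0 \<and> f1 x = 0 \<and> f2 x = 0"
proof -
  have d: "(f has_real_derivative f1 x) (at x)" "(f1 has_real_derivative f2 x) (at x)" for x
    using assms by (auto simp: C2_compact_def)
  show "continuous_on UNIV f" "continuous_on UNIV f1"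
    using d by (auto intro!: continuous_at_imp_continuous_on DERIV_isCont)
  show "continuous_on UNIV f2" using assms by (simp add: C2_compact_def)
  obtain R where R: "\<And>x. R < \<bar>x\<bar> \<Longrightarrow> f x = 0" using assms by (auto simp: C2_compact_def)
  have op: "open {x::real. R < \<bar>x\<bar>}" by (intro open_Collect_less continuous_intros)
  \<comment> \<open>The function vanishes on a whole open set, hence so does its derivative there;
    this is applied to f and then to f1.\<close>
  have zero: "D = 0" if "(g has_real_derivative D) (at x)" "R < \<bar>x\<bar>" "\<And>x. R < \<bar>x\<bar> \<Longrightarrow> g x = 0" for g D x
  proof -
    have "((\<lambda>_. 0) has_real_derivative D) (at x)"
      using that(1) by (rule has_field_derivative_transform_within_open[OF _ op]) (use that in auto)
    then show ?thesis by (rule DERIV_unique) simp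
  qed
  have R1: "f1 x = 0" if "R < \<bar>x\<bar>" for x using zero[OF d(1) that R] .
  have "f2 x = 0" if "R < \<bar>x\<bar>" for x using zero[OF d(2) that R1] .
  then show "\<exists>R. \<forall>x. R < \<bar>x\<bar> \<longrightarrow> f x = 0 \<and> f1 x = 0 \<and> f2 x = 0" using R R1 by blast
qed

lemma C2_compact_bounded:
  assumes "C2_compact f f1 f2"
  shows "\<exists>A. \<forall>x. \<bar>f x\<bar> \<le> A \<and> \<bar>f1 x\<bar> \<le> A \<and> \<bar>f2 x\<bar> \<le> A"
proof -
  note F = C2_compact_facts[OF assms]
  obtain R where R: "\<And>x. R < \<bar>x\<bar> \<Longrightarrow> f x = 0" "\<And>x. R < \<bar>x\<bar> \<Longrightarrow> f1 x = 0" "\<And>x. R < \<bar>x\<bar> \<Longrightarrow> f2 x = 0" using F(4) by blast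
  obtain A1 A2 A3 where "\<And>x. \<bar>f x\<bar> \<le> A1" "\<And>x. \<bar>f1 x\<bar> \<le> A2" "\<And>x. \<bar>f2 x\<bar> \<le> A3"
    using compact_support_bounded[where R=R, OF F(1) R(1)] compact_support_bounded[where R=R, OF F(2) R(2)] compact_support_bounded[where R=R, OF F(3) R(3)]
    by blast
  then show ?thesis by (intro exI[of _ "max A1 (max A2 A3)"]) (auto simp: le_max_iff_disj)
qed

lemma C2_compact_uniformly_continuous:
  assumes "C2_compact f f1 f2" "0 < e"
  shows "\<exists>d>0. \<forall>x x'. \<bar>x - x'\<bar> < d \<longrightarrow> \<bar>f x - f x'\<bar> < e \<and> \<bar>f1 x - f1 x'\<bar> < e \<and> \<bar>f2 x - f2 x'\<bar> < e"
proof -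
  note F = C2_compact_facts[OF assms(1)]
  obtain R where R: "\<And>x. R < \<bar>x\<bar> \<Longrightarrow> f x = 0" "\<And>x. R < \<bar>x\<bar> \<Longrightarrow> f1 x = 0" "\<And>x. R < \<bar>x\<bar> \<Longrightarrow> f2 x = 0" using F(4) by blast
  obtain d1 where d1: "d1 > 0" "\<forall>x x'. \<bar>x - x'\<bar> < d1 \<longrightarrow> \<bar>f x - f x'\<bar> < e"
    using compact_support_uniformly_continuous[where R=R, OF F(1) R(1) assms(2)] by auto
  obtain d2 where d2: "d2 > 0" "\<forall>x x'. \<bar>x - x'\<bar> < d2 \<longrightarrow> \<bar>f1 x - f1 x'\<bar> < e"
    using compact_support_uniformly_continuous[where R=R, OF F(2) R(2) assms(2)] by auto
  obtain d3 where d3: "d3 > 0" "\<forall>x x'. \<bar>x - x'\<bar> < d3 \<longrightarrow> \<bar>f2 x - f2 x'\<bar> < e"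
    using compact_support_uniformly_continuous[where R=R, OF F(3) R(3) assms(2)] by auto
  have "\<bar>f x - f x'\<bar> < e \<and> \<bar>f1 x - f1 x'\<bar> < e \<and> \<bar>f2 x - f2 x'\<bar> < e"
    if "\<bar>x - x'\<bar> < min d1 (min d2 d3)" for x x'
  proof -
    have "\<bar>x - x'\<bar> < d1" "\<bar>x - x'\<bar> < d2" "\<bar>x - x'\<bar> < d3" using that by linarith+
    then show ?thesis using d1(2) d2(2) d3(2) by blast
  qed
  moreover have "0 < min d1 (min d2 d3)" using d1 d2 d3 by simp
  ultimately show ?thesis by blast
qed

section \<open>The generator and its uniform approximation\<close>

context levy_triplet begin

definition generator :: "(real \<Rightarrow> real) \<Rightarrow> (real \<Rightarrow> real) \<Rightarrow> (real \<Rightarrow> real) \<Rightarrow> real \<Rightarrow> real" where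
  "generator f f1 f2 x = b * f1 x + \<sigma>2 / 2 * f2 x
     + (LINT y|\<nu>. f (x + y) - f x - indicator {y. \<bar>y\<bar> \<le> 1} y * (y * f1 x))"

text \<open>The difference of two truncation functions, which converts between sin and the
  truncation at 1 in the triplet.\<close>

lemma integrable_sin_truncation: "integrable \<nu> (\<lambda>y. sin y - indicator {y. \<bar>y\<bar> \<le> 1} y * y)"
proof (rule integrable_levyI)
  fix y :: real
  show "norm (sin y - indicator {y. \<bar>y\<bar> \<le> 1} y * y) \<le> 1 * min 1 (y\<^sup>2)"
  proof (cases "\<bar>y\<bar> \<le> 1")
    case True
    then have "\<bar>y\<bar> * y\<^sup>2 \<le> 1 * y\<^sup>2" by (intro mult_right_mono) auto
    then have "\<bar>sin y - y\<bar> \<le> y\<^sup>2" using abs_sin_minus_self_le[of y] zero_le_power2[of y] by linarith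
    then show ?thesis using True abs_square_le_1[of y] by simp
  next
    case False then show ?thesis using abs_square_le_1[of y] by simp
  qed
qed simp

end

context levy_small_time begin

text \<open>The mean of sin is the imaginary part of the characteristic function at 1. It replaces
  the mean of the law, which need not exist.\<close>

lemma sin_mean_tendsto:
  "(\<lambda>n. (LINT y|\<mu> n. sin y) / h n) \<longlonglongrightarrow> b + (LINT y|\<nu>. sin y - indicator {y. \<bar>y\<bar> \<le> 1} y * y)"
proof -
  have 1: "Im ((1 - char (\<mu> n) 1) / complex_of_real (h n)) = - ((LINT y|\<mu> n. sin y) / h n)" for n
  proof -
    have "integrable (\<mu> n) (\<lambda>y. iexp (1 * y))"
      by (rule integrable_\<mu>I[where B=1]) (simp_all del: of_real_mult)
    from integral_Im[OF this] have "Im (char (\<mu> n) 1) = (LINT y|\<mu> n. sin y)"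
      by (simp add: char_def Im_exp)
    then show ?thesis by (simp add: Im_divide_of_real)
  qed
  have "Im (CLINT y|\<nu>. psi_kernel 1 y) = - (LINT y|\<nu>. sin y - indicator {y. \<bar>y\<bar> \<le> 1} y * y)"
    using integral_Im[OF integrable_psi_kernel[of 1]]
    by (simp add: psi_kernel_def[abs_def] Im_exp flip: Bochner_Integration.integral_minus)
  then have 2: "Im (\<psi> 1) = - (b + (LINT y|\<nu>. sin y - indicator {y. \<bar>y\<bar> \<le> 1} y * y))"
    by (simp add: levy_exponent_eq)
  have "(\<lambda>n. - ((LINT y|\<mu> n. sin y) / h n)) \<longlonglongrightarrow> - (b + (LINT y|\<nu>. sin y - indicator {y. \<bar>y\<bar> \<le> 1} y * y))"
    using tendsto_Im[OF char_quotient_tendsto[of 1]] unfolding 1 2 .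
  then show ?thesis by (rule tendsto_minus_cancel)
qed

lemma generator_tendsto:
  assumes f: "C2_compact f f1 f2"
  shows "(\<lambda>n. ((LINT y|\<mu> n. f (x + y)) - f x) / h n) \<longlonglongrightarrow> generator f f1 f2 x"
proof -
  have d: "\<And>x. (f has_real_derivative f1 x) (at x)" "\<And>x. (f1 has_real_derivative f2 x) (at x)"
    using f by (auto simp: C2_compact_def)
  note F = C2_compact_facts[OF f]
  obtain A where A: "\<And>x. \<bar>f x\<bar> \<le> A" "\<And>x. \<bar>f1 x\<bar> \<le> A" "\<And>x. \<bar>f2 x\<bar> \<le> A" using C2_compact_bounded[OF f] by blast
  have A0: "0 \<le> A" using A(1)[of 0] by linarith
  have [measurable]: "f \<in> borel_measurable borel" by (intro borel_measurable_continuous_onI F)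
  \<comment> \<open>Splits the increment of f into a bounded continuous function times the defect,
    to which the weak limit applies, and a multiple of sin. The value at 0 is the one that makes it
    continuous.\<close>
  define \<Phi> where "\<Phi> y = (if y = 0 then f2 x else (f (x + y) - f x - sin y * f1 x) / gauss_defect y)" for y
  have \<Phi>: "\<Phi> y * gauss_defect y = f (x + y) - f x - sin y * f1 x" for y
    using gauss_defect_pos[of y] by (cases "y = 0") (simp_all add: \<Phi>_def)
  have \<Phi>_bd: "\<bar>\<Phi> y\<bar> \<le> 8 * A" for y
  proof (cases "y = 0")
    case True then show ?thesis using A(3)[of x] A0 by (simp add: \<Phi>_def)
  next
    case False
    show ?thesis using increment_bound_gauss_defect[OF d A, of x y] gauss_defect_pos[OF False] False
      by (simp add: \<Phi>_def abs_divide field_simps)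
  qed
  have fc: "isCont f z" for z using d(1) by (rule DERIV_isCont)
  have \<Phi>_cont: "isCont \<Phi> y" for y
  proof (cases "y = 0")
    case True
    have "isCont f2 x" using F(3) by (simp add: continuous_on_eq_continuous_at)
    from increment_quotient_tendsto[OF d this]
    have "(\<Phi> \<longlongrightarrow> f2 x) (at 0)"
      by (rule Lim_transform_eventually) (auto simp: eventually_at_filter \<Phi>_def)
    then show ?thesis using True by (simp add: isCont_def \<Phi>_def)
  next
    case False
    have "isCont (\<lambda>y. (f (x + y) - f x - sin y * f1 x) / gauss_defect y) y"
      using gauss_defect_pos[OF False] unfolding gauss_defect_def[abs_def]
      by (intro continuous_intros isCont_o2[OF _ fc]) auto
    moreover have "\<forall>\<^sub>F z in nhds y. \<Phi> z = (f (x + z) - f x - sin z * f1 x) / gauss_defect z"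
      using t1_space_nhds[OF False] by eventually_elim (simp add: \<Phi>_def)
    ultimately show ?thesis using isCont_cong by fastforce
  qed
  have int_f: "integrable (\<mu> n) (\<lambda>y. f (x + y))" for n
    by (rule integrable_\<mu>I[where B=A]) (use A in auto)
  have int_sin: "integrable (\<mu> n) sin" for n by (rule integrable_\<mu>I[where B=1]) auto
  have eq: "((LINT y|\<mu> n. f (x + y)) - f x) / h n =
     (LINT y|\<mu> n. \<Phi> y * gauss_defect y) / h n + f1 x * ((LINT y|\<mu> n. sin y) / h n)" for n
  proof -
    interpret prob_space "\<mu> n" by (rule prob_space_\<mu>)
    have "(LINT y|\<mu> n. \<Phi> y * gauss_defect y) = (LINT y|\<mu> n. f (x + y)) - f x - (LINT y|\<mu> n. sin y) * f1 x"
      unfolding \<Phi> using int_f int_sin prob_space by simp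
    then have "(LINT y|\<mu> n. f (x + y)) - f x = (LINT y|\<mu> n. \<Phi> y * gauss_defect y) + f1 x * (LINT y|\<mu> n. sin y)"
      by (simp add: mult.commute)
    then show ?thesis by (simp add: add_divide_distrib)
  qed
  have "(\<lambda>n. ((LINT y|\<mu> n. f (x + y)) - f x) / h n) \<longlonglongrightarrow>
    (LINT y|\<nu>. \<Phi> y * gauss_defect y) + \<sigma>2 / 2 * \<Phi> 0
      + f1 x * (b + (LINT y|\<nu>. sin y - indicator {y. \<bar>y\<bar> \<le> 1} y * y))"
    unfolding eq by (intro tendsto_intros gauss_defect_weak_limit[OF \<Phi>_cont \<Phi>_bd] sin_mean_tendsto)
  also have "(LINT y|\<nu>. \<Phi> y * gauss_defect y) + \<sigma>2 / 2 * \<Phi> 0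
      + f1 x * (b + (LINT y|\<nu>. sin y - indicator {y. \<bar>y\<bar> \<le> 1} y * y)) = generator f f1 f2 x"
  proof -
    have int1: "integrable \<nu> (\<lambda>y. \<Phi> y * gauss_defect y)"
      unfolding \<Phi>
    proof (rule integrable_levyI)
      fix y
      have "norm (f (x + y) - f x - sin y * f1 x) \<le> 8 * A * gauss_defect y"
        using increment_bound_gauss_defect[OF d A, of x y] by simp
      also have "\<dots> \<le> 8 * A * min 1 (y\<^sup>2)" using A0 gauss_defect_le by (intro mult_left_mono) auto
      finally show "norm (f (x + y) - f x - sin y * f1 x) \<le> 8 * A * min 1 (y\<^sup>2)" .
    qed simp
    have "(LINT y|\<nu>. \<Phi> y * gauss_defect y) + f1 x * (LINT y|\<nu>. sin y - indicator {y. \<bar>y\<bar> \<le> 1} y * y) =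
      (LINT y|\<nu>. \<Phi> y * gauss_defect y + f1 x * (sin y - indicator {y. \<bar>y\<bar> \<le> 1} y * y))"
      using int1 integrable_sin_truncation by simp
    also have "\<dots> = (LINT y|\<nu>. f (x + y) - f x - indicator {y. \<bar>y\<bar> \<le> 1} y * (y * f1 x))"
      unfolding \<Phi> by (intro Bochner_Integration.integral_cong) (auto simp: algebra_simps)
    finally show ?thesis by (simp add: generator_def \<Phi>_def algebra_simps)
  qed
  finally show ?thesis .
qed

text \<open>Equicontinuity in x holds because the difference of two translates of f is itself a C^2
  function, small together with both derivatives by uniform continuity.
  \<open>increment_bound_gauss_defect\<close> for this difference, and the boundedness of the
  convergent sequences of masses and sin-means, give a bound independent of n.\<close>

lemma generator_uniform:
  assumes f: "C2_compact f f1 f2" and "0 < e"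
  shows "\<forall>\<^sub>F n in sequentially. \<forall>x\<in>{-R..R}. \<bar>((LINT y|\<mu> n. f (x + y)) - f x) / h n - generator f f1 f2 x\<bar> \<le> e"
proof (rule equicontinuous_pointwise_imp_uniform[OF _ generator_tendsto[OF f] \<open>0 < e\<close>])
  fix e :: real assume "0 < e"
  have d: "\<And>x. (f has_real_derivative f1 x) (at x)" "\<And>x. (f1 has_real_derivative f2 x) (at x)"
    using f by (auto simp: C2_compact_def)
  obtain A where A: "\<And>x. \<bar>f x\<bar> \<le> A" using C2_compact_bounded[OF f] by blast
  have [measurable]: "f \<in> borel_measurable borel" by (intro borel_measurable_continuous_onI C2_compact_facts[OF f])
  obtain B1 where B1: "\<And>n. \<bar>(LINT y|\<mu> n. gauss_defect y) / h n\<bar> \<le> B1"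
    using gauss_defect_mass_tendsto[THEN convergentI, THEN convergent_imp_Bseq] unfolding Bseq_def real_norm_def by blast
  obtain B2 where B2: "\<And>n. \<bar>(LINT y|\<mu> n. sin y) / h n\<bar> \<le> B2"
    using sin_mean_tendsto[THEN convergentI, THEN convergent_imp_Bseq] unfolding Bseq_def real_norm_def by blast
  have B0: "0 \<le> B1" "0 \<le> B2" using B1[of 0] B2[of 0] by linarith+
  \<comment> \<open>The weights repeat those of the final estimate, 8 times the mass plus the
    sin-mean; the summand 1 keeps K positive.\<close>
  define K where "K = 8 * B1 + B2 + 1"
  have K: "0 < K" using B0 by (simp add: K_def)
  obtain \<delta> where \<delta>: "\<delta> > 0" "\<And>x x'. \<bar>x - x'\<bar> < \<delta> \<Longrightarrow> \<bar>f x - f x'\<bar> < e / K \<and> \<bar>f1 x - f1 x'\<bar> < e / K \<and> \<bar>f2 x - f2 x'\<bar> < e / K"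
    using C2_compact_uniformly_continuous[OF f, of "e / K"] \<open>0 < e\<close> K by auto
  have "\<bar>((LINT y|\<mu> n. f (x + y)) - f x) / h n - ((LINT y|\<mu> n. f (x' + y)) - f x') / h n\<bar> \<le> e"
    if "\<bar>x - x'\<bar> < \<delta>" for n x x'
  proof -
    interpret prob_space "\<mu> n" by (rule prob_space_\<mu>)
    let ?g = "\<lambda>y. f (x + y) - f (x' + y)" and ?g1 = "\<lambda>y. f1 (x + y) - f1 (x' + y)" and ?g2 = "\<lambda>y. f2 (x + y) - f2 (x' + y)"
    have shift: "((\<lambda>y. f (c + y)) has_real_derivative f1 (c + y)) (at y)"
        "((\<lambda>y. f1 (c + y)) has_real_derivative f2 (c + y)) (at y)" for c y
      using d(1)[of "c + y"] DERIV_shift[of f "f1 (c + y)" y c] d(2)[of "c + y"] DERIV_shift[of f1 "f2 (c + y)" y c]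
      by (simp_all add: add.commute)
    have g: "(?g has_real_derivative ?g1 y) (at y)" "(?g1 has_real_derivative ?g2 y) (at y)" for y
      using DERIV_diff[OF shift(1) shift(1)] DERIV_diff[OF shift(2) shift(2)] by blast+
    have bd: "\<bar>?g y\<bar> \<le> e / K" "\<bar>?g1 y\<bar> \<le> e / K" "\<bar>?g2 y\<bar> \<le> e / K" for y
      using \<delta>(2)[of "x + y" "x' + y"] that by auto
    have int_f: "integrable (\<mu> n) (\<lambda>y. f (x + y))" "integrable (\<mu> n) (\<lambda>y. f (x' + y))"
      by (rule integrable_\<mu>I[where B=A]; use A in auto)+
    have int_sin: "integrable (\<mu> n) sin" by (rule integrable_\<mu>I[where B=1]) auto
    have int_k: "integrable (\<mu> n) gauss_defect"
      by (rule integrable_\<mu>I[where B=1]) (auto simp: gauss_defect_def)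
    have split: "((LINT y|\<mu> n. f (x + y)) - f x) - ((LINT y|\<mu> n. f (x' + y)) - f x')
        = (LINT y|\<mu> n. ?g (0 + y) - ?g 0 - sin y * ?g1 0) + ?g1 0 * (LINT y|\<mu> n. sin y)"
      using int_f int_sin prob_space by simp
    have "\<bar>((LINT y|\<mu> n. f (x + y)) - f x) - ((LINT y|\<mu> n. f (x' + y)) - f x')\<bar> \<le> 
        \<bar>(LINT y|\<mu> n. ?g (0 + y) - ?g 0 - sin y * ?g1 0)\<bar> + e / K * \<bar>(LINT y|\<mu> n. sin y)\<bar>"
      unfolding split by (rule order_trans[OF abs_triangle_ineq], unfold abs_mult, intro add_left_mono mult_right_mono bd abs_ge_zero)
    note t1 = this
    have t2: "\<bar>(LINT y|\<mu> n. ?g (0 + y) - ?g 0 - sin y * ?g1 0)\<bar> \<le> (LINT y|\<mu> n. 8 * (e / K) * gauss_defect y)"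
    proof (rule order_trans[OF integral_abs_bound], rule integral_mono)
      show "integrable (\<mu> n) (\<lambda>y. \<bar>?g (0 + y) - ?g 0 - sin y * ?g1 0\<bar>)" using int_f int_sin by simp
      show "integrable (\<mu> n) (\<lambda>y. 8 * (e / K) * gauss_defect y)" using int_k by simp
    qed (rule increment_bound_gauss_defect[OF g bd])
    have t3: "(LINT y|\<mu> n. 8 * (e / K) * gauss_defect y) = 8 * (e / K) * (LINT y|\<mu> n. gauss_defect y)" by simp
    have *: "\<bar>((LINT y|\<mu> n. f (x + y)) - f x) - ((LINT y|\<mu> n. f (x' + y)) - f x')\<bar> \<le>
      8 * (e / K) * (LINT y|\<mu> n. gauss_defect y) + e / K * \<bar>(LINT y|\<mu> n. sin y)\<bar>"
      by (rule order_trans[OF t1 add_right_mono[OF t2[unfolded t3]]])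
    have "\<bar>((LINT y|\<mu> n. f (x + y)) - f x) - ((LINT y|\<mu> n. f (x' + y)) - f x')\<bar> / h n \<le>
      (8 * (e / K) * (LINT y|\<mu> n. gauss_defect y) + e / K * \<bar>(LINT y|\<mu> n. sin y)\<bar>) / h n"
      by (rule divide_right_mono[OF * less_imp_le[OF h_pos]])
    also have "\<dots> = e / K * (8 * ((LINT y|\<mu> n. gauss_defect y) / h n) + \<bar>(LINT y|\<mu> n. sin y) / h n\<bar>)"
      using h_pos[of n] by (simp add: abs_divide add_divide_distrib distrib_left)
    also have "\<dots> \<le> e / K * K"
    proof (rule mult_left_mono)
      show "8 * ((LINT y|\<mu> n. gauss_defect y) / h n) + \<bar>(LINT y|\<mu> n. sin y) / h n\<bar> \<le> K"
        using B1[of n] B2[of n] unfolding K_def by linarith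
    qed (use \<open>0 < e\<close> K in simp)
    also have "\<dots> = e" using K by simp
    finally show ?thesis
      unfolding diff_divide_distrib[symmetric] abs_divide using h_pos[of n] by simp
  qed
  then show "\<exists>d>0. \<forall>n x x'. \<bar>x - x'\<bar> < d \<longrightarrow>
      \<bar>((LINT y|\<mu> n. f (x + y)) - f x) / h n - ((LINT y|\<mu> n. f (x' + y)) - f x') / h n\<bar> \<le> e"
    using \<delta>(1) by blast
qed

end

section \<open>Confinement along dyadic times\<close>

text \<open>Without boundedness the supremum in \<open>sup_norm_path\<close> would be unspecified.
  One-sided limits bound the path near each time, and finitely many such neighbourhoods cover
  [0, 1].\<close>

lemma cadlag_on_unit_bdd_above:
  assumes "cadlag_on_unit f"
  shows "bdd_above ((\<lambda>t. \<bar>f t\<bar>) ` {0..1})"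
proof -
  have "\<exists>d B. 0 < d \<and> (\<forall>s\<in>{0..1}. \<bar>s - t\<bar> < d \<longrightarrow> \<bar>f s\<bar> \<le> B)" if t: "t \<in> {0..1}" for t
  proof -
    have "\<exists>d B. 0 < d \<and> (\<forall>s\<in>{0..1}. t < s \<and> s < t + d \<longrightarrow> \<bar>f s\<bar> \<le> B)"
    proof (cases "t = 1")
      case True then show ?thesis by (intro exI[of _ 1]) auto
    next
      case False
      then have "(f \<longlongrightarrow> f t) (at_right t)" using assms t by (auto simp: cadlag_on_unit_def)
      then have "\<forall>\<^sub>F s in at_right t. dist (f s) (f t) < 1" by (rule tendstoD) simp
      then obtain e where "t < e" "\<forall>s>t. s < e \<longrightarrow> dist (f s) (f t) < 1"
        unfolding eventually_at_right_field by auto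
      then show ?thesis by (intro exI[of _ "e - t"] exI[of _ "\<bar>f t\<bar> + 1"]) (force simp: dist_real_def)
    qed
    then obtain d1 B1 where 1: "0 < d1" "\<And>s. s \<in> {0..1} \<Longrightarrow> t < s \<Longrightarrow> s < t + d1 \<Longrightarrow> \<bar>f s\<bar> \<le> B1" by blast
    have "\<exists>d B. 0 < d \<and> (\<forall>s\<in>{0..1}. t - d < s \<and> s < t \<longrightarrow> \<bar>f s\<bar> \<le> B)"
    proof (cases "t = 0")
      case True then show ?thesis by (intro exI[of _ 1]) auto
    next
      case False
      then obtain l where "(f \<longlongrightarrow> l) (at_left t)" using assms t by (force simp: cadlag_on_unit_def)
      then have "\<forall>\<^sub>F s in at_left t. dist (f s) l < 1" by (rule tendstoD) simp
      then obtain e where "e < t" "\<forall>s>e. s < t \<longrightarrow> dist (f s) l < 1"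
        unfolding eventually_at_left_field by auto
      then show ?thesis by (intro exI[of _ "t - e"] exI[of _ "\<bar>l\<bar> + 1"]) (force simp: dist_real_def)
    qed
    then obtain d2 B2 where 2: "0 < d2" "\<And>s. s \<in> {0..1} \<Longrightarrow> t - d2 < s \<Longrightarrow> s < t \<Longrightarrow> \<bar>f s\<bar> \<le> B2" by blast
    have "\<bar>f s\<bar> \<le> max (max B1 B2) \<bar>f t\<bar>" if "s \<in> {0..1}" "\<bar>s - t\<bar> < min d1 d2" for s
      using 1(2)[of s] 2(2)[of s] that by (cases s t rule: linorder_cases) auto
    then show ?thesis using 1(1) 2(1) by (intro exI[of _ "min d1 d2"] exI[of _ "max (max B1 B2) \<bar>f t\<bar>"]) auto
  qed
  then obtain d B where dB: "\<And>t. t \<in> {0..1} \<Longrightarrow> 0 < d t"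
    "\<And>t s. t \<in> {0..1} \<Longrightarrow> s \<in> {0..1} \<Longrightarrow> \<bar>s - t\<bar> < d t \<Longrightarrow> \<bar>f s\<bar> \<le> B t" by metis
  have "{0..1} \<subseteq> (\<Union>t\<in>{0..1}. ball t (d t))" using dB(1) by auto
  then obtain C where C: "C \<subseteq> {0..1}" "finite C" "{0..1} \<subseteq> (\<Union>t\<in>C. ball t (d t))"
    using compactE_image[OF compact_Icc, of "{0..1::real}" "\<lambda>t. ball t (d t)" 0 1] by (metis open_ball)
  have "\<bar>f s\<bar> \<le> Max (B ` C)" if s: "s \<in> {0..1}" for s
  proof -
    obtain t where "t \<in> C" "s \<in> ball t (d t)" using C(3) s by blast
    then have t: "t \<in> C" "\<bar>s - t\<bar> < d t" by (simp_all add: dist_real_def abs_minus_commute)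
    then have "\<bar>f s\<bar> \<le> B t" using dB(2)[of t s] C(1) s by auto
    also have "\<dots> \<le> Max (B ` C)" using C(2) t(1) by simp
    finally show ?thesis .
  qed
  then show ?thesis by (auto intro!: bdd_aboveI[of _ "Max (B ` C)"])
qed

lemma cadlag_on_unit_le_dyadic:
  assumes f: "cadlag_on_unit f" and dyadic: "\<And>n k. k \<le> 2 ^ n \<Longrightarrow> \<bar>f (real k / 2 ^ n)\<bar> \<le> r" and t: "t \<in> {0..1}"
  shows "\<bar>f t\<bar> \<le> r"
proof (cases "t = 1")
  case True then show ?thesis using dyadic[of 1 0] by simp
next
  case False
  \<comment> \<open>Floor plus 1 instead of the ceiling: the approximating times must lie strictly
    to the right of t even if t is dyadic, since only the right limit is known to be f t. They stay
    in [0, 1] because t < 1.\<close>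
  define k where "k n = nat (\<lfloor>t * 2 ^ n\<rfloor> + 1)" for n :: nat
  define s where "s n = real (k n) / 2 ^ n" for n
  have fl: "real_of_int \<lfloor>t * 2 ^ n\<rfloor> \<le> t * 2 ^ n" "t * 2 ^ n < real_of_int \<lfloor>t * 2 ^ n\<rfloor> + 1" for n
    by linarith+
  have k: "real (k n) = real_of_int \<lfloor>t * 2 ^ n\<rfloor> + 1" for n
    using t by (simp add: k_def)
  have s: "t < s n" "s n \<le> t + (1 / 2) ^ n" for n
    using fl[of n] by (simp_all add: s_def k field_simps power_divide)
  have "k n \<le> 2 ^ n" for n
  proof -
    have "t * 2 ^ n < 2 ^ n" using t False by simp
    then have "\<lfloor>t * 2 ^ n\<rfloor> < 2 ^ n" by (simp add: floor_less_iff)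
    then have "\<lfloor>t * 2 ^ n\<rfloor> + 1 \<le> int (2 ^ n)" by simp
    then show ?thesis unfolding k_def by linarith
  qed
  then have le: "\<bar>f (s n)\<bar> \<le> r" for n using dyadic[of "k n" n] by (simp add: s_def)
  have "s \<longlonglongrightarrow> t"
  proof (rule real_tendsto_sandwich[of "\<lambda>_. t" s])
    show "(\<lambda>n. t + (1 / 2) ^ n) \<longlonglongrightarrow> t"
      using tendsto_add[OF tendsto_const[of t] LIMSEQ_realpow_zero[of "1/2"]] by simp
  qed (use s in \<open>auto intro!: always_eventually less_imp_le\<close>)
  then have "filterlim s (at_right t) sequentially"
    using less_imp_neq[OF s(1)] s(1) by (auto simp: filterlim_at intro!: always_eventually)
  moreover have "(f \<longlongrightarrow> f t) (at_right t)" using f t False by (auto simp: cadlag_on_unit_def)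
  ultimately have "(\<lambda>n. f (s n)) \<longlonglongrightarrow> f t" by (rule filterlim_compose[rotated])
  then have "(\<lambda>n. \<bar>f (s n)\<bar>) \<longlonglongrightarrow> \<bar>f t\<bar>" by (rule tendsto_rabs)
  then show ?thesis by (rule LIMSEQ_le_const2) (use le in auto)
qed

text \<open>Discrete Gronwall inequality. The errors form a geometric sum, each of whose N terms is
  at most d * exp c.\<close>

lemma linear_recursion_lower:
  fixes a :: "nat \<Rightarrow> real"
  assumes step: "\<And>k. k < N \<Longrightarrow> q * a k - d \<le> a (Suc k)" and "0 \<le> q" "0 \<le> d" "q \<le> exp (c / N)" "0 \<le> c" "0 < N"
  shows "q ^ N * a 0 - d * N * exp c \<le> a N"
proof -
  have "q ^ k * a 0 - d * (\<Sum>j<k. q ^ j) \<le> a k" if "k \<le> N" for k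
    using that
  proof (induction k)
    case (Suc k)
    have "q ^ Suc k * a 0 - d * (\<Sum>j<Suc k. q ^ j) = q * (q ^ k * a 0 - d * (\<Sum>j<k. q ^ j)) - d"
      by (simp add: sum.lessThan_Suc_shift sum_distrib_left algebra_simps del: sum.lessThan_Suc)
    also have "\<dots> \<le> q * a k - d" using Suc \<open>0 \<le> q\<close> by (simp add: mult_left_mono)
    also have "\<dots> \<le> a (Suc k)" using step Suc by simp
    finally show ?case .
  qed simp
  from this[of N] have 1: "q ^ N * a 0 - d * (\<Sum>j<N. q ^ j) \<le> a N" by simp
  have "q ^ j \<le> exp c" if "j < N" for j
  proof -
    have "q ^ j \<le> exp (c / N) ^ j" using assms by (intro power_mono)
    also have "\<dots> = exp (real j * (c / N))" by (rule exp_of_nat_mult[symmetric])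
    also have "real j * (c / N) \<le> real N * (c / N)" using that assms by (intro mult_right_mono) auto
    also have "real N * (c / N) = c" using assms by simp
    finally show ?thesis by simp
  qed
  then have "(\<Sum>j<N. q ^ j) \<le> N * exp c" using sum_bounded_above[of "{..<N}" "\<lambda>j. q ^ j" "exp c"] by simp
  then have "d * (\<Sum>j<N. q ^ j) \<le> d * (N * exp c)" using \<open>0 \<le> d\<close> by (intro mult_left_mono)
  then show ?thesis using 1 by (simp add: mult.assoc)
qed

lemma power_dyadic_tendsto_exp: "(\<lambda>n. (1 - K / 2 ^ n) ^ (2 ^ n)) \<longlonglongrightarrow> exp (- K)" for K :: real
proof -
  have "strict_mono (\<lambda>n. 2 ^ n :: nat)" by (intro strict_monoI) simp
  from LIMSEQ_subseq_LIMSEQ[OF tendsto_exp_limit_sequentially[of "- K"] this]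
  show ?thesis by (simp add: o_def)
qed

section \<open>The process along dyadic times as a killed random walk\<close>

locale levy_paths = levy_triplet \<nu> \<sigma>2 b + prob_space M
  for M :: "'a measure" and X :: "real \<Rightarrow> 'a \<Rightarrow> real" and \<nu> \<sigma>2 b +
  assumes levy: "levy_process M X \<nu> \<sigma>2 b"
begin

lemma X_measurable [measurable]: "t \<in> {0..1} \<Longrightarrow> X t \<in> borel_measurable M"
  using levy by (simp add: levy_process_def)

lemma X_0: "\<omega> \<in> space M \<Longrightarrow> X 0 \<omega> = 0"
  using levy by (simp add: levy_process_def)

definition increment_law :: "nat \<Rightarrow> real measure" where
  "increment_law n = distr M borel (X (1 / 2 ^ n))"

lemma dyadic_in_unit: "k \<le> 2 ^ n \<Longrightarrow> real k / 2 ^ n \<in> {0..1}"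
  using of_nat_mono[of k "2 ^ n", where 'a=real] by (simp add: divide_le_eq)

lemma inverse_power_in_unit: "1 / 2 ^ n \<in> {0..1::real}"
  using dyadic_in_unit[of 1 n] by simp

sublocale levy_small_time \<nu> \<sigma>2 b increment_law "\<lambda>n. 1 / 2 ^ n"
proof (intro levy_small_time.intro levy_small_time_axioms.intro)
  fix n u
  show "real_distribution (increment_law n)"
    unfolding increment_law_def using inverse_power_in_unit by (intro real_distribution_distr X_measurable)
  show "char (increment_law n) u = exp (- (complex_of_real (1 / 2 ^ n) * levy_exponent \<nu> \<sigma>2 b u))"
    using levy inverse_power_in_unit[of n] unfolding increment_law_def levy_process_def by blast
  show "(\<lambda>n. 1 / 2 ^ n :: real) \<longlonglongrightarrow> 0"
    using LIMSEQ_realpow_zero[of "1/2"] by (simp add: power_divide)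
qed (use levy_triplet_axioms in simp_all)

definition dyadic_confined :: "real \<Rightarrow> nat \<Rightarrow> nat \<Rightarrow> 'a set" where
  "dyadic_confined r n k = {\<omega> \<in> space M. \<forall>j\<le>k. \<bar>X (real j / 2 ^ n) \<omega>\<bar> \<le> r}"

lemma sets_dyadic_confined: "k \<le> 2 ^ n \<Longrightarrow> dyadic_confined r n k \<in> sets M"
proof -
  assume k: "k \<le> 2 ^ n"
  have "{\<omega> \<in> space M. \<bar>X (real j / 2 ^ n) \<omega>\<bar> \<le> r} \<in> sets M" if "j \<le> k" for j
  proof -
    have [measurable]: "X (real j / 2 ^ n) \<in> borel_measurable M"
      using that k dyadic_in_unit[of j n] by (intro X_measurable) simp
    show ?thesis by measurable
  qed
  then have "space M \<inter> (\<Inter>j\<le>k. {\<omega> \<in> space M. \<bar>X (real j / 2 ^ n) \<omega>\<bar> \<le> r}) \<in> sets M"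
    by (intro sets.Int sets.finite_INT) auto
  moreover have "dyadic_confined r n k = space M \<inter> (\<Inter>j\<le>k. {\<omega> \<in> space M. \<bar>X (real j / 2 ^ n) \<omega>\<bar> \<le> r})"
    by (auto simp: dyadic_confined_def)
  ultimately show ?thesis by simp
qed

lemma sup_norm_path_le_iff:
  assumes "\<omega> \<in> space M"
  shows "sup_norm_path X \<omega> \<le> r \<longleftrightarrow> (\<forall>n. \<omega> \<in> dyadic_confined r n (2 ^ n))"
proof
  have cadlag: "cadlag_on_unit (\<lambda>t. X t \<omega>)" using levy assms by (simp add: levy_process_def)
  note bdd = cadlag_on_unit_bdd_above[OF cadlag]
  show "\<forall>n. \<omega> \<in> dyadic_confined r n (2 ^ n)" if "sup_norm_path X \<omega> \<le> r"
    using that assms cSUP_upper[OF dyadic_in_unit bdd]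
    unfolding sup_norm_path_def dyadic_confined_def by force
  show "sup_norm_path X \<omega> \<le> r" if "\<forall>n. \<omega> \<in> dyadic_confined r n (2 ^ n)"
    unfolding sup_norm_path_def
  proof (rule cSUP_least)
    fix t :: real assume t: "t \<in> {0..1}"
    have dy: "\<bar>X (real k / 2 ^ n) \<omega>\<bar> \<le> r" if "k \<le> 2 ^ n" for n k
      using \<open>\<forall>n. \<omega> \<in> dyadic_confined r n (2 ^ n)\<close> that unfolding dyadic_confined_def by blast
    show "\<bar>X t \<omega>\<bar> \<le> r" by (rule cadlag_on_unit_le_dyadic[OF cadlag dy t])
  qed simp
qed

text \<open>The grids are nested: the point with index j is the point with index 2 j of the next
  grid. By right-continuity the intersection of these events is confinement at all times.\<close>

lemma dyadic_confined_decseq: "decseq (\<lambda>n. dyadic_confined r n (2 ^ n))"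
proof (rule decseq_SucI, rule subsetI)
  fix n \<omega> assume \<omega>: "\<omega> \<in> dyadic_confined r (Suc n) (2 ^ Suc n)"
  have "\<bar>X (real j / 2 ^ n) \<omega>\<bar> \<le> r" if "j \<le> 2 ^ n" for j
  proof -
    have "real (2 * j) / 2 ^ Suc n = real j / 2 ^ n" by simp
    moreover have "2 * j \<le> 2 ^ Suc n" using that by simp
    ultimately show ?thesis using \<omega> unfolding dyadic_confined_def by (metis (no_types, lifting) mem_Collect_eq)
  qed
  then show "\<omega> \<in> dyadic_confined r n (2 ^ n)" using \<omega> by (auto simp: dyadic_confined_def)
qed

lemma prob_dyadic_confined_tendsto:
  "(\<lambda>n. prob (dyadic_confined r n (2 ^ n))) \<longlonglongrightarrow> prob {\<omega> \<in> space M. sup_norm_path X \<omega> \<le> r}"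
proof -
  have "(\<Inter>n. dyadic_confined r n (2 ^ n)) = {\<omega> \<in> space M. sup_norm_path X \<omega> \<le> r}"
    using sup_norm_path_le_iff by (auto simp: dyadic_confined_def)
  moreover have "range (\<lambda>n. dyadic_confined r n (2 ^ n)) \<subseteq> events" using sets_dyadic_confined by auto
  ultimately show ?thesis
    using finite_Lim_measure_decseq[OF _ dyadic_confined_decseq, of r] by simp
qed

text \<open>The Markov property at a dyadic time: the past up to step k is a function of the first k
  increments, and the next increment is independent of them with the law of X at time
  \<open>1 / 2 ^ n\<close>.\<close>

lemma dyadic_step:
  fixes f :: "real \<Rightarrow> real"
  assumes k: "k < 2 ^ n" and f[measurable]: "f \<in> borel_measurable borel" and B: "\<And>x. \<bar>f x\<bar> \<le> B"
  shows "expectation (\<lambda>\<omega>. indicator (dyadic_confined r n k) \<omega> * f (X (real (Suc k) / 2 ^ n) \<omega>)) =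
    expectation (\<lambda>\<omega>. indicator (dyadic_confined r n k) \<omega> * (LINT y|increment_law n. f (X (real k / 2 ^ n) \<omega> + y)))"
proof -
  define \<xi> where "\<xi> i \<omega> = X (real (Suc i) / 2 ^ n) \<omega> - X (real i / 2 ^ n) \<omega>" for i \<omega>
  have indep: "indep_vars (\<lambda>_. borel) \<xi> {..<2 ^ n}"
  proof -
    have "independent_increments M X" using levy by (simp add: levy_process_def)
    moreover have "(\<forall>i\<le>2 ^ n. real i / 2 ^ n \<in> {0..1}) \<and> (\<forall>i<2 ^ n. real i / 2 ^ n \<le> real (Suc i) / 2 ^ n)"
      using dyadic_in_unit by (auto simp: divide_right_mono)
    ultimately show ?thesis unfolding independent_increments_def \<xi>_def[abs_def] by meson
  qed
  \<comment> \<open>Records all that the step needs of the past: whether the walk was confined so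
    far, and where it is now.\<close>
  define G where "G v = (if \<forall>j\<le>k. \<bar>\<Sum>i<j. v i\<bar> \<le> r then 1 else 0 :: real, \<Sum>i<k. v i)" for v :: "nat \<Rightarrow> real"
  define V where "V = G \<circ> (\<lambda>\<omega>. restrict (\<lambda>i. \<xi> i \<omega>) {..<k})"
  \<comment> \<open>The second coordinate is padding: \<open>indep_var\<close> requires both random
    variables to take values in the same type.\<close>
  define W where "W \<omega> = (\<xi> k \<omega>, 0 :: real)" for \<omega>
  have G_meas: "G \<in> measurable (PiM {..<k} (\<lambda>_. borel)) (borel \<Otimes>\<^sub>M borel)"
  proof -
    have s: "(\<lambda>v. \<Sum>i<j. v i) \<in> borel_measurable (PiM {..<k} (\<lambda>_. borel :: real measure))" if "j \<le> k" for j
      using that by (intro borel_measurable_sum measurable_component_singleton) auto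
    have "Measurable.pred (PiM {..<k} (\<lambda>_. borel :: real measure)) (\<lambda>v. \<forall>j\<in>{..k}. \<bar>\<Sum>i<j. v i\<bar> \<le> r)"
    proof (rule pred_intros_countable_bounded)
      show "Measurable.pred (PiM {..<k} (\<lambda>_. borel :: real measure)) (\<lambda>v. \<bar>\<Sum>i<j. v i\<bar> \<le> r)" if "j \<in> {..k}" for j
      proof -
        have [measurable]: "(\<lambda>v. \<Sum>i<j. v i) \<in> borel_measurable (PiM {..<k} (\<lambda>_. borel :: real measure))" using s that by auto
        show ?thesis by measurable
      qed
    qed
    then have [measurable]: "Measurable.pred (PiM {..<k} (\<lambda>_. borel :: real measure)) (\<lambda>v. \<forall>j\<le>k. \<bar>\<Sum>i<j. v i\<bar> \<le> r)"
      by (simp add: Ball_def)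
    have [measurable]: "(\<lambda>v. \<Sum>i<k. v i) \<in> borel_measurable (PiM {..<k} (\<lambda>_. borel :: real measure))" using s by simp
    show ?thesis unfolding G_def by measurable
  qed
  have "indep_var (PiM {..<k} (\<lambda>_. borel)) (\<lambda>\<omega>. restrict (\<lambda>i. \<xi> i \<omega>) {..<k}) (PiM {k} (\<lambda>_. borel)) (\<lambda>\<omega>. restrict (\<lambda>i. \<xi> i \<omega>) {k})"
    using k by (intro indep_var_restrict[OF indep]) auto
  moreover have m2: "(\<lambda>v. (v k, 0)) \<in> measurable (PiM {k} (\<lambda>_. borel :: real measure)) (borel \<Otimes>\<^sub>M (borel :: real measure))"
  proof -
    have [measurable]: "(\<lambda>v. v k) \<in> measurable (PiM {k} (\<lambda>_. borel :: real measure)) borel"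
      by (rule measurable_component_singleton) simp
    show ?thesis by measurable
  qed
  ultimately have "indep_var (borel \<Otimes>\<^sub>M borel) V (borel \<Otimes>\<^sub>M borel) ((\<lambda>v. (v k, 0)) \<circ> (\<lambda>\<omega>. restrict (\<lambda>i. \<xi> i \<omega>) {k}))"
    unfolding V_def using G_meas by (intro indep_var_compose)
  then have "indep_var (borel \<Otimes>\<^sub>M borel) V (borel \<Otimes>\<^sub>M borel) W"
    by (simp add: o_def W_def[abs_def])
  note D = this[unfolded indep_var_distribution_eq]
  have [measurable]: "V \<in> measurable M (borel \<Otimes>\<^sub>M borel)" "W \<in> measurable M (borel \<Otimes>\<^sub>M borel)" using D by auto
  have \<xi>_meas[measurable]: "\<xi> k \<in> borel_measurable M"
    using dyadic_in_unit[of k n] dyadic_in_unit[of "Suc k" n] k X_measurable unfolding \<xi>_def[abs_def]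
    by (intro borel_measurable_diff) auto
  have telescope: "(\<Sum>i<j. \<xi> i \<omega>) = X (real j / 2 ^ n) \<omega>" if "\<omega> \<in> space M" for j \<omega>
    using sum_lessThan_telescope[of "\<lambda>i. X (real i / 2 ^ n) \<omega>" j] X_0[OF that] by (simp add: \<xi>_def)
  have V: "V \<omega> = (indicator (dyadic_confined r n k) \<omega>, X (real k / 2 ^ n) \<omega>)" if \<omega>: "\<omega> \<in> space M" for \<omega>
  proof -
    have "(\<Sum>i<j. restrict (\<lambda>i. \<xi> i \<omega>) {..<k} i) = X (real j / 2 ^ n) \<omega>" if "j \<le> k" for j
      using that by (subst telescope[OF \<omega>, symmetric]) (intro sum.cong; auto)
    then show ?thesis using \<omega> by (auto simp: V_def G_def dyadic_confined_def)
  qed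
  have law: "distr M borel (\<xi> k) = increment_law n"
  proof -
    have "distr M borel (\<lambda>\<omega>. X (real k / 2 ^ n + 1 / 2 ^ n) \<omega> - X (real k / 2 ^ n) \<omega>) = distr M borel (\<lambda>\<omega>. X (1 / 2 ^ n) \<omega> - X 0 \<omega>)"
    proof -
      have "stationary_increments M X" using levy by (simp add: levy_process_def)
      moreover have "real k / 2 ^ n + 1 / 2 ^ n = real (Suc k) / 2 ^ n" by (simp add: add_divide_distrib)
      then have "0 \<le> real k / 2 ^ n \<and> 0 \<le> (1::real) / 2 ^ n \<and> real k / 2 ^ n + 1 / 2 ^ n \<le> 1"
        using dyadic_in_unit[of "Suc k" n] k by auto
      ultimately show ?thesis unfolding stationary_increments_def by blast
    qed
    moreover have "real k / 2 ^ n + 1 / 2 ^ n = real (Suc k) / 2 ^ n" by (simp add: add_divide_distrib)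
    ultimately show ?thesis unfolding increment_law_def \<xi>_def[abs_def]
      by (simp only:) (intro distr_cong; simp add: X_0)
  qed
  interpret DV: prob_space "distr M (borel \<Otimes>\<^sub>M borel) V" by (rule prob_space_distr) simp
  interpret DW: prob_space "distr M (borel \<Otimes>\<^sub>M borel) W" by (rule prob_space_distr) simp
  interpret P: pair_prob_space "distr M (borel \<Otimes>\<^sub>M borel) V" "distr M (borel \<Otimes>\<^sub>M borel) W" ..
  \<comment> \<open>Clamping the first coordinate makes F bounded on the whole product space, as
    Fubini needs; on the values 0 and 1 taken by V it changes nothing.\<close>
  define F where "F p = (case p of ((a, x), (y, z)) \<Rightarrow> max 0 (min 1 a) * f (x + y))" for p :: "(real \<times> real) \<times> (real \<times> real)"
  have F_meas[measurable]: "F \<in> borel_measurable ((borel \<Otimes>\<^sub>M borel) \<Otimes>\<^sub>M (borel \<Otimes>\<^sub>M borel))" unfolding F_def by measurable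
  have "\<bar>F p\<bar> \<le> 1 * B" for p
  proof -
    obtain a x y z where p: "p = ((a, x), (y, z))" by (metis surj_pair)
    show ?thesis unfolding p F_def prod.case abs_mult by (intro mult_mono B) auto
  qed
  then have F_int: "integrable (distr M (borel \<Otimes>\<^sub>M borel) V \<Otimes>\<^sub>M distr M (borel \<Otimes>\<^sub>M borel) W) F"
    by (intro P.integrable_const_bound[where B="1 * B"]) auto
  have inner: "(LINT w|distr M (borel \<Otimes>\<^sub>M borel) W. F (v, w)) = max 0 (min 1 (fst v)) * (LINT y|increment_law n. f (snd v + y))" for v
  proof -
    have [measurable]: "(\<lambda>w. F (v, w)) \<in> borel_measurable (borel \<Otimes>\<^sub>M borel)"
      by (rule measurable_compose[OF measurable_Pair1' F_meas]) (simp add: space_pair_measure)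
    have "(LINT w|distr M (borel \<Otimes>\<^sub>M borel) W. F (v, w)) = expectation (\<lambda>\<omega>. F (v, W \<omega>))"
      by (subst integral_distr) auto
    also have "\<dots> = max 0 (min 1 (fst v)) * expectation (\<lambda>\<omega>. f (snd v + \<xi> k \<omega>))"
      by (cases v) (simp add: F_def W_def)
    also have "expectation (\<lambda>\<omega>. f (snd v + \<xi> k \<omega>)) = (LINT y|distr M borel (\<xi> k). f (snd v + y))"
      by (subst integral_distr) auto
    finally show ?thesis by (simp only: law)
  qed
  have "expectation (\<lambda>\<omega>. indicator (dyadic_confined r n k) \<omega> * f (X (real (Suc k) / 2 ^ n) \<omega>)) = expectation (\<lambda>\<omega>. F (V \<omega>, W \<omega>))"
    by (intro Bochner_Integration.integral_cong) (auto simp: V W_def F_def \<xi>_def indicator_def)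
  also have "\<dots> = (LINT p|distr M ((borel \<Otimes>\<^sub>M borel) \<Otimes>\<^sub>M (borel \<Otimes>\<^sub>M borel)) (\<lambda>\<omega>. (V \<omega>, W \<omega>)). F p)"
    by (subst integral_distr) auto
  also have "\<dots> = integral\<^sup>L (distr M (borel \<Otimes>\<^sub>M borel) V \<Otimes>\<^sub>M distr M (borel \<Otimes>\<^sub>M borel) W) F"
    using D by simp
  also have "\<dots> = (LINT v|distr M (borel \<Otimes>\<^sub>M borel) V. LINT w|distr M (borel \<Otimes>\<^sub>M borel) W. F (v, w))"
    by (rule P.integral_fst'[symmetric, OF F_int])
  also have "\<dots> = expectation (\<lambda>\<omega>. LINT w|distr M (borel \<Otimes>\<^sub>M borel) W. F (V \<omega>, w))"
    by (subst integral_distr) auto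
  also have "\<dots> = expectation (\<lambda>\<omega>. indicator (dyadic_confined r n k) \<omega> * (LINT y|increment_law n. f (X (real k / 2 ^ n) \<omega> + y)))"
    unfolding inner by (intro Bochner_Integration.integral_cong) (auto simp: V indicator_def)
  finally show ?thesis .
qed

end

section \<open>Sub- and supersolutions bound the confinement probability\<close>

context levy_paths begin

lemma confined_functional_integrable:
  fixes g :: "real \<Rightarrow> real"
  assumes "k \<le> 2 ^ n" "j \<le> 2 ^ n" and g: "g \<in> borel_measurable borel" "\<And>x. \<bar>g x\<bar> \<le> B"
  shows "integrable M (\<lambda>\<omega>. indicator (dyadic_confined r n k) \<omega> * g (X (real j / 2 ^ n) \<omega>))"
proof (rule integrable_const_bound[where B=B])
  have B: "0 \<le> B" using g(2)[of 0] by linarith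
  have [measurable]: "dyadic_confined r n k \<in> sets M" "X (real j / 2 ^ n) \<in> borel_measurable M" "g \<in> borel_measurable borel"
    using assms by (auto intro: sets_dyadic_confined X_measurable dyadic_in_unit)
  show "(\<lambda>\<omega>. indicator (dyadic_confined r n k) \<omega> * g (X (real j / 2 ^ n) \<omega>)) \<in> borel_measurable M" by measurable
  show "AE \<omega> in M. norm (indicator (dyadic_confined r n k) \<omega> * g (X (real j / 2 ^ n) \<omega>)) \<le> B"
    using g B by (auto simp: indicator_def)
qed

lemma confined_functional_0:
  assumes "0 \<le> r"
  shows "expectation (\<lambda>\<omega>. indicator (dyadic_confined r n 0) \<omega> * f (X (real 0 / 2 ^ n) \<omega>)) = (f 0 :: real)"
proof -
  have "expectation (\<lambda>\<omega>. indicator (dyadic_confined r n 0) \<omega> * f (X (real 0 / 2 ^ n) \<omega>)) = expectation (\<lambda>\<omega>. f 0)"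
    using assms by (intro Bochner_Integration.integral_cong) (auto simp: X_0 dyadic_confined_def)
  then show ?thesis using prob_space by simp
qed

text \<open>The factor q and the error d are quantified inside the limit since both will depend on
  n, as in q = 1 - K / 2^n. Only a lower estimate is stated; the upper bound uses it for -
  f.\<close>

lemma confined_step_bounds:
  assumes f: "C2_compact f f1 f2" and "0 < e"
  shows "\<forall>\<^sub>F n in sequentially. \<forall>k<2 ^ n. \<forall>q d.
    (\<forall>x\<in>{-r..r}. q * f x - d \<le> f x + (generator f f1 f2 x - e) / 2 ^ n) \<and> 0 \<le> d \<longrightarrow>
      q * expectation (\<lambda>\<omega>. indicator (dyadic_confined r n k) \<omega> * f (X (real k / 2 ^ n) \<omega>)) - d
        \<le> expectation (\<lambda>\<omega>. indicator (dyadic_confined r n k) \<omega> * f (X (real (Suc k) / 2 ^ n) \<omega>))"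
    (is "eventually ?P _")
proof -
  have fm: "f \<in> borel_measurable borel" by (intro borel_measurable_continuous_onI C2_compact_facts[OF f])
  obtain A where A: "\<And>x. \<bar>f x\<bar> \<le> A" using C2_compact_bounded[OF f] by blast
  show ?thesis using generator_uniform[OF f \<open>0 < e\<close>, of r]
  proof eventually_elim
    case (elim n)
    show "?P n"
    proof (intro allI impI, elim conjE)
      fix k q d assume k: "k < (2::nat) ^ n" and q: "\<forall>x\<in>{-r..r}. q * f x - d \<le> f x + (generator f f1 f2 x - e) / 2 ^ n" and d: "0 \<le> d"
      let ?D = "dyadic_confined r n k" and ?X = "X (real k / 2 ^ n)"
      let ?P = "\<lambda>x. LINT y|increment_law n. f (x + y)"
      interpret I: real_distribution "increment_law n" by (rule real_distribution_\<mu>)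
      have Pm: "?P \<in> borel_measurable borel" using fm by measurable
      have int_f: "integrable (increment_law n) (\<lambda>y. f (x + y))" for x
        by (rule integrable_\<mu>I[where B=A]) (use A fm in auto)
      have PA: "\<bar>?P x\<bar> \<le> A" for x
      proof -
        have "\<bar>?P x\<bar> \<le> (LINT y|increment_law n. A)"
          using A int_f by (intro order_trans[OF integral_abs_bound] integral_mono) auto
        then show ?thesis using I.prob_space by simp
      qed
      have low: "q * f x - d \<le> ?P x" if "x \<in> {-r..r}" for x
      proof -
        have "generator f f1 f2 x - e \<le> (?P x - f x) / (1 / 2 ^ n)" using elim that by (force simp: abs_le_iff)
        then have "(generator f f1 f2 x - e) / 2 ^ n \<le> ?P x - f x" by (simp add: field_simps)
        moreover have "q * f x - d \<le> f x + (generator f f1 f2 x - e) / 2 ^ n" using q that by blast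
        ultimately show ?thesis by linarith
      qed
      have int1: "integrable M (\<lambda>\<omega>. indicator ?D \<omega> * f (?X \<omega>))" "integrable M (\<lambda>\<omega>. indicator ?D \<omega> * ?P (?X \<omega>))"
        using k by (intro confined_functional_integrable[where B=A] fm A Pm PA; simp)+
      have int2: "integrable M (\<lambda>\<omega>. indicator ?D \<omega> * d)"
        using confined_functional_integrable[of k n k "\<lambda>_. d" d r] k d by simp
      have "q * expectation (\<lambda>\<omega>. indicator ?D \<omega> * f (?X \<omega>)) - d * prob ?D =
         expectation (\<lambda>\<omega>. q * (indicator ?D \<omega> * f (?X \<omega>)) - indicator ?D \<omega> * d)"
        using int1 int2 by (simp add: sets_dyadic_confined k less_imp_le mult.commute)
      also have "\<dots> \<le> expectation (\<lambda>\<omega>. indicator ?D \<omega> * ?P (?X \<omega>))"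
      proof (rule integral_mono)
        show "integrable M (\<lambda>\<omega>. q * (indicator ?D \<omega> * f (?X \<omega>)) - indicator ?D \<omega> * d)" using int1 int2 by simp
        show "integrable M (\<lambda>\<omega>. indicator ?D \<omega> * ?P (?X \<omega>))" by (rule int1)
        fix \<omega>
        show "q * (indicator ?D \<omega> * f (?X \<omega>)) - indicator ?D \<omega> * d \<le> indicator ?D \<omega> * ?P (?X \<omega>)"
        proof (cases "\<omega> \<in> ?D")
          case True
          then have "?X \<omega> \<in> {-r..r}" by (auto simp: dyadic_confined_def abs_le_iff)
          then show ?thesis using low True by simp
        qed simp
      qed
      also have "\<dots> = expectation (\<lambda>\<omega>. indicator ?D \<omega> * f (X (real (Suc k) / 2 ^ n) \<omega>))"
        by (rule dyadic_step[OF k fm A, symmetric])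
      finally show "q * expectation (\<lambda>\<omega>. indicator ?D \<omega> * f (?X \<omega>)) - d \<le> expectation (\<lambda>\<omega>. indicator ?D \<omega> * f (X (real (Suc k) / 2 ^ n) \<omega>))"
        using mult_left_mono[OF prob_le_1 d, of ?D] by simp
    qed
  qed
qed

lemma step_factor_bounds:
  fixes K :: real
  assumes "\<bar>K\<bar> \<le> 2 ^ n"
  shows "0 \<le> 1 - K / 2 ^ n" "1 - K / 2 ^ n \<le> exp (\<bar>K\<bar> / 2 ^ n)"
proof -
  have "K / 2 ^ n \<le> 1" using assms by (simp add: divide_le_eq)
  then show "0 \<le> 1 - K / 2 ^ n" by simp
  have "1 - K / 2 ^ n \<le> 1 + \<bar>K\<bar> / 2 ^ n"
    using divide_right_mono[OF abs_ge_minus_self[of K], of "2 ^ n"] by simp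
  also have "\<dots> \<le> exp (\<bar>K\<bar> / 2 ^ n)" by (rule exp_ge_add_one_self)
  finally show "1 - K / 2 ^ n \<le> exp (\<bar>K\<bar> / 2 ^ n)" .
qed

lemma eventually_le_power_two: "\<forall>\<^sub>F n in sequentially. (K::real) \<le> 2 ^ n"
proof -
  obtain m where "K < 2 ^ m" using real_arch_pow[of 2 K] by auto
  then have "K \<le> 2 ^ n" if "m \<le> n" for n using power_increasing[OF that, of "2::real"] by linarith
  then show ?thesis by (auto simp: eventually_sequentially)
qed

text \<open>Expected values of f over the confined paths lose at most a factor 1 - K / 2^n per step,
  up to a small error. In total they retain exp (- K), while f is at most B at the final
  time.\<close>

theorem confinement_lower:
  assumes f: "C2_compact f f1 f2" and "0 \<le> r"
    and support: "\<And>x. r < \<bar>x\<bar> \<Longrightarrow> f x = 0" and bound: "\<And>x. f x \<le> B" and nonneg: "\<And>x. 0 \<le> f x"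
    and sub: "\<And>x. \<bar>x\<bar> \<le> r \<Longrightarrow> - K * f x \<le> generator f f1 f2 x"
  shows "exp (- K) * f 0 \<le> B * prob {\<omega> \<in> space M. sup_norm_path X \<omega> \<le> r}"
proof (rule field_le_epsilon)
  fix e' :: real assume "0 < e'"
  \<comment> \<open>The recursion magnifies the accumulated error by at most
    \<open>exp \<bar>K\<bar>\<close>; the scaling leaves exactly e'.\<close>
  define e where "e = e' / exp \<bar>K\<bar>"
  have e: "0 < e" "e * exp \<bar>K\<bar> = e'" using \<open>0 < e'\<close> by (simp_all add: e_def)
  have fm: "f \<in> borel_measurable borel" by (intro borel_measurable_continuous_onI C2_compact_facts[OF f])
  have B: "\<bar>f x\<bar> \<le> B" for x using bound nonneg by simp
  have "\<forall>\<^sub>F n in sequentially. (1 - K / 2 ^ n) ^ 2 ^ n * f 0 - e' \<le> B * prob (dyadic_confined r n (2 ^ n))"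
    using confined_step_bounds[OF f e(1), of r] eventually_le_power_two[of "\<bar>K\<bar>"]
  proof eventually_elim
    case (elim n)
    define a where "a k = expectation (\<lambda>\<omega>. indicator (dyadic_confined r n k) \<omega> * f (X (real k / 2 ^ n) \<omega>))" for k
    have "(1 - K / 2 ^ n) ^ 2 ^ n * a 0 - e / 2 ^ n * real (2 ^ n) * exp \<bar>K\<bar> \<le> a (2 ^ n)"
    proof (rule linear_recursion_lower)
      fix k assume k: "k < (2::nat) ^ n"
      have "(1 - K / 2 ^ n) * f x - e / 2 ^ n \<le> f x + (generator f f1 f2 x - e) / 2 ^ n" if "x \<in> {-r..r}" for x
      proof -
        have "- K * f x \<le> generator f f1 f2 x" using that by (intro sub) (auto simp: abs_le_iff)
        then have "- K * f x / 2 ^ n \<le> generator f f1 f2 x / 2 ^ n" by (rule divide_right_mono) simp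
        then show ?thesis by (simp add: algebra_simps diff_divide_distrib)
      qed
      then have "(1 - K / 2 ^ n) * a k - e / 2 ^ n \<le> expectation (\<lambda>\<omega>. indicator (dyadic_confined r n k) \<omega> * f (X (real (Suc k) / 2 ^ n) \<omega>))"
        using elim(1) k e(1) unfolding a_def by simp
      \<comment> \<open>Killing at the new time is free: f vanishes outside the ball, so paths that
        have just left it contribute nothing.\<close>
      also have "\<dots> = a (Suc k)"
        unfolding a_def
      proof (intro Bochner_Integration.integral_cong refl)
        fix \<omega> assume "\<omega> \<in> space M"
        show "indicator (dyadic_confined r n k) \<omega> * f (X (real (Suc k) / 2 ^ n) \<omega>) =
            indicator (dyadic_confined r n (Suc k)) \<omega> * f (X (real (Suc k) / 2 ^ n) \<omega>)"
          using support[of "X (real (Suc k) / 2 ^ n) \<omega>"]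
          by (cases "r < \<bar>X (real (Suc k) / 2 ^ n) \<omega>\<bar>") (auto simp: dyadic_confined_def indicator_def le_Suc_eq)
      qed
      finally show "(1 - K / 2 ^ n) * a k - e / 2 ^ n \<le> a (Suc k)" .
    qed (use e step_factor_bounds[OF elim(2)] in auto)
    note h1 = this
    have h2: "a 0 = f 0" unfolding a_def by (rule confined_functional_0[OF \<open>0 \<le> r\<close>])
    have h3: "a (2 ^ n) \<le> expectation (\<lambda>\<omega>. indicator (dyadic_confined r n (2 ^ n)) \<omega> * B)"
      unfolding a_def
    proof (rule integral_mono)
      show "integrable M (\<lambda>\<omega>. indicator (dyadic_confined r n (2 ^ n)) \<omega> * f (X (real (2 ^ n) / 2 ^ n) \<omega>))"
        by (rule confined_functional_integrable[OF _ _ fm B]) auto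
      show "integrable M (\<lambda>\<omega>. indicator (dyadic_confined r n (2 ^ n)) \<omega> * B)"
        by (rule confined_functional_integrable[of _ _ "2 ^ n" "\<lambda>_. B" "\<bar>B\<bar>"]) auto
    qed (auto simp: indicator_def bound)
    have h4: "expectation (\<lambda>\<omega>. indicator (dyadic_confined r n (2 ^ n)) \<omega> * B) = B * prob (dyadic_confined r n (2 ^ n))"
      by (simp add: sets_dyadic_confined mult.commute)
    have "e / 2 ^ n * real (2 ^ n) * exp \<bar>K\<bar> = e'" by (simp add: e(2))
    then show ?case using h1 h3 unfolding h2 h4 by linarith
  qed
  moreover have "(\<lambda>n. (1 - K / 2 ^ n) ^ 2 ^ n * f 0 - e') \<longlonglongrightarrow> exp (- K) * f 0 - e'"
    by (intro tendsto_intros power_dyadic_tendsto_exp)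
  moreover have "(\<lambda>n. B * prob (dyadic_confined r n (2 ^ n))) \<longlonglongrightarrow> B * prob {\<omega> \<in> space M. sup_norm_path X \<omega> \<le> r}"
    by (intro tendsto_intros prob_dyadic_confined_tendsto)
  ultimately have "exp (- K) * f 0 - e' \<le> B * prob {\<omega> \<in> space M. sup_norm_path X \<omega> \<le> r}"
    by (intro tendsto_le[OF trivial_limit_sequentially])
  then show "exp (- K) * f 0 \<le> B * prob {\<omega> \<in> space M. sup_norm_path X \<omega> \<le> r} + e'" by simp
qed

text \<open>The supersolution property may fail by \<open>\<eta>\<close>, which will be the
  contribution of the collar. Over unit time this adds at most
  \<open>\<eta> * exp \<bar>K\<bar>\<close>.\<close>

theorem confinement_upper:
  assumes f: "C2_compact f f1 f2" and "0 \<le> r"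
    and nonneg: "\<And>x. 0 \<le> f x" and bound: "\<And>x. \<bar>x\<bar> \<le> r \<Longrightarrow> c \<le> f x" and "0 \<le> \<eta>"
    and super: "\<And>x. \<bar>x\<bar> \<le> r \<Longrightarrow> generator f f1 f2 x \<le> - K * f x + \<eta>"
  shows "c * prob {\<omega> \<in> space M. sup_norm_path X \<omega> \<le> r} \<le> exp (- K) * f 0 + \<eta> * exp \<bar>K\<bar>"
proof (rule field_le_epsilon)
  fix e' :: real assume "0 < e'"
  define e where "e = e' / exp \<bar>K\<bar>"
  have e: "0 < e" "e * exp \<bar>K\<bar> = e'" using \<open>0 < e'\<close> by (simp_all add: e_def)
  \<comment> \<open>With the sign reversed, the supersolution takes the form required by the
    one-step lower estimate.\<close>
  define g g1 g2 where "g x = - f x" and "g1 x = - f1 x" and "g2 x = - f2 x" for x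
  have g: "C2_compact g g1 g2"
    using f unfolding C2_compact_def g_def g1_def g2_def by (auto intro!: derivative_intros continuous_intros)
  have gen_g: "generator g g1 g2 x = - generator f f1 f2 x" for x
  proof -
    have "(LINT y|\<nu>. g (x + y) - g x - indicator {y. \<bar>y\<bar> \<le> 1} y * (y * g1 x)) =
       (LINT y|\<nu>. - (f (x + y) - f x - indicator {y. \<bar>y\<bar> \<le> 1} y * (y * f1 x)))"
      by (intro Bochner_Integration.integral_cong) (auto simp: g_def g1_def)
    then show ?thesis unfolding generator_def Bochner_Integration.integral_minus by (simp add: g1_def g2_def)
  qed
  have fm: "f \<in> borel_measurable borel" by (intro borel_measurable_continuous_onI C2_compact_facts[OF f])
  obtain A where A: "\<And>x. \<bar>f x\<bar> \<le> A" using C2_compact_bounded[OF f] by blast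
  have "\<forall>\<^sub>F n in sequentially. c * prob (dyadic_confined r n (2 ^ n)) \<le> (1 - K / 2 ^ n) ^ 2 ^ n * f 0 + (\<eta> * exp \<bar>K\<bar> + e')"
    using confined_step_bounds[OF g e(1), of r] eventually_le_power_two[of "\<bar>K\<bar>"]
  proof eventually_elim
    case (elim n)
    define a where "a k = expectation (\<lambda>\<omega>. indicator (dyadic_confined r n k) \<omega> * g (X (real k / 2 ^ n) \<omega>))" for k
    have gA: "\<bar>g x\<bar> \<le> A" for x using A by (simp add: g_def)
    have gm: "g \<in> borel_measurable borel" using fm unfolding g_def[abs_def] by simp
    have "(1 - K / 2 ^ n) ^ 2 ^ n * a 0 - (\<eta> + e) / 2 ^ n * real (2 ^ n) * exp \<bar>K\<bar> \<le> a (2 ^ n)"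
    proof (rule linear_recursion_lower)
      fix k assume k: "k < (2::nat) ^ n"
      have "(1 - K / 2 ^ n) * g x - (\<eta> + e) / 2 ^ n \<le> g x + (generator g g1 g2 x - e) / 2 ^ n" if "x \<in> {-r..r}" for x
      proof -
        have "generator f f1 f2 x \<le> - K * f x + \<eta>" using that by (intro super) (auto simp: abs_le_iff)
        then have "- K * g x - \<eta> \<le> generator g g1 g2 x" unfolding gen_g by (simp add: g_def)
        then have "(- K * g x - \<eta>) / 2 ^ n \<le> generator g g1 g2 x / 2 ^ n" by (rule divide_right_mono) simp
        then show ?thesis by (simp add: algebra_simps diff_divide_distrib add_divide_distrib)
      qed
      then have "(1 - K / 2 ^ n) * a k - (\<eta> + e) / 2 ^ n \<le> expectation (\<lambda>\<omega>. indicator (dyadic_confined r n k) \<omega> * g (X (real (Suc k) / 2 ^ n) \<omega>))"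
        using elim(1) k e(1) \<open>0 \<le> \<eta>\<close> unfolding a_def by simp
      \<comment> \<open>Here f need not vanish outside the ball; the smaller event only drops paths
        on which g is at most 0.\<close>
      also have "\<dots> \<le> a (Suc k)"
        unfolding a_def
      proof (rule integral_mono)
        show "integrable M (\<lambda>\<omega>. indicator (dyadic_confined r n k) \<omega> * g (X (real (Suc k) / 2 ^ n) \<omega>))"
             "integrable M (\<lambda>\<omega>. indicator (dyadic_confined r n (Suc k)) \<omega> * g (X (real (Suc k) / 2 ^ n) \<omega>))"
          using k by (intro confined_functional_integrable[OF _ _ gm gA]; simp)+
      qed (use nonneg in \<open>auto simp: g_def dyadic_confined_def indicator_def\<close>)
      finally show "(1 - K / 2 ^ n) * a k - (\<eta> + e) / 2 ^ n \<le> a (Suc k)" .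
    qed (use e \<open>0 \<le> \<eta>\<close> step_factor_bounds[OF elim(2)] in auto)
    note h1 = this
    have h2: "a 0 = - f 0" unfolding a_def g_def[symmetric] by (rule confined_functional_0[OF \<open>0 \<le> r\<close>])
    have h3: "a (2 ^ n) \<le> expectation (\<lambda>\<omega>. indicator (dyadic_confined r n (2 ^ n)) \<omega> * (- c))"
      unfolding a_def
    proof (rule integral_mono)
      show "integrable M (\<lambda>\<omega>. indicator (dyadic_confined r n (2 ^ n)) \<omega> * g (X (real (2 ^ n) / 2 ^ n) \<omega>))"
        by (rule confined_functional_integrable[OF _ _ gm gA]) auto
      show "integrable M (\<lambda>\<omega>. indicator (dyadic_confined r n (2 ^ n)) \<omega> * - c)"
        by (rule confined_functional_integrable[of _ _ "2 ^ n" "\<lambda>_. - c" "\<bar>c\<bar>"]) auto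
      fix \<omega>
      show "indicator (dyadic_confined r n (2 ^ n)) \<omega> * g (X (real (2 ^ n) / 2 ^ n) \<omega>) \<le> indicator (dyadic_confined r n (2 ^ n)) \<omega> * - c"
        using bound[of "X (real (2 ^ n) / 2 ^ n) \<omega>"] by (auto simp: indicator_def g_def dyadic_confined_def)
    qed
    have h4: "expectation (\<lambda>\<omega>. indicator (dyadic_confined r n (2 ^ n)) \<omega> * (- c)) = - c * prob (dyadic_confined r n (2 ^ n))"
      by (simp add: sets_dyadic_confined mult.commute)
    have "(\<eta> + e) / 2 ^ n * real (2 ^ n) * exp \<bar>K\<bar> = \<eta> * exp \<bar>K\<bar> + e'"
    proof -
      have "(\<eta> + e) / 2 ^ n * real (2 ^ n) = \<eta> + e" by simp
      then show ?thesis by (simp only: distrib_right e(2))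
    qed
    then show ?case using h1 h3 unfolding h2 h4 by simp
  qed
  moreover have "(\<lambda>n. (1 - K / 2 ^ n) ^ 2 ^ n * f 0 + (\<eta> * exp \<bar>K\<bar> + e')) \<longlonglongrightarrow> exp (- K) * f 0 + (\<eta> * exp \<bar>K\<bar> + e')"
    by (intro tendsto_intros power_dyadic_tendsto_exp)
  moreover have "(\<lambda>n. c * prob (dyadic_confined r n (2 ^ n))) \<longlonglongrightarrow> c * prob {\<omega> \<in> space M. sup_norm_path X \<omega> \<le> r}"
    by (intro tendsto_intros prob_dyadic_confined_tendsto)
  ultimately have "c * prob {\<omega> \<in> space M. sup_norm_path X \<omega> \<le> r} \<le> exp (- K) * f 0 + (\<eta> * exp \<bar>K\<bar> + e')"
    by (intro tendsto_le[OF trivial_limit_sequentially])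
  then show "c * prob {\<omega> \<in> space M. sup_norm_path X \<omega> \<le> r} \<le> exp (- K) * f 0 + \<eta> * exp \<bar>K\<bar> + e'" by simp
qed

end

section \<open>The tilted generator\<close>

lemma quadratic_error_imp_has_derivative:
  fixes F :: "real \<Rightarrow> real"
  assumes "\<And>h. \<bar>h\<bar> \<le> 1 \<Longrightarrow> \<bar>F (u + h) - F u - h * D\<bar> \<le> C * h\<^sup>2"
  shows "(F has_real_derivative D) (at u)"
proof -
  have "((\<lambda>h. (F (u + h) - F u) / h - D) \<longlongrightarrow> 0) (at 0)"
  proof (rule Lim_null_comparison)
    have "\<forall>\<^sub>F h::real in at 0. \<bar>h\<bar> < 1 \<and> h \<noteq> 0"
      by (auto simp: eventually_at dist_real_def intro: exI[of _ 1])
    then show "\<forall>\<^sub>F h in at 0. norm ((F (u + h) - F u) / h - D) \<le> C * \<bar>h\<bar>"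
    proof eventually_elim
      case (elim h)
      have "(F (u + h) - F u) / h - D = (F (u + h) - F u - h * D) / h" using elim by (simp add: field_simps)
      then have "norm ((F (u + h) - F u) / h - D) = \<bar>F (u + h) - F u - h * D\<bar> / \<bar>h\<bar>" by (simp add: abs_divide)
      also have "\<dots> \<le> C * h\<^sup>2 / \<bar>h\<bar>" using assms[of h] elim by (intro divide_right_mono) auto
      also have "\<dots> = C * \<bar>h\<bar>"
        using elim by (metis abs_0_eq nonzero_mult_div_cancel_right power2_abs power2_eq_square mult.assoc)
      finally show ?case .
    qed
    show "((\<lambda>h::real. C * \<bar>h\<bar>) \<longlongrightarrow> 0) (at 0)"
      using tendsto_mult[OF tendsto_const tendsto_rabs_zero[OF tendsto_ident_at], of C] by simp
  qed
  then have "((\<lambda>h. (F (u + h) - F u) / h) \<longlongrightarrow> D) (at 0)" by (rule LIM_zero_cancel)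
  then show ?thesis by (simp add: DERIV_def)
qed

lemma exp_taylor_bound:
  fixes y u h \<epsilon> :: real
  assumes "\<bar>y\<bar> \<le> \<epsilon>" "\<bar>h\<bar> \<le> 1"
  shows "\<bar>exp ((u + h) * y) - exp (u * y) - h * (y * exp (u * y))\<bar> \<le> h\<^sup>2 * (y\<^sup>2 * exp ((\<bar>u\<bar> + 1) * \<epsilon>))"
proof -
  obtain z where z: "min u (u + h) \<le> z" "z \<le> max u (u + h)"
    "exp ((u + h) * y) = exp (u * y) + h * (y * exp (u * y)) + h\<^sup>2 / 2 * (y\<^sup>2 * exp (z * y))"
    by (rule taylor_second_order[of "\<lambda>v. exp (v * y)" "\<lambda>v. y * exp (v * y)" "\<lambda>v. y\<^sup>2 * exp (v * y)" u h])
       (auto intro!: derivative_eq_intros simp: power2_eq_square)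
  have "\<bar>z\<bar> \<le> \<bar>u\<bar> + 1" using z(1,2) assms(2) by (auto simp: min_def max_def split: if_splits)
  then have "\<bar>z\<bar> * \<bar>y\<bar> \<le> (\<bar>u\<bar> + 1) * \<epsilon>" using assms(1) by (intro mult_mono) auto
  then have "z * y \<le> (\<bar>u\<bar> + 1) * \<epsilon>" using abs_ge_self[of "z * y"] by (simp add: abs_mult)
  then have "exp (z * y) \<le> exp ((\<bar>u\<bar> + 1) * \<epsilon>)" by simp
  then have "h\<^sup>2 / 2 * (y\<^sup>2 * exp (z * y)) \<le> h\<^sup>2 * (y\<^sup>2 * exp ((\<bar>u\<bar> + 1) * \<epsilon>))"
    by (intro mult_mono) auto
  then show ?thesis unfolding z(3) by simp
qed

context levy_triplet begin

context
  fixes \<epsilon> :: real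
  assumes eps: "0 < \<epsilon>"
begin

abbreviation "small_jumps \<equiv> {-\<epsilon>..\<epsilon>} - {0::real}"
abbreviation "large_jumps \<equiv> - {-\<epsilon>..\<epsilon>}"

lemma small_jumps_integrable:
  fixes g :: "real \<Rightarrow> real"
  assumes "g \<in> borel_measurable borel" "\<And>y. \<bar>y\<bar> \<le> \<epsilon> \<Longrightarrow> \<bar>g y\<bar> \<le> C * y\<^sup>2" "0 \<le> C"
  shows "set_integrable \<nu> small_jumps g"
  unfolding set_integrable_def
proof (rule integrable_levyI)
  show "(\<lambda>y. indicator small_jumps y *\<^sub>R g y) \<in> borel_measurable borel" using assms(1) by simp
  fix y :: real
  have *: "y\<^sup>2 \<le> max 1 (\<epsilon>\<^sup>2) * min 1 (y\<^sup>2)" if "\<bar>y\<bar> \<le> \<epsilon>"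
  proof (cases "y\<^sup>2 \<le> 1")
    case True
    have "1 * y\<^sup>2 \<le> max 1 (\<epsilon>\<^sup>2) * y\<^sup>2" by (intro mult_right_mono) auto
    then show ?thesis using True by simp
  next
    case False
    have "y\<^sup>2 \<le> \<epsilon>\<^sup>2" using that eps by (metis abs_le_square_iff abs_of_pos)
    then show ?thesis using False by (simp add: le_max_iff_disj)
  qed
  show "norm (indicator small_jumps y *\<^sub>R g y) \<le> (C * max 1 (\<epsilon>\<^sup>2)) * min 1 (y\<^sup>2)"
  proof (cases "y \<in> small_jumps")
    case True
    then have y: "\<bar>y\<bar> \<le> \<epsilon>" by auto
    have "\<bar>g y\<bar> \<le> C * (max 1 (\<epsilon>\<^sup>2) * min 1 (y\<^sup>2))"
      using assms(2)[OF y] mult_left_mono[OF *[OF y] assms(3)] by linarith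
    then show ?thesis using True by (simp add: mult.assoc)
  next
    case False then show ?thesis using assms(3) by simp
  qed
qed

lemma large_jumps_integrable:
  fixes g :: "real \<Rightarrow> real"
  assumes "g \<in> borel_measurable borel" "\<And>y. \<epsilon> < \<bar>y\<bar> \<Longrightarrow> \<bar>g y\<bar> \<le> C"
  shows "set_integrable \<nu> large_jumps g"
  unfolding set_integrable_def
proof (rule integrable_levyI)
  show "(\<lambda>y. indicator large_jumps y *\<^sub>R g y) \<in> borel_measurable borel" using assms(1) by simp
  fix y :: real
  show "norm (indicator large_jumps y *\<^sub>R g y) \<le> (\<bar>C\<bar> / min 1 (\<epsilon>\<^sup>2)) * min 1 (y\<^sup>2)"
  proof (cases "y \<in> large_jumps")
    case True
    then have y: "\<epsilon> < \<bar>y\<bar>" by auto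
    then have "\<epsilon>\<^sup>2 \<le> y\<^sup>2" using eps by (metis abs_le_square_iff abs_of_pos less_imp_le)
    then have "min 1 (\<epsilon>\<^sup>2) \<le> min 1 (y\<^sup>2)" by auto
    then have "\<bar>C\<bar> * min 1 (\<epsilon>\<^sup>2) \<le> \<bar>C\<bar> * min 1 (y\<^sup>2)" by (intro mult_left_mono) auto
    moreover have "0 < min 1 (\<epsilon>\<^sup>2)" using eps by simp
    ultimately have "\<bar>C\<bar> \<le> \<bar>C\<bar> * min 1 (y\<^sup>2) / min 1 (\<epsilon>\<^sup>2)" by (simp only: pos_le_divide_eq)
    moreover have "\<bar>g y\<bar> \<le> C" using assms(2) y .
    ultimately show ?thesis using True by simp
  qed simp
qed

lemma drift_correction_integrable:
  "set_integrable \<nu> ({-1..1} - {-\<epsilon>..\<epsilon>}) (\<lambda>y. y)" "set_integrable \<nu> ({-\<epsilon>..\<epsilon>} - {-1..1}) (\<lambda>y. y)"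
proof -
  have "set_integrable \<nu> large_jumps (\<lambda>y. indicator {-1..1} y * y)"
    by (rule large_jumps_integrable[where C=1]) (auto simp: indicator_def)
  then show "set_integrable \<nu> ({-1..1} - {-\<epsilon>..\<epsilon>}) (\<lambda>y. y)"
    unfolding set_integrable_def
    by (rule Bochner_Integration.integrable_cong[THEN iffD1, rotated -1]) (auto simp: indicator_def)
  have "set_integrable \<nu> small_jumps (\<lambda>y. indicator (- {-1..1}) y * y)"
  proof (rule small_jumps_integrable[where C=1])
    fix y :: real
    show "\<bar>indicator (- {-1..1}) y * y\<bar> \<le> 1 * y\<^sup>2"
    proof (cases "\<bar>y\<bar> \<le> 1")
      case False
      then have "\<bar>y\<bar> * 1 \<le> \<bar>y\<bar> * \<bar>y\<bar>" by (intro mult_left_mono) auto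
      then show ?thesis by (auto simp: indicator_def power2_eq_square)
    qed (auto simp: indicator_def abs_le_iff)
  qed auto
  then show "set_integrable \<nu> ({-\<epsilon>..\<epsilon>} - {-1..1}) (\<lambda>y. y)"
    unfolding set_integrable_def
    by (rule Bochner_Integration.integrable_cong[THEN iffD1, rotated -1]) (auto simp: indicator_def)
qed

lemma exp_integrands_integrable:
  "set_integrable \<nu> small_jumps (\<lambda>y. exp (u * y) - 1 - u * y)"
  "set_integrable \<nu> small_jumps (\<lambda>y. y * (exp (u * y) - 1))"
  "set_integrable \<nu> small_jumps (\<lambda>y. y\<^sup>2 * exp (u * y))"
  "set_integrable \<nu> small_jumps (\<lambda>y. y\<^sup>2)"
proof -
  define E where "E = exp (\<bar>u\<bar> * \<epsilon>)"
  have E: "exp (v * y) \<le> E" if "\<bar>y\<bar> \<le> \<epsilon>" "\<bar>v\<bar> \<le> \<bar>u\<bar>" for v y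
  proof -
    have "v * y \<le> \<bar>v\<bar> * \<bar>y\<bar>" using abs_ge_self[of "v * y"] by (simp add: abs_mult)
    also have "\<dots> \<le> \<bar>u\<bar> * \<epsilon>" using that by (intro mult_mono) auto
    finally show ?thesis by (simp add: E_def)
  qed
  show "set_integrable \<nu> small_jumps (\<lambda>y. exp (u * y) - 1 - u * y)"
  proof (rule small_jumps_integrable[where C="u\<^sup>2 * E"])
    fix y assume y: "\<bar>y\<bar> \<le> \<epsilon>"
    obtain z where z: "min 0 (0 + u) \<le> z" "z \<le> max 0 (0 + u)"
      "exp ((0 + u) * y) = exp (0 * y) + u * (y * exp (0 * y)) + u\<^sup>2 / 2 * (y\<^sup>2 * exp (z * y))"
      by (rule taylor_second_order[of "\<lambda>v. exp (v * y)" "\<lambda>v. y * exp (v * y)" "\<lambda>v. y\<^sup>2 * exp (v * y)" 0 u])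
         (auto intro!: derivative_eq_intros simp: power2_eq_square)
    have "\<bar>z\<bar> \<le> \<bar>u\<bar>" using z(1,2) by (auto simp: min_def max_def split: if_splits)
    then have "u\<^sup>2 / 2 * (y\<^sup>2 * exp (z * y)) \<le> u\<^sup>2 * (y\<^sup>2 * E)" using E[OF y] by (intro mult_mono) auto
    then show "\<bar>exp (u * y) - 1 - u * y\<bar> \<le> u\<^sup>2 * E * y\<^sup>2" using z(3) by (simp add: algebra_simps)
  qed (auto simp: E_def)
  show "set_integrable \<nu> small_jumps (\<lambda>y. y * (exp (u * y) - 1))"
  proof (rule small_jumps_integrable[where C="\<bar>u\<bar> * E"])
    fix y assume y: "\<bar>y\<bar> \<le> \<epsilon>"
    have "\<bar>exp (u * y) - 1\<bar> \<le> \<bar>u * y\<bar> * E"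
    proof (cases "0 \<le> u * y")
      case True
      have "1 - u * y \<le> exp (- (u * y))" using exp_ge_add_one_self[of "- (u * y)"] by simp
      then have "(1 - u * y) * exp (u * y) \<le> exp (- (u * y)) * exp (u * y)" by (intro mult_right_mono) auto
      also have "\<dots> = 1" by (simp add: exp_minus)
      finally have "exp (u * y) - 1 \<le> u * y * exp (u * y)" by (simp add: algebra_simps)
      also have "\<dots> \<le> u * y * E" using E[OF y, of u] True by (intro mult_left_mono) auto
      finally show ?thesis using True by simp
    next
      case False
      have "exp (u * y) \<le> 1" using False by simp
      then have "\<bar>exp (u * y) - 1\<bar> \<le> \<bar>u * y\<bar> * 1"
        using exp_ge_add_one_self[of "u * y"] False by linarith
      also have "\<dots> \<le> \<bar>u * y\<bar> * E" using eps by (intro mult_left_mono) (auto simp: E_def)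
      finally show ?thesis .
    qed
    then have "\<bar>y\<bar> * \<bar>exp (u * y) - 1\<bar> \<le> \<bar>y\<bar> * (\<bar>u * y\<bar> * E)"
      by (rule mult_left_mono) simp
    also have "\<bar>y\<bar> * (\<bar>u * y\<bar> * E) = \<bar>u\<bar> * E * (\<bar>y\<bar> * \<bar>y\<bar>)" by (simp only: abs_mult mult_ac)
    also have "\<bar>y\<bar> * \<bar>y\<bar> = y\<^sup>2" by (simp add: power2_eq_square)
    finally show "\<bar>y * (exp (u * y) - 1)\<bar> \<le> \<bar>u\<bar> * E * y\<^sup>2" unfolding abs_mult[of y] .
  qed (auto simp: E_def)
  show "set_integrable \<nu> small_jumps (\<lambda>y. y\<^sup>2 * exp (u * y))"
  proof (rule small_jumps_integrable[where C=E])
    fix y assume "\<bar>y\<bar> \<le> \<epsilon>"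
    then have "y\<^sup>2 * exp (u * y) \<le> y\<^sup>2 * E" by (intro mult_left_mono E) auto
    then show "\<bar>y\<^sup>2 * exp (u * y)\<bar> \<le> E * y\<^sup>2" by (simp add: abs_mult mult.commute)
  qed (auto simp: E_def)
  show "set_integrable \<nu> small_jumps (\<lambda>y. y\<^sup>2)"
    by (rule small_jumps_integrable[where C=1]) auto
qed

text \<open>Differentiation under the integral, reduced to one estimate: a pointwise remainder h^2 *
  y^2 * C integrates to a multiple of h^2, because y^2 is \<nu>-integrable over the small
  jumps.\<close>

lemma set_integral_quadratic_error:
  fixes G :: "real \<Rightarrow> real \<Rightarrow> real"
  assumes G: "\<And>v. set_integrable \<nu> small_jumps (G v)" and H: "set_integrable \<nu> small_jumps H"
    and err: "\<And>h y. \<bar>h\<bar> \<le> 1 \<Longrightarrow> \<bar>y\<bar> \<le> \<epsilon> \<Longrightarrow> \<bar>G (u + h) y - G u y - h * H y\<bar> \<le> h\<^sup>2 * (y\<^sup>2 * C)"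
  shows "((\<lambda>v. LINT y:small_jumps|\<nu>. G v y) has_real_derivative (LINT y:small_jumps|\<nu>. H y)) (at u)"
proof (rule quadratic_error_imp_has_derivative)
  fix h :: real assume h: "\<bar>h\<bar> \<le> 1"
  have int: "set_integrable \<nu> small_jumps (\<lambda>y. G (u + h) y - G u y - h * H y)"
    by (intro set_integral_diff set_integrable_mult_right G H) 
  have "(LINT y:small_jumps|\<nu>. G (u + h) y) - (LINT y:small_jumps|\<nu>. G u y) - h * (LINT y:small_jumps|\<nu>. H y)
      = (LINT y:small_jumps|\<nu>. G (u + h) y - G u y - h * H y)"
    using G H by (simp add: set_integral_diff set_integral_mult_right)
  also have "\<bar>\<dots>\<bar> \<le> (LINT y:small_jumps|\<nu>. y\<^sup>2 * (h\<^sup>2 * C))"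
    unfolding set_lebesgue_integral_def
  proof (rule order_trans[OF integral_abs_bound], rule integral_mono)
    show "integrable \<nu> (\<lambda>y. \<bar>indicator small_jumps y *\<^sub>R (G (u + h) y - G u y - h * H y)\<bar>)"
      using int unfolding set_integrable_def by (rule integrable_abs)
    have "set_integrable \<nu> small_jumps (\<lambda>y. y\<^sup>2 * (h\<^sup>2 * C))"
      by (rule set_integrable_mult_left) (rule exp_integrands_integrable)
    then show "integrable \<nu> (\<lambda>y. indicator small_jumps y *\<^sub>R (y\<^sup>2 * (h\<^sup>2 * C)))"
      unfolding set_integrable_def .
    fix y
    show "\<bar>indicator small_jumps y *\<^sub>R (G (u + h) y - G u y - h * H y)\<bar> \<le> indicator small_jumps y *\<^sub>R (y\<^sup>2 * (h\<^sup>2 * C))"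
      using err[OF h, of y] by (cases "y \<in> small_jumps") (auto simp: abs_le_iff algebra_simps)
  qed
  also have "\<dots> = (LINT y:small_jumps|\<nu>. y\<^sup>2) * C * h\<^sup>2" by (simp add: algebra_simps)
  finally show "\<bar>(LINT y:small_jumps|\<nu>. G (u + h) y) - (LINT y:small_jumps|\<nu>. G u y) - h * (LINT y:small_jumps|\<nu>. H y)\<bar>
      \<le> (LINT y:small_jumps|\<nu>. y\<^sup>2) * C * h\<^sup>2" .
qed

text \<open>The integrand stays in the form y * (exp (u * y) - 1), which is of order y^2; the two
  summands need not be integrable separately near 0.\<close>

lemma Lambda_eps_derivative:
  "(Lambda_eps \<nu> \<sigma>2 b \<epsilon> has_real_derivative
     \<sigma>2 * u + drift_eps \<nu> b \<epsilon> + (LINT y:small_jumps|\<nu>. y * (exp (u * y) - 1))) (at u)"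
proof -
  have d: "((\<lambda>v. LINT y:small_jumps|\<nu>. exp (v * y) - 1 - v * y) has_real_derivative (LINT y:small_jumps|\<nu>. y * (exp (u * y) - 1))) (at u)"
  proof (rule set_integral_quadratic_error[OF exp_integrands_integrable(1,2)])
    fix h y :: real assume "\<bar>h\<bar> \<le> 1" "\<bar>y\<bar> \<le> \<epsilon>"
    from exp_taylor_bound[OF this(2,1), of u]
    show "\<bar>exp ((u + h) * y) - 1 - (u + h) * y - (exp (u * y) - 1 - u * y) - h * (y * (exp (u * y) - 1))\<bar>
        \<le> h\<^sup>2 * (y\<^sup>2 * exp ((\<bar>u\<bar> + 1) * \<epsilon>))" by (simp add: algebra_simps)
  qed
  show ?thesis
    unfolding Lambda_eps_def[abs_def] by (rule derivative_eq_intros d refl | simp)+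
qed

lemma deriv_Lambda_eps:
  "deriv (Lambda_eps \<nu> \<sigma>2 b \<epsilon>) u = \<sigma>2 * u + drift_eps \<nu> b \<epsilon> + (LINT y:small_jumps|\<nu>. y * (exp (u * y) - 1))"
  by (rule DERIV_imp_deriv[OF Lambda_eps_derivative])

lemma deriv_deriv_Lambda_eps:
  "deriv (deriv (Lambda_eps \<nu> \<sigma>2 b \<epsilon>)) u = \<sigma>2 + (LINT y:small_jumps|\<nu>. y\<^sup>2 * exp (u * y))"
proof (rule DERIV_imp_deriv)
  have d: "((\<lambda>v. LINT y:small_jumps|\<nu>. y * (exp (v * y) - 1)) has_real_derivative (LINT y:small_jumps|\<nu>. y\<^sup>2 * exp (u * y))) (at u)"
  proof (rule set_integral_quadratic_error[OF exp_integrands_integrable(2,3)])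
    fix h y :: real assume hy: "\<bar>h\<bar> \<le> 1" "\<bar>y\<bar> \<le> \<epsilon>"
    have "y * (exp ((u + h) * y) - 1) - y * (exp (u * y) - 1) - h * (y\<^sup>2 * exp (u * y))
        = y * (exp ((u + h) * y) - exp (u * y) - h * (y * exp (u * y)))" by (simp add: algebra_simps power2_eq_square)
    also have "\<bar>\<dots>\<bar> \<le> \<epsilon> * (h\<^sup>2 * (y\<^sup>2 * exp ((\<bar>u\<bar> + 1) * \<epsilon>)))"
      unfolding abs_mult[of y] by (intro mult_mono exp_taylor_bound hy) (use eps in auto)
    finally show "\<bar>y * (exp ((u + h) * y) - 1) - y * (exp (u * y) - 1) - h * (y\<^sup>2 * exp (u * y))\<bar>
        \<le> h\<^sup>2 * (y\<^sup>2 * (\<epsilon> * exp ((\<bar>u\<bar> + 1) * \<epsilon>)))" by (simp add: algebra_simps)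
  qed
  have "deriv (Lambda_eps \<nu> \<sigma>2 b \<epsilon>) = (\<lambda>v. \<sigma>2 * v + drift_eps \<nu> b \<epsilon> + (LINT y:small_jumps|\<nu>. y * (exp (v * y) - 1)))"
    by (rule ext) (rule deriv_Lambda_eps)
  then show "(deriv (Lambda_eps \<nu> \<sigma>2 b \<epsilon>) has_real_derivative \<sigma>2 + (LINT y:small_jumps|\<nu>. y\<^sup>2 * exp (u * y))) (at u)"
    by (auto intro!: derivative_eq_intros d)
qed

end

end

section \<open>Exponential tilting of the generator\<close>

lemma C2_compact_exp_mult:
  assumes "C2_compact g g1 g2"
  shows "C2_compact (\<lambda>x. exp (u * x) * g x) (\<lambda>x. exp (u * x) * (u * g x + g1 x))
    (\<lambda>x. exp (u * x) * (u\<^sup>2 * g x + 2 * u * g1 x + g2 x))"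
proof -
  have d: "\<And>x. (g has_real_derivative g1 x) (at x)" "\<And>x. (g1 has_real_derivative g2 x) (at x)"
    using assms by (auto simp: C2_compact_def)
  note F = C2_compact_facts[OF assms]
  have "((\<lambda>x. exp (u * x) * g x) has_real_derivative exp (u * x) * (u * g x + g1 x)) (at x)"
    "((\<lambda>x. exp (u * x) * (u * g x + g1 x)) has_real_derivative exp (u * x) * (u\<^sup>2 * g x + 2 * u * g1 x + g2 x)) (at x)" for x
    by (rule derivative_eq_intros d refl | simp add: algebra_simps power2_eq_square)+
  moreover have "continuous_on UNIV (\<lambda>x. exp (u * x) * (u\<^sup>2 * g x + 2 * u * g1 x + g2 x))"
    by (intro continuous_intros F)
  moreover have "\<exists>R. \<forall>x. R < \<bar>x\<bar> \<longrightarrow> exp (u * x) * g x = 0" using F(4) by force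
  ultimately show ?thesis by (simp add: C2_compact_def)
qed

lemma C2_compact_scale:
  fixes c :: real
  assumes "C2_compact g g1 g2" "0 < c"
  shows "C2_compact (\<lambda>x. g (x / c)) (\<lambda>x. g1 (x / c) / c) (\<lambda>x. g2 (x / c) / c\<^sup>2)"
proof -
  have d: "\<And>x. (g has_real_derivative g1 x) (at x)" "\<And>x. (g1 has_real_derivative g2 x) (at x)"
    using assms by (auto simp: C2_compact_def)
  have s: "((\<lambda>x. x / c) has_real_derivative 1 / c) (at x)" for x
    using assms(2) by (auto intro!: derivative_eq_intros)
  have 1: "((\<lambda>x. g (x / c)) has_real_derivative g1 (x / c) / c) (at x)" for x
    using DERIV_chain2[OF d(1) s] by simp
  have 2: "((\<lambda>x. g1 (x / c) / c) has_real_derivative g2 (x / c) / c\<^sup>2) (at x)" for x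
    using DERIV_cdivide[OF DERIV_chain2[OF d(2) s], of c] by (simp add: power2_eq_square)
  have "continuous_on UNIV g2" using assms by (simp add: C2_compact_def)
  then have 3: "continuous_on UNIV (\<lambda>x. g2 (x / c) / c\<^sup>2)"
  proof -
    have "continuous_on UNIV (\<lambda>x. x / c)" using assms(2) by (intro continuous_intros) simp
    from continuous_on_compose2[OF \<open>continuous_on UNIV g2\<close> this] have "continuous_on UNIV (\<lambda>x. g2 (x / c))" by simp
    then show ?thesis using assms(2) by (intro continuous_on_divide continuous_on_const) auto
  qed
  obtain R where R: "\<And>x. R < \<bar>x\<bar> \<Longrightarrow> g x = 0" using assms by (auto simp: C2_compact_def)
  have "g (x / c) = 0" if "R * c < \<bar>x\<bar>" for x
    using that assms(2) by (intro R) (simp add: abs_divide pos_less_divide_eq)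
  then show ?thesis using 1 2 3 unfolding C2_compact_def by blast
qed

context levy_triplet begin

lemma jump_integrands_integrable:
  assumes eps: "0 < \<epsilon>" and f: "C2_compact f f1 f2"
  shows "set_integrable \<nu> ({-\<epsilon>..\<epsilon>} - {0}) (\<lambda>y. f (x + y) - f x - y * f1 x)"
    and "set_integrable \<nu> ({-\<epsilon>..\<epsilon>} - {0}) (\<lambda>y. exp (u * y) * (f (x + y) - f x - y * f1 x))"
    and "set_integrable \<nu> (- {-\<epsilon>..\<epsilon>}) (\<lambda>y. f (x + y) - f x)"
    and "set_integrable \<nu> (- {-\<epsilon>..\<epsilon>}) (\<lambda>y. f (x + y))"
proof -
  have d: "\<And>x. (f has_real_derivative f1 x) (at x)" "\<And>x. (f1 has_real_derivative f2 x) (at x)"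
    using f by (auto simp: C2_compact_def)
  have [measurable]: "f \<in> borel_measurable borel" by (intro borel_measurable_continuous_onI C2_compact_facts[OF f])
  obtain A where A: "\<And>x. \<bar>f x\<bar> \<le> A" "\<And>x. \<bar>f2 x\<bar> \<le> A" using C2_compact_bounded[OF f] by blast
  have A0: "0 \<le> A" using A(1)[of 0] by linarith
  have q: "\<bar>f (x + y) - f x - y * f1 x\<bar> \<le> A * y\<^sup>2" for y
  proof -
    obtain z where z: "f (x + y) = f x + y * f1 x + y\<^sup>2 / 2 * f2 z" by (rule taylor_second_order[OF d])
    have "\<bar>y\<^sup>2 / 2 * f2 z\<bar> \<le> y\<^sup>2 * A" unfolding abs_mult by (intro mult_mono A) auto
    then show ?thesis using z by (simp add: mult.commute)
  qed
  show "set_integrable \<nu> ({-\<epsilon>..\<epsilon>} - {0}) (\<lambda>y. f (x + y) - f x - y * f1 x)"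
    by (rule small_jumps_integrable[OF eps _ q A0]) simp
  show "set_integrable \<nu> ({-\<epsilon>..\<epsilon>} - {0}) (\<lambda>y. exp (u * y) * (f (x + y) - f x - y * f1 x))"
  proof (rule small_jumps_integrable[OF eps])
    fix y assume y: "\<bar>y\<bar> \<le> \<epsilon>"
    have "u * y \<le> \<bar>u\<bar> * \<bar>y\<bar>" using abs_ge_self[of "u * y"] by (simp add: abs_mult)
    also have "\<dots> \<le> \<bar>u\<bar> * \<epsilon>" using y by (intro mult_left_mono) auto
    finally have "exp (u * y) \<le> exp (\<bar>u\<bar> * \<epsilon>)" by simp
    then have "\<bar>exp (u * y) * (f (x + y) - f x - y * f1 x)\<bar> \<le> exp (\<bar>u\<bar> * \<epsilon>) * (A * y\<^sup>2)"
      unfolding abs_mult using q by (intro mult_mono) auto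
    then show "\<bar>exp (u * y) * (f (x + y) - f x - y * f1 x)\<bar> \<le> (exp (\<bar>u\<bar> * \<epsilon>) * A) * y\<^sup>2" by (simp add: mult.assoc)
  qed (use A0 in auto)
  show "set_integrable \<nu> (- {-\<epsilon>..\<epsilon>}) (\<lambda>y. f (x + y))"
    by (rule large_jumps_integrable[OF eps, where C=A]) (use A in auto)
  show "set_integrable \<nu> (- {-\<epsilon>..\<epsilon>}) (\<lambda>y. f (x + y) - f x)"
  proof (rule large_jumps_integrable[OF eps])
    fix y
    show "\<bar>f (x + y) - f x\<bar> \<le> 2 * A" using A(1)[of "x + y"] A(1)[of x] by linarith
  qed simp
qed

text \<open>Moves the truncation from 1 to \<epsilon>. The two truncations differ on the two annuli
  of \<open>drift_eps\<close>, one of which is always empty, so no case distinction on \<epsilon> is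
  needed.\<close>

lemma generator_eq:
  assumes eps: "0 < \<epsilon>" and f: "C2_compact f f1 f2"
  shows "generator f f1 f2 x = drift_eps \<nu> b \<epsilon> * f1 x + \<sigma>2 / 2 * f2 x
     + (LINT y:{-\<epsilon>..\<epsilon>} - {0}|\<nu>. f (x + y) - f x - y * f1 x) + (LINT y:- {-\<epsilon>..\<epsilon>}|\<nu>. f (x + y) - f x)"
proof -
  note I = jump_integrands_integrable(1,3)[OF eps f, of x] drift_correction_integrable[OF eps]
  note I' = I[unfolded set_integrable_def]
  have "(LINT y|\<nu>. f (x + y) - f x - indicator {y. \<bar>y\<bar> \<le> 1} y * (y * f1 x)) =
     (LINT y|\<nu>. indicator ({-\<epsilon>..\<epsilon>} - {0}) y *\<^sub>R (f (x + y) - f x - y * f1 x) + indicator (- {-\<epsilon>..\<epsilon>}) y *\<^sub>R (f (x + y) - f x)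
        + f1 x * (indicator ({-\<epsilon>..\<epsilon>} - {-1..1}) y *\<^sub>R y) - f1 x * (indicator ({-1..1} - {-\<epsilon>..\<epsilon>}) y *\<^sub>R y))"
    by (intro Bochner_Integration.integral_cong refl) (auto simp: indicator_def)
  also have "\<dots> = (LINT y:{-\<epsilon>..\<epsilon>} - {0}|\<nu>. f (x + y) - f x - y * f1 x) + (LINT y:- {-\<epsilon>..\<epsilon>}|\<nu>. f (x + y) - f x)
      + f1 x * (LINT y:{-\<epsilon>..\<epsilon>} - {-1..1}|\<nu>. y) - f1 x * (LINT y:{-1..1} - {-\<epsilon>..\<epsilon>}|\<nu>. y)"
    unfolding set_lebesgue_integral_def using I'
    by (simp only: Bochner_Integration.integral_diff Bochner_Integration.integral_add
      Bochner_Integration.integrable_add integrable_mult_right integral_mult_right_zero)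
  finally show ?thesis by (simp add: generator_def drift_eps_def algebra_simps)
qed

text \<open>The exponential factor turns the small jumps into jumps with density exp (u * y), and
  the coefficient of g1 becomes \<Lambda>' u = 0. The coefficient of g is \<Lambda> u; the large
  jumps are kept as gain minus loss.\<close>

lemma tilted_generator:
  assumes eps: "0 < \<epsilon>" and g: "C2_compact g g1 g2" and crit: "deriv (Lambda_eps \<nu> \<sigma>2 b \<epsilon>) u = 0"
  defines "f \<equiv> \<lambda>x. exp (u * x) * g x"
  shows "generator f (\<lambda>x. exp (u * x) * (u * g x + g1 x)) (\<lambda>x. exp (u * x) * (u\<^sup>2 * g x + 2 * u * g1 x + g2 x)) x =
     exp (u * x) * (g x * Lambda_eps \<nu> \<sigma>2 b \<epsilon> u + \<sigma>2 / 2 * g2 x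
        + (LINT y:{-\<epsilon>..\<epsilon>} - {0}|\<nu>. exp (u * y) * (g (x + y) - g x - y * g1 x)))
     + (LINT y:- {-\<epsilon>..\<epsilon>}|\<nu>. f (x + y)) - measure \<nu> (- {-\<epsilon>..\<epsilon>}) * f x"
proof -
  let ?S = "{-\<epsilon>..\<epsilon>} - {0::real}" and ?L = "- {-\<epsilon>..\<epsilon>}"
  define f1 f2 where "f1 x = exp (u * x) * (u * g x + g1 x)" and "f2 x = exp (u * x) * (u\<^sup>2 * g x + 2 * u * g1 x + g2 x)" for x
  have f: "C2_compact f f1 f2"
    using C2_compact_exp_mult[OF g] unfolding f_def f1_def[abs_def] f2_def[abs_def] .
  note I = jump_integrands_integrable(2)[OF eps g, of u x] exp_integrands_integrable(1,2)[OF eps, of u]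
  \<comment> \<open>The three summands are the tilted second-order increment and the integrands of
    \<Lambda> u and \<Lambda>' u.\<close>
  have "(LINT y:?S|\<nu>. f (x + y) - f x - y * f1 x) =
     (LINT y:?S|\<nu>. exp (u * x) * (exp (u * y) * (g (x + y) - g x - y * g1 x)
         + g x * (exp (u * y) - 1 - u * y) + g1 x * (y * (exp (u * y) - 1))))"
    by (simp add: f_def f1_def exp_add algebra_simps)
  also have "\<dots> = exp (u * x) * ((LINT y:?S|\<nu>. exp (u * y) * (g (x + y) - g x - y * g1 x))
       + g x * (LINT y:?S|\<nu>. exp (u * y) - 1 - u * y) + g1 x * (LINT y:?S|\<nu>. y * (exp (u * y) - 1)))"
    using I by (simp only: set_integral_mult_right set_integral_add set_integrable_mult_right)
  finally have small: "(LINT y:?S|\<nu>. f (x + y) - f x - y * f1 x) = \<dots>" .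
  have fin: "emeasure \<nu> ?L < \<infinity>" by (rule emeasure_levy_away_finite[OF eps])
  have "set_integrable \<nu> ?L (\<lambda>y. f x)" by (rule large_jumps_integrable[OF eps, where C="\<bar>f x\<bar>"]) auto
  then have large: "(LINT y:?L|\<nu>. f (x + y) - f x) = (LINT y:?L|\<nu>. f (x + y)) - measure \<nu> ?L * f x"
    using jump_integrands_integrable(4)[OF eps f, of x] fin
    by (simp add: set_integral_diff set_integral_const)
  have crit': "\<sigma>2 * u + drift_eps \<nu> b \<epsilon> + (LINT y:?S|\<nu>. y * (exp (u * y) - 1)) = 0"
    using crit unfolding deriv_Lambda_eps[OF eps] .
  \<comment> \<open>Substituting this for the drift cancels every occurrence of g1 outside the
    increments.\<close>
  have drift: "drift_eps \<nu> b \<epsilon> = - \<sigma>2 * u - (LINT y:?S|\<nu>. y * (exp (u * y) - 1))" using crit' by simp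
  have "generator f f1 f2 x = exp (u * x) * (g x * Lambda_eps \<nu> \<sigma>2 b \<epsilon> u + \<sigma>2 / 2 * g2 x
        + (LINT y:?S|\<nu>. exp (u * y) * (g (x + y) - g x - y * g1 x)))
     + (LINT y:?L|\<nu>. f (x + y)) - measure \<nu> ?L * f x"
    unfolding generator_eq[OF eps f] small large Lambda_eps_def drift
    by (simp add: f1_def f2_def algebra_simps power2_eq_square)
  then show ?thesis unfolding f1_def[abs_def] f2_def[abs_def] .
qed

text \<open>The jump condition, integrated against exp (u * y), and the diffusion condition combine
  to - c times \<open>F_bar\<close>; the 2 in the latter compensates the half in
  \<open>\<sigma>2 / 2\<close>. What the large jumps bring in is non-negative and is
  dropped.\<close>

lemma tilted_generator_ge:
  assumes eps: "0 < \<epsilon>" and g: "C2_compact g g1 g2" and crit: "deriv (Lambda_eps \<nu> \<sigma>2 b \<epsilon>) u = 0"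
    and nonneg: "\<And>x. 0 \<le> g x"
    and jump: "\<And>y. \<bar>y\<bar> \<le> \<epsilon> \<Longrightarrow> - (c / \<epsilon>\<^sup>2) * y\<^sup>2 * g x \<le> g (x + y) - g x - y * g1 x"
    and diffusion: "- 2 * (c / \<epsilon>\<^sup>2) * g x \<le> g2 x"
  shows "- (measure \<nu> (- {-\<epsilon>..\<epsilon>}) - Lambda_eps \<nu> \<sigma>2 b \<epsilon> u + c * F_bar \<nu> \<sigma>2 \<epsilon> u) * (exp (u * x) * g x) \<le>
     generator (\<lambda>x. exp (u * x) * g x) (\<lambda>x. exp (u * x) * (u * g x + g1 x)) (\<lambda>x. exp (u * x) * (u\<^sup>2 * g x + 2 * u * g1 x + g2 x)) x"
proof -
  let ?S = "{-\<epsilon>..\<epsilon>} - {0::real}" and ?L = "- {-\<epsilon>..\<epsilon>}"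
  let ?I = "LINT y:?S|\<nu>. y\<^sup>2 * exp (u * y)" and ?J = "LINT y:?S|\<nu>. exp (u * y) * (g (x + y) - g x - y * g1 x)"
  have "- (c / \<epsilon>\<^sup>2) * g x * ?I = (LINT y:?S|\<nu>. (- (c / \<epsilon>\<^sup>2) * g x) * (y\<^sup>2 * exp (u * y)))"
    by (simp only: set_integral_mult_right)
  also have "\<dots> \<le> ?J"
  proof (rule set_integral_mono)
    show "set_integrable \<nu> ?S (\<lambda>y. (- (c / \<epsilon>\<^sup>2) * g x) * (y\<^sup>2 * exp (u * y)))"
      by (rule set_integrable_mult_right) (rule exp_integrands_integrable[OF eps])
    show "set_integrable \<nu> ?S (\<lambda>y. exp (u * y) * (g (x + y) - g x - y * g1 x))"
      by (rule jump_integrands_integrable[OF eps g])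
    fix y assume "y \<in> ?S"
    then have "- (c / \<epsilon>\<^sup>2) * y\<^sup>2 * g x \<le> g (x + y) - g x - y * g1 x" by (intro jump) auto
    then have "exp (u * y) * (- (c / \<epsilon>\<^sup>2) * y\<^sup>2 * g x) \<le> exp (u * y) * (g (x + y) - g x - y * g1 x)"
      by (intro mult_left_mono) auto
    then show "(- (c / \<epsilon>\<^sup>2) * g x) * (y\<^sup>2 * exp (u * y)) \<le> exp (u * y) * (g (x + y) - g x - y * g1 x)"
      by (simp add: mult_ac)
  qed
  finally have J: "- (c / \<epsilon>\<^sup>2) * g x * ?I \<le> ?J" .
  have "\<sigma>2 / 2 * (- 2 * (c / \<epsilon>\<^sup>2) * g x) \<le> \<sigma>2 / 2 * g2 x"
    using diffusion variance_nonneg by (intro mult_left_mono) auto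
  then have "g x * (Lambda_eps \<nu> \<sigma>2 b \<epsilon> u - c * F_bar \<nu> \<sigma>2 \<epsilon> u) \<le> g x * Lambda_eps \<nu> \<sigma>2 b \<epsilon> u + \<sigma>2 / 2 * g2 x + ?J"
    using J by (simp add: F_bar_def algebra_simps)
  then have "exp (u * x) * (g x * (Lambda_eps \<nu> \<sigma>2 b \<epsilon> u - c * F_bar \<nu> \<sigma>2 \<epsilon> u)) \<le>
      exp (u * x) * (g x * Lambda_eps \<nu> \<sigma>2 b \<epsilon> u + \<sigma>2 / 2 * g2 x + ?J)" by (intro mult_left_mono) auto
  moreover have "0 \<le> (LINT y:?L|\<nu>. exp (u * (x + y)) * g (x + y))"
    unfolding set_lebesgue_integral_def using nonneg by (intro integral_nonneg_AE) auto
  ultimately show ?thesis unfolding tilted_generator[OF eps g crit] by (simp add: algebra_simps)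
qed

text \<open>The mirror image, except that the inflow from the large jumps now has the wrong sign and
  must be estimated by \<open>\<eta>\<close>.\<close>

lemma tilted_generator_le:
  assumes eps: "0 < \<epsilon>" and g: "C2_compact g g1 g2" and crit: "deriv (Lambda_eps \<nu> \<sigma>2 b \<epsilon>) u = 0"
    and jump: "\<And>y. \<bar>y\<bar> \<le> \<epsilon> \<Longrightarrow> g (x + y) - g x - y * g1 x \<le> - (c / \<epsilon>\<^sup>2) * y\<^sup>2 * g x"
    and diffusion: "g2 x \<le> - 2 * (c / \<epsilon>\<^sup>2) * g x"
    and large: "(LINT y:- {-\<epsilon>..\<epsilon>}|\<nu>. exp (u * (x + y)) * g (x + y)) \<le> \<eta>"
  shows "generator (\<lambda>x. exp (u * x) * g x) (\<lambda>x. exp (u * x) * (u * g x + g1 x)) (\<lambda>x. exp (u * x) * (u\<^sup>2 * g x + 2 * u * g1 x + g2 x)) x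
    \<le> - (measure \<nu> (- {-\<epsilon>..\<epsilon>}) - Lambda_eps \<nu> \<sigma>2 b \<epsilon> u + c * F_bar \<nu> \<sigma>2 \<epsilon> u) * (exp (u * x) * g x) + \<eta>"
proof -
  let ?S = "{-\<epsilon>..\<epsilon>} - {0::real}" and ?L = "- {-\<epsilon>..\<epsilon>}"
  let ?I = "LINT y:?S|\<nu>. y\<^sup>2 * exp (u * y)" and ?J = "LINT y:?S|\<nu>. exp (u * y) * (g (x + y) - g x - y * g1 x)"
  have "?J \<le> (LINT y:?S|\<nu>. (- (c / \<epsilon>\<^sup>2) * g x) * (y\<^sup>2 * exp (u * y)))"
  proof (rule set_integral_mono)
    show "set_integrable \<nu> ?S (\<lambda>y. (- (c / \<epsilon>\<^sup>2) * g x) * (y\<^sup>2 * exp (u * y)))"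
      by (rule set_integrable_mult_right) (rule exp_integrands_integrable[OF eps])
    show "set_integrable \<nu> ?S (\<lambda>y. exp (u * y) * (g (x + y) - g x - y * g1 x))"
      by (rule jump_integrands_integrable[OF eps g])
    fix y assume "y \<in> ?S"
    then have "g (x + y) - g x - y * g1 x \<le> - (c / \<epsilon>\<^sup>2) * y\<^sup>2 * g x" by (intro jump) auto
    then have "exp (u * y) * (g (x + y) - g x - y * g1 x) \<le> exp (u * y) * (- (c / \<epsilon>\<^sup>2) * y\<^sup>2 * g x)"
      by (intro mult_left_mono) auto
    then show "exp (u * y) * (g (x + y) - g x - y * g1 x) \<le> (- (c / \<epsilon>\<^sup>2) * g x) * (y\<^sup>2 * exp (u * y))"
      by (simp add: mult_ac)
  qed
  also have "\<dots> = - (c / \<epsilon>\<^sup>2) * g x * ?I" by (simp only: set_integral_mult_right)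
  finally have J: "?J \<le> - (c / \<epsilon>\<^sup>2) * g x * ?I" .
  have "\<sigma>2 / 2 * g2 x \<le> \<sigma>2 / 2 * (- 2 * (c / \<epsilon>\<^sup>2) * g x)"
    using diffusion variance_nonneg by (intro mult_left_mono) auto
  then have "g x * Lambda_eps \<nu> \<sigma>2 b \<epsilon> u + \<sigma>2 / 2 * g2 x + ?J \<le> g x * (Lambda_eps \<nu> \<sigma>2 b \<epsilon> u - c * F_bar \<nu> \<sigma>2 \<epsilon> u)"
    using J by (simp add: F_bar_def algebra_simps)
  then have "exp (u * x) * (g x * Lambda_eps \<nu> \<sigma>2 b \<epsilon> u + \<sigma>2 / 2 * g2 x + ?J) \<le>
      exp (u * x) * (g x * (Lambda_eps \<nu> \<sigma>2 b \<epsilon> u - c * F_bar \<nu> \<sigma>2 \<epsilon> u))" by (intro mult_left_mono) auto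
  then show ?thesis unfolding tilted_generator[OF eps g crit] using large by (simp add: algebra_simps)
qed

end

section \<open>Test functions and small balls\<close>

lemma pos_part_power_derivative:
  "((\<lambda>z::real. max 0 z ^ Suc (Suc n)) has_real_derivative real (Suc (Suc n)) * max 0 z ^ Suc n) (at z)"
proof (cases z "0::real" rule: linorder_cases)
  case less
  have "((\<lambda>z::real. max 0 z ^ Suc (Suc n)) has_real_derivative 0) (at z)"
    by (rule has_field_derivative_transform_within_open[of "\<lambda>_. 0" _ _ "{..<0}"]) (use less in auto)
  then show ?thesis using less by simp
next
  case equal
  \<comment> \<open>At the kink the power is at most h^2, so the derivative exists and is 0.\<close>
  have "((\<lambda>z::real. max 0 z ^ Suc (Suc n)) has_real_derivative 0) (at 0)"
  proof (rule quadratic_error_imp_has_derivative)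
    fix h :: real assume h: "\<bar>h\<bar> \<le> 1"
    have "max 0 h ^ n \<le> 1" using h by (intro power_le_one) auto
    then have "max 0 h ^ 2 * max 0 h ^ n \<le> max 0 h ^ 2 * 1" by (intro mult_left_mono) auto
    also have "\<dots> \<le> h\<^sup>2" by (simp add: max_def)
    finally have "max 0 h ^ Suc (Suc n) \<le> h\<^sup>2" by (simp add: power2_eq_square)
    then show "\<bar>max 0 (0 + h) ^ Suc (Suc n) - max 0 0 ^ Suc (Suc n) - h * 0\<bar> \<le> 1 * h\<^sup>2" by simp
  qed
  then show ?thesis using equal by simp
next
  case greater
  have "((\<lambda>z::real. max 0 z ^ Suc (Suc n)) has_real_derivative real (Suc (Suc n)) * z ^ Suc n) (at z)"
  proof (rule has_field_derivative_transform_within_open[of "\<lambda>z. z ^ Suc (Suc n)" _ _ "{0<..}"])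
    show "((\<lambda>z. z ^ Suc (Suc n)) has_real_derivative real (Suc (Suc n)) * z ^ Suc n) (at z)"
      using DERIV_pow[of "Suc (Suc n)" z UNIV] by simp
  qed (use greater in auto)
  then show ?thesis using greater by simp
qed

lemma pos_part_cube_chain:
  assumes "(w has_real_derivative w') (at x)"
  shows "((\<lambda>x. max 0 (w x) ^ 3) has_real_derivative 3 * (max 0 (w x))\<^sup>2 * w') (at x)"
  using DERIV_chain2[OF pos_part_power_derivative[of 1] assms] by (simp add: numeral_3_eq_3 numeral_2_eq_2)

lemma pos_part_square_chain:
  assumes "(w has_real_derivative w') (at x)"
  shows "((\<lambda>x. (max 0 (w x))\<^sup>2) has_real_derivative 2 * max 0 (w x) * w') (at x)"
  using DERIV_chain2[OF pos_part_power_derivative[of 0] assms] by (simp add: numeral_2_eq_2)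

text \<open>In units of \<epsilon> the support is [-3, 3]. The cube is the lowest integer power of
  the positive part that is still C^2.\<close>

definition bump :: "real \<Rightarrow> real" where "bump t = max 0 (1 - t\<^sup>2 / 9) ^ 3"
definition bump1 :: "real \<Rightarrow> real" where "bump1 t = 3 * (max 0 (1 - t\<^sup>2 / 9))\<^sup>2 * (- (2 * t / 9))"
definition bump2 :: "real \<Rightarrow> real" where
  "bump2 t = 6 * max 0 (1 - t\<^sup>2 / 9) * (2 * t / 9)\<^sup>2 - 2 / 3 * (max 0 (1 - t\<^sup>2 / 9))\<^sup>2"

lemma bump_derivatives:
  "(bump has_real_derivative bump1 t) (at t)" "(bump1 has_real_derivative bump2 t) (at t)"
proof -
  have w: "((\<lambda>t::real. 1 - t\<^sup>2 / 9) has_real_derivative - (2 * t / 9)) (at t)" for t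
    by (auto intro!: derivative_eq_intros)
  show "(bump has_real_derivative bump1 t) (at t)"
    unfolding bump_def[abs_def] bump1_def by (rule pos_part_cube_chain[OF w])
  show "(bump1 has_real_derivative bump2 t) (at t)"
    unfolding bump1_def[abs_def] bump2_def
    by (rule derivative_eq_intros pos_part_square_chain[OF w] refl | simp add: power2_eq_square algebra_simps)+
qed

lemma C2_compact_bump: "C2_compact bump bump1 bump2"
  unfolding C2_compact_def
proof (intro conjI allI bump_derivatives exI impI)
  show "continuous_on UNIV bump2" unfolding bump2_def[abs_def] by (intro continuous_intros) auto
  fix t :: real assume "3 < \<bar>t\<bar>"
  then have "3\<^sup>2 \<le> \<bar>t\<bar>\<^sup>2" by (intro power_mono) auto
  then show "bump t = 0" by (simp add: bump_def)
qed

lemma bump_nonneg: "0 \<le> bump t" and bump_le_1: "bump t \<le> 1"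
  by (auto simp: bump_def intro!: power_le_one)

text \<open>In m = max 0 (1 - t^2 / 9) the second derivative is a quadratic polynomial, which makes
  the sign and the minimum visible: zeros at 0 and 4/5, least value - 2/3 on [0, 1] at m =
  1.\<close>

lemma bump2_eq: "bump2 t = max 0 (1 - t\<^sup>2 / 9) * (8 / 3 - 10 / 3 * max 0 (1 - t\<^sup>2 / 9))"
  by (cases "t\<^sup>2 \<le> 9") (simp_all add: bump2_def max_def power2_eq_square field_simps)

lemma bump2_ge: "- (2 / 3) \<le> bump2 t"
proof -
  define m where "m = max 0 (1 - t\<^sup>2 / 9)"
  have m: "0 \<le> m" "m \<le> 1" by (auto simp: m_def)
  have "0 \<le> (1 - m) * (10 / 3 * m + 2 / 3)" using m by (intro mult_nonneg_nonneg) auto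
  moreover have "(1 - m) * (10 / 3 * m + 2 / 3) = m * (8 / 3 - 10 / 3 * m) + 2 / 3" by (simp add: field_simps)
  ultimately have "- (2 / 3) \<le> m * (8 / 3 - 10 / 3 * m)" by linarith
  then show ?thesis by (simp add: bump2_eq m_def)
qed

text \<open>Convexity starts where m <= 4/5, that is t^2 >= 9/5. The rational threshold 7/5 lies
  beyond and is 12/5 - 1, the closest a unit jump from outside \<open>12 / 5\<close> can come to
  0.\<close>

lemma bump2_nonneg: "7 / 5 \<le> \<bar>t\<bar> \<Longrightarrow> 0 \<le> bump2 t"
proof -
  assume "7 / 5 \<le> \<bar>t\<bar>"
  then have "(7 / 5)\<^sup>2 \<le> \<bar>t\<bar>\<^sup>2" by (intro power_mono) auto
  then have "49 / 25 \<le> t\<^sup>2" by (simp add: power2_eq_square)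
  then have "max 0 (1 - t\<^sup>2 / 9) \<le> 4 / 5" by (intro max.boundedI) auto
  from mult_left_mono[OF this, of "10 / 3"] have "0 \<le> 8 / 3 - 10 / 3 * max 0 (1 - t\<^sup>2 / 9)" by simp
  then show ?thesis unfolding bump2_eq by (intro mult_nonneg_nonneg) auto
qed

text \<open>At the edge m = 9/25, whose cube exceeds 1/30; and 20/30 is the bound 2/3 of
  \<open>bump2_ge\<close>.\<close>

lemma bump_ge: "\<bar>t\<bar> \<le> 12 / 5 \<Longrightarrow> 1 / 30 \<le> bump t"
proof -
  assume "\<bar>t\<bar> \<le> 12 / 5"
  then have "\<bar>t\<bar>\<^sup>2 \<le> (12 / 5)\<^sup>2" by (intro power_mono) auto
  then have "t\<^sup>2 \<le> 144 / 25" by (simp add: power2_eq_square)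
  then have "9 / 25 \<le> max 0 (1 - t\<^sup>2 / 9)" unfolding le_max_iff_disj by linarith
  then have "(9 / 25) ^ 3 \<le> max 0 (1 - t\<^sup>2 / 9) ^ 3" by (rule power_mono) simp
  then show ?thesis by (simp add: bump_def power3_eq_cube)
qed

text \<open>
  Near the boundary of its support the bump is convex, so that a jump cannot decrease it below
  its tangent; elsewhere it is bounded away from 0.
\<close>

lemma bump_jump:
  assumes "\<bar>s\<bar> \<le> 1"
  shows "- 10 * s\<^sup>2 * bump t \<le> bump (t + s) - bump t - s * bump1 t"
proof -
  obtain z where z: "min t (t + s) \<le> z" "z \<le> max t (t + s)" "bump (t + s) = bump t + s * bump1 t + s\<^sup>2 / 2 * bump2 z"
    by (rule taylor_second_order[OF bump_derivatives])
  \<comment> \<open>The 20 is twice the constant 10, because the Taylor remainder has a half. In the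
    inner case the minimum of the second derivative is absorbed by 20/30; in the outer one the
    intermediate point lies in the convex region.\<close>
  have "- 20 * bump t \<le> bump2 z"
  proof (cases "\<bar>t\<bar> \<le> 12 / 5")
    case True then show ?thesis using bump_ge[OF True] bump2_ge[of z] by simp
  next
    case False
    then have "7 / 5 \<le> \<bar>z\<bar>" using z(1,2) assms by (auto simp: min_def max_def abs_if split: if_splits)
    from bump2_nonneg[OF this] show ?thesis using bump_nonneg[of t] by linarith
  qed
  then have "s\<^sup>2 / 2 * (- 20 * bump t) \<le> s\<^sup>2 / 2 * bump2 z" by (intro mult_left_mono) auto
  moreover have "- 10 * s\<^sup>2 * bump t = s\<^sup>2 / 2 * (- 20 * bump t)" by simp
  ultimately show ?thesis using z(3) by linarith
qed

lemma bump_diffusion: "- 20 * bump t \<le> bump2 t"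
  using bump_ge[of t] bump2_ge[of t] bump2_nonneg[of t] bump_nonneg[of t]
  by (cases "\<bar>t\<bar> \<le> 12 / 5") linarith+

section \<open>The cut-off cosine for the ball of radius \<epsilon>/2\<close>

lemma C2_compact_cutoff:
  fixes \<delta> :: real
  assumes "0 < \<delta>"
  obtains \<phi> \<phi>1 \<phi>2 where "C2_compact \<phi> \<phi>1 \<phi>2" "\<And>t. 0 \<le> \<phi> t" "\<And>t. \<phi> t \<le> 1"
    "\<And>t. \<bar>t\<bar> \<le> 1 / 2 \<Longrightarrow> \<phi> t = 1 \<and> \<phi>1 t = 0 \<and> \<phi>2 t = 0" "\<And>t. 1 / 2 + \<delta> < \<bar>t\<bar> \<Longrightarrow> \<phi> t = 0"
proof -
  \<comment> \<open>The distances beyond 1/2 and below - 1/2 in units of \<delta>; outside the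
    collar one of them is at least 1.\<close>
  define a b where "a t = max 0 ((t - 1 / 2) / \<delta>)" and "b t = max 0 ((- t - 1 / 2) / \<delta>)" for t
  \<comment> \<open>Two layers of cubes: this one joins the plateau smoothly at 1/2 and - 1/2, and
    the cube of the positive part of w smooths the junction with 0.\<close>
  define w w1 w2 where "w t = 1 - a t ^ 3 - b t ^ 3" and "w1 t = - (3 * (a t)\<^sup>2 * (1 / \<delta>)) - 3 * (b t)\<^sup>2 * (- 1 / \<delta>)"
    and "w2 t = - (6 * a t * (1 / \<delta>)\<^sup>2) - 6 * b t * (1 / \<delta>)\<^sup>2" for t
  have l: "((\<lambda>t. (t - 1 / 2) / \<delta>) has_real_derivative 1 / \<delta>) (at t)" "((\<lambda>t. (- t - 1 / 2) / \<delta>) has_real_derivative - 1 / \<delta>) (at t)" for t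
    using assms by (auto intro!: derivative_eq_intros)
  have w: "(w has_real_derivative w1 t) (at t)" for t
    unfolding w_def[abs_def] w1_def a_def b_def
    by (rule derivative_eq_intros pos_part_cube_chain l refl | simp)+
  have w1: "(w1 has_real_derivative w2 t) (at t)" for t
    unfolding w1_def[abs_def] w2_def a_def b_def
    by (rule derivative_eq_intros pos_part_square_chain l refl | simp add: power2_eq_square)+
  define \<phi> \<phi>1 \<phi>2 where "\<phi> t = max 0 (w t) ^ 3" and "\<phi>1 t = 3 * (max 0 (w t))\<^sup>2 * w1 t"
    and "\<phi>2 t = 6 * max 0 (w t) * (w1 t)\<^sup>2 + 3 * (max 0 (w t))\<^sup>2 * w2 t" for t
  have supp: "\<phi> t = 0" if "1 / 2 + \<delta> < \<bar>t\<bar>" for t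
  proof -
    have "1 \<le> a t \<or> 1 \<le> b t" using that assms by (auto simp: a_def b_def le_max_iff_disj abs_if split: if_splits)
    moreover have "0 \<le> a t" "0 \<le> b t" by (auto simp: a_def b_def)
    ultimately have "1 \<le> a t ^ 3 + b t ^ 3"
      using one_le_power[of "a t" 3] one_le_power[of "b t" 3] zero_le_power[of "a t" 3] zero_le_power[of "b t" 3] by linarith
    then show ?thesis by (simp add: \<phi>_def w_def)
  qed
  show ?thesis
  proof
    show "C2_compact \<phi> \<phi>1 \<phi>2"
      unfolding C2_compact_def
    proof (intro conjI allI exI impI)
      show "(\<phi> has_real_derivative \<phi>1 t) (at t)" for t
        unfolding \<phi>_def[abs_def] \<phi>1_def by (rule pos_part_cube_chain[OF w])
      show "(\<phi>1 has_real_derivative \<phi>2 t) (at t)" for t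
        unfolding \<phi>1_def[abs_def] \<phi>2_def
        by (rule derivative_eq_intros pos_part_square_chain[OF w] w1 refl | simp add: power2_eq_square)+
      have "continuous_on UNIV a" "continuous_on UNIV b"
        unfolding a_def[abs_def] b_def[abs_def] using assms by (intro continuous_intros; simp)+
      then show "continuous_on UNIV \<phi>2"
        unfolding \<phi>2_def[abs_def] w_def[abs_def] w1_def[abs_def] w2_def[abs_def] using assms by (intro continuous_intros) auto
    qed (rule supp)
    show "0 \<le> \<phi> t" for t by (simp add: \<phi>_def)
    have "w t \<le> 1" for t
    proof -
      have "0 \<le> a t ^ 3" "0 \<le> b t ^ 3" by (simp_all add: a_def b_def)
      then show ?thesis unfolding w_def by linarith
    qed
    then show "\<phi> t \<le> 1" for t unfolding \<phi>_def by (intro power_le_one) auto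
    show "\<phi> t = 1 \<and> \<phi>1 t = 0 \<and> \<phi>2 t = 0" if "\<bar>t\<bar> \<le> 1 / 2" for t
    proof -
      have "(t - 1 / 2) / \<delta> \<le> 0" "(- t - 1 / 2) / \<delta> \<le> 0" using that assms by (auto simp: divide_le_eq)
      then have "a t = 0" "b t = 0" by (auto simp: a_def b_def)
      then show ?thesis by (simp add: \<phi>_def \<phi>1_def \<phi>2_def w_def w1_def w2_def)
    qed
  qed (rule supp)
qed

lemma cos_ge_7_8: "\<bar>t\<bar> \<le> 1 / 2 \<Longrightarrow> 7 / 8 \<le> cos t" for t :: real
proof -
  assume "\<bar>t\<bar> \<le> 1 / 2"
  then have "\<bar>t\<bar>\<^sup>2 \<le> (1 / 2)\<^sup>2" by (intro power_mono) auto
  moreover obtain z where "cos (0 + t) = cos 0 + t * - sin 0 + t\<^sup>2 / 2 * - cos z"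
    by (rule taylor_second_order[of cos "\<lambda>z. - sin z" "\<lambda>z. - cos z" 0 t]) (auto intro!: derivative_eq_intros)
  moreover have "t\<^sup>2 / 2 * cos z \<le> t\<^sup>2 / 2 * 1" by (intro mult_left_mono) auto
  ultimately show ?thesis by (simp add: power2_eq_square)
qed

text \<open>The increment equals sin t * (s - sin s) - cos t * (1 - cos s). The second product is at
  least 63/160 s^2, the first at most 1/12 s^2, and since 1 + cos t <= 2 a decrease of 1/6 s^2 is
  enough.\<close>

lemma cos_jump:
  fixes s t :: real
  assumes "\<bar>s\<bar> \<le> 1" "\<bar>t\<bar> \<le> 1 / 2"
  shows "cos (t + s) - cos t + s * sin t \<le> - (1 / 12) * s\<^sup>2 * (1 + cos t)"
proof -
  have cube: "\<bar>s\<bar> ^ 3 \<le> s\<^sup>2"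
    using mult_left_mono[OF assms(1), of "s\<^sup>2"] by (simp add: power3_eq_cube power2_eq_square)
  \<comment> \<open>By the half-angle formula; for x <= 1/2 the cubic bound gives sin x >= 23/24 x,
    and 2 * 529/576 / 4 exceeds 9/20.\<close>
  have "1 - cos s \<ge> 9 / 20 * s\<^sup>2"
  proof -
    define x where "x = \<bar>s\<bar> / 2"
    have x: "0 \<le> x" "x \<le> 1 / 2" using assms(1) by (auto simp: x_def)
    have "x * x\<^sup>2 \<le> x * (1 / 2)\<^sup>2" using x by (intro mult_left_mono power_mono) auto
    then have "x ^ 3 \<le> x * (1 / 2)\<^sup>2" by (simp add: power3_eq_cube power2_eq_square)
    then have "\<bar>sin x - x\<bar> \<le> x / 24" using abs_sin_minus_self_cubic[of x] x by (simp add: power2_eq_square)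
    then have "23 / 24 * x \<le> sin x" by linarith
    then have "(23 / 24 * x)\<^sup>2 \<le> (sin x)\<^sup>2" using x by (intro power_mono) auto
    moreover have "1 - cos s = 2 * (sin x)\<^sup>2"
      using cos_double_sin[of x] by (simp add: x_def)
    moreover have "s\<^sup>2 = 4 * x\<^sup>2" by (simp add: x_def power_divide)
    moreover have "(23 / 24 * x)\<^sup>2 = 529 / 576 * x\<^sup>2" by (simp add: power_mult_distrib power_divide)
    ultimately show ?thesis using zero_le_power2[of x] by linarith
  qed
  then have "7 / 8 * (9 / 20 * s\<^sup>2) \<le> cos t * (1 - cos s)" using cos_ge_7_8[OF assms(2)] by (intro mult_mono) auto
  moreover have "sin t * (s - sin s) \<le> 1 / 2 * (s\<^sup>2 / 6)"
  proof -
    have "\<bar>sin t\<bar> \<le> 1 / 2" using abs_sin_x_le_abs_x[of t] assms(2) by linarith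
    moreover have "\<bar>s - sin s\<bar> \<le> s\<^sup>2 / 6" using abs_sin_minus_self_cubic[of s] cube by linarith
    ultimately have "\<bar>sin t\<bar> * \<bar>s - sin s\<bar> \<le> 1 / 2 * (s\<^sup>2 / 6)" by (intro mult_mono) auto
    then show ?thesis using abs_ge_self[of "sin t * (s - sin s)"] by (simp add: abs_mult)
  qed
  moreover have "cos (t + s) - cos t + s * sin t = sin t * (s - sin s) - cos t * (1 - cos s)"
    by (simp add: cos_add algebra_simps)
  moreover have "1 / 12 * s\<^sup>2 * (1 + cos t) \<le> 1 / 12 * s\<^sup>2 * 2" by (intro mult_left_mono) auto
  ultimately show ?thesis using zero_le_power2[of s] by linarith
qed

section \<open>The two small ball estimates\<close>

context levy_paths begin

text \<open>The rescaled bump times exp (u * x) is a subsolution. The factor exp (3 \<epsilon> |u|)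
  bounds the exponential on the support.\<close>

lemma small_ball_lower:
  assumes eps: "0 < \<epsilon>" and crit: "deriv (Lambda_eps \<nu> \<sigma>2 b \<epsilon>) u = 0"
  shows "exp (- (measure \<nu> (- {-\<epsilon>..\<epsilon>}) - Lambda_eps \<nu> \<sigma>2 b \<epsilon> u + 10 * F_bar \<nu> \<sigma>2 \<epsilon> u))
    \<le> exp (3 * \<epsilon> * \<bar>u\<bar>) * prob {\<omega> \<in> space M. sup_norm_path X \<omega> \<le> 3 * \<epsilon>}"
proof -
  define g g1 g2 where "g x = bump (x / \<epsilon>)" and "g1 x = bump1 (x / \<epsilon>) / \<epsilon>" and "g2 x = bump2 (x / \<epsilon>) / \<epsilon>\<^sup>2" for x
  have g: "C2_compact g g1 g2"
    using C2_compact_scale[OF C2_compact_bump eps] unfolding g_def[abs_def] g1_def[abs_def] g2_def[abs_def] .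
  let ?K = "measure \<nu> (- {-\<epsilon>..\<epsilon>}) - Lambda_eps \<nu> \<sigma>2 b \<epsilon> u + 10 * F_bar \<nu> \<sigma>2 \<epsilon> u"
  have supp: "g x = 0" if "3 * \<epsilon> < \<bar>x\<bar>" for x
  proof -
    have "3 \<le> \<bar>x / \<epsilon>\<bar>" using that eps by (simp add: abs_divide pos_le_divide_eq)
    then have "3\<^sup>2 \<le> \<bar>x / \<epsilon>\<bar>\<^sup>2" by (intro power_mono) auto
    then have "9 \<le> (x / \<epsilon>)\<^sup>2" unfolding power2_abs by simp
    then show ?thesis by (simp add: g_def bump_def)
  qed
  have "exp (- ?K) * (exp (u * 0) * g 0) \<le> exp (3 * \<epsilon> * \<bar>u\<bar>) * prob {\<omega> \<in> space M. sup_norm_path X \<omega> \<le> 3 * \<epsilon>}"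
  proof (rule confinement_lower[OF C2_compact_exp_mult[OF g]])
    fix x
    show "0 \<le> exp (u * x) * g x" by (simp add: g_def bump_nonneg)
    show "exp (u * x) * g x = 0" if "3 * \<epsilon> < \<bar>x\<bar>" using supp[OF that] by simp
    show "exp (u * x) * g x \<le> exp (3 * \<epsilon> * \<bar>u\<bar>)"
    proof (cases "3 * \<epsilon> < \<bar>x\<bar>")
      case True then show ?thesis using supp by simp
    next
      case False
      have "u * x \<le> \<bar>u\<bar> * \<bar>x\<bar>" using abs_ge_self[of "u * x"] by (simp add: abs_mult)
      also have "\<dots> \<le> \<bar>u\<bar> * (3 * \<epsilon>)" using False by (intro mult_left_mono) auto
      finally have "u * x \<le> 3 * \<epsilon> * \<bar>u\<bar>" by (simp add: mult.commute)
      then have "exp (u * x) * g x \<le> exp (3 * \<epsilon> * \<bar>u\<bar>) * 1"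
        by (intro mult_mono) (auto simp: g_def bump_nonneg bump_le_1)
      then show ?thesis by simp
    qed
    show "- ?K * (exp (u * x) * g x) \<le> generator (\<lambda>x. exp (u * x) * g x) (\<lambda>x. exp (u * x) * (u * g x + g1 x))
        (\<lambda>x. exp (u * x) * (u\<^sup>2 * g x + 2 * u * g1 x + g2 x)) x"
    proof (rule tilted_generator_ge[OF eps g crit])
      show "0 \<le> g x" for x by (simp add: g_def bump_nonneg)
      fix y assume "\<bar>y\<bar> \<le> \<epsilon>"
      then have "\<bar>y / \<epsilon>\<bar> \<le> 1" using eps by (simp add: abs_divide)
      from bump_jump[OF this, of "x / \<epsilon>"]
      show "- (10 / \<epsilon>\<^sup>2) * y\<^sup>2 * g x \<le> g (x + y) - g x - y * g1 x"
        by (simp add: g_def g1_def add_divide_distrib power_divide)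
    next
      have "(- 20 * bump (x / \<epsilon>)) / \<epsilon>\<^sup>2 \<le> bump2 (x / \<epsilon>) / \<epsilon>\<^sup>2"
        using bump_diffusion by (intro divide_right_mono) auto
      then show "- 2 * (10 / \<epsilon>\<^sup>2) * g x \<le> g2 x" by (simp add: g_def g2_def)
    qed
  qed (use eps in simp)
  moreover have "g 0 = 1" by (simp add: g_def bump_def)
  ultimately show ?thesis by simp
qed

text \<open>
  From the ball of radius \<open>\<epsilon>/2\<close> a jump larger than \<open>\<epsilon>\<close> can only reach the collar of width
  \<open>\<delta>\<epsilon>\<close> on which the cutoff is not yet 0 if its size is at most \<open>(1+\<delta>)\<epsilon>\<close>.
\<close>

lemma small_ball_upper_cutoff:
  assumes eps: "0 < \<epsilon>" and crit: "deriv (Lambda_eps \<nu> \<sigma>2 b \<epsilon>) u = 0" and \<delta>: "0 < \<delta>" "\<delta> \<le> 1"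
  defines "K \<equiv> measure \<nu> (- {-\<epsilon>..\<epsilon>}) - Lambda_eps \<nu> \<sigma>2 b \<epsilon> u + 1 / 12 * F_bar \<nu> \<sigma>2 \<epsilon> u"
  shows "exp (- (\<epsilon> / 2 * \<bar>u\<bar>)) * (15 / 8) * prob {\<omega> \<in> space M. sup_norm_path X \<omega> \<le> \<epsilon> / 2}
    \<le> exp (- K) * 2 + 2 * exp (2 * \<epsilon> * \<bar>u\<bar>) * measure \<nu> {y. \<epsilon> < \<bar>y\<bar> \<and> \<bar>y\<bar> \<le> \<epsilon> + \<delta> * \<epsilon>} * exp \<bar>K\<bar>"
proof -
  obtain \<phi> \<phi>1 \<phi>2 where \<phi>: "C2_compact \<phi> \<phi>1 \<phi>2" "\<And>t. 0 \<le> \<phi> t" "\<And>t. \<phi> t \<le> 1"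
    "\<And>t. \<bar>t\<bar> \<le> 1 / 2 \<Longrightarrow> \<phi> t = 1 \<and> \<phi>1 t = 0 \<and> \<phi>2 t = 0" "\<And>t. 1 / 2 + \<delta> < \<bar>t\<bar> \<Longrightarrow> \<phi> t = 0"
    by (rule C2_compact_cutoff[OF \<delta>(1)]) blast
  define \<gamma> \<gamma>1 \<gamma>2 where "\<gamma> t = (1 + cos t) * \<phi> t" and "\<gamma>1 t = - sin t * \<phi> t + (1 + cos t) * \<phi>1 t"
    and "\<gamma>2 t = - cos t * \<phi> t - 2 * sin t * \<phi>1 t + (1 + cos t) * \<phi>2 t" for t
  have d\<phi>: "\<And>x. (\<phi> has_real_derivative \<phi>1 x) (at x)" "\<And>x. (\<phi>1 has_real_derivative \<phi>2 x) (at x)"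
    using \<phi>(1) by (auto simp: C2_compact_def)
  have \<gamma>: "C2_compact \<gamma> \<gamma>1 \<gamma>2"
    unfolding C2_compact_def
  proof (intro conjI allI exI impI)
    show "(\<gamma> has_real_derivative \<gamma>1 t) (at t)" for t
      unfolding \<gamma>_def[abs_def] \<gamma>1_def by (rule derivative_eq_intros d\<phi> refl | simp add: algebra_simps)+
    show "(\<gamma>1 has_real_derivative \<gamma>2 t) (at t)" for t
      unfolding \<gamma>1_def[abs_def] \<gamma>2_def by (rule derivative_eq_intros d\<phi> refl | simp add: algebra_simps)+
    show "continuous_on UNIV \<gamma>2"
      unfolding \<gamma>2_def[abs_def] by (intro continuous_intros C2_compact_facts[OF \<phi>(1)])
    show "\<gamma> t = 0" if "1 / 2 + \<delta> < \<bar>t\<bar>" for t using \<phi>(5)[OF that] by (simp add: \<gamma>_def)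
  qed
  have cos_nonneg: "0 \<le> 1 + cos t" for t :: real using cos_ge_minus_one[of t] by linarith
  have \<gamma>_nonneg: "0 \<le> \<gamma> t" for t using cos_nonneg \<phi>(2) by (simp add: \<gamma>_def)
  have \<gamma>_le: "\<gamma> t \<le> 1 + cos t" for t
    using mult_left_mono[OF \<phi>(3) cos_nonneg, of t t] by (simp add: \<gamma>_def)
  define g g1 g2 where "g x = \<gamma> (x / \<epsilon>)" and "g1 x = \<gamma>1 (x / \<epsilon>) / \<epsilon>" and "g2 x = \<gamma>2 (x / \<epsilon>) / \<epsilon>\<^sup>2" for x
  have g: "C2_compact g g1 g2"
    using C2_compact_scale[OF \<gamma> eps] unfolding g_def[abs_def] g1_def[abs_def] g2_def[abs_def] .
  have in_half: "\<bar>x / \<epsilon>\<bar> \<le> 1 / 2" if "\<bar>x\<bar> \<le> \<epsilon> / 2" for x using that eps by (simp add: abs_divide divide_le_eq)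
  let ?T = "{y. \<epsilon> < \<bar>y\<bar> \<and> \<bar>y\<bar> \<le> \<epsilon> + \<delta> * \<epsilon>}"
  \<comment> \<open>The 2 bounds 1 + cos, and the exponential bounds exp (u * z) for |z| <= 2
    \<epsilon>, which covers every point reachable in the collar.\<close>
  let ?\<eta> = "2 * exp (2 * \<epsilon> * \<bar>u\<bar>) * measure \<nu> ?T"
  have "exp (- (\<epsilon> / 2 * \<bar>u\<bar>)) * (15 / 8) * prob {\<omega> \<in> space M. sup_norm_path X \<omega> \<le> \<epsilon> / 2}
    \<le> exp (- K) * (exp (u * 0) * g 0) + ?\<eta> * exp \<bar>K\<bar>"
  proof (rule confinement_upper[OF C2_compact_exp_mult[OF g]])
    show "0 \<le> exp (u * x) * g x" for x by (simp add: g_def \<gamma>_nonneg)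
    show "0 \<le> ?\<eta>" by simp
    fix x assume x: "\<bar>x\<bar> \<le> \<epsilon> / 2"
    note t = in_half[OF x]
    \<comment> \<open>Inside the ball the cutoff is 1 with vanishing derivatives, so g and its
      derivatives are those of the cosine.\<close>
    have gx: "g x = 1 + cos (x / \<epsilon>)" "g1 x = - sin (x / \<epsilon>) / \<epsilon>" "g2 x = - cos (x / \<epsilon>) / \<epsilon>\<^sup>2"
      using \<phi>(4)[OF t] by (simp_all add: g_def g1_def g2_def \<gamma>_def \<gamma>1_def \<gamma>2_def)
    have "\<bar>u * x\<bar> \<le> \<bar>u\<bar> * (\<epsilon> / 2)" unfolding abs_mult using x by (intro mult_left_mono) auto
    then have "- (\<epsilon> / 2 * \<bar>u\<bar>) \<le> u * x" by (simp add: abs_le_iff mult.commute)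
    then show "exp (- (\<epsilon> / 2 * \<bar>u\<bar>)) * (15 / 8) \<le> exp (u * x) * g x"
      using cos_ge_7_8[OF t] by (intro mult_mono) (auto simp: gx)
    show "generator (\<lambda>x. exp (u * x) * g x) (\<lambda>x. exp (u * x) * (u * g x + g1 x))
        (\<lambda>x. exp (u * x) * (u\<^sup>2 * g x + 2 * u * g1 x + g2 x)) x \<le> - K * (exp (u * x) * g x) + ?\<eta>"
      unfolding K_def
    proof (rule tilted_generator_le[OF eps g crit])
      fix y assume "\<bar>y\<bar> \<le> \<epsilon>"
      then have "\<bar>y / \<epsilon>\<bar> \<le> 1" using eps by (simp add: abs_divide)
      \<comment> \<open>A small jump may land outside the ball; there the cutoff only lowers the
        function, which is the right direction for a supersolution.\<close>
      from cos_jump[OF this t] \<gamma>_le[of "x / \<epsilon> + y / \<epsilon>"]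
      have "\<gamma> (x / \<epsilon> + y / \<epsilon>) - (1 + cos (x / \<epsilon>)) + y / \<epsilon> * sin (x / \<epsilon>) \<le> - (1 / 12) * (y / \<epsilon>)\<^sup>2 * (1 + cos (x / \<epsilon>))"
        by linarith
      then show "g (x + y) - g x - y * g1 x \<le> - (1 / 12 / \<epsilon>\<^sup>2) * y\<^sup>2 * g x"
        unfolding gx by (simp add: g_def add_divide_distrib power_divide)
    next
      \<comment> \<open>Equivalent to cos >= 1/5, far below the available 7/8.\<close>
      have "1 / 6 * (1 + cos (x / \<epsilon>)) \<le> cos (x / \<epsilon>)" using cos_ge_7_8[OF t] by simp
      then have "1 / 6 * (1 + cos (x / \<epsilon>)) / \<epsilon>\<^sup>2 \<le> cos (x / \<epsilon>) / \<epsilon>\<^sup>2" by (rule divide_right_mono) simp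
      then show "g2 x \<le> - 2 * (1 / 12 / \<epsilon>\<^sup>2) * g x" unfolding gx by simp
    next
      have T: "?T \<in> sets \<nu>" by simp
      have fin: "emeasure \<nu> ?T < \<infinity>"
        by (rule le_less_trans[OF emeasure_mono emeasure_levy_away_finite[OF eps]]) auto
      have "(LINT y:- {-\<epsilon>..\<epsilon>}|\<nu>. exp (u * (x + y)) * g (x + y)) \<le> (LINT y|\<nu>. 2 * exp (2 * \<epsilon> * \<bar>u\<bar>) * indicator ?T y)"
        unfolding set_lebesgue_integral_def
      proof (rule integral_mono)
        show "integrable \<nu> (\<lambda>y. indicator (- {-\<epsilon>..\<epsilon>}) y *\<^sub>R (exp (u * (x + y)) * g (x + y)))"
          using jump_integrands_integrable(4)[OF eps C2_compact_exp_mult[OF g]] unfolding set_integrable_def .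
        show "integrable \<nu> (\<lambda>y. 2 * exp (2 * \<epsilon> * \<bar>u\<bar>) * indicator ?T y)"
          using T fin by (intro integrable_mult_right integrable_real_indicator)
        fix y
        show "indicator (- {-\<epsilon>..\<epsilon>}) y *\<^sub>R (exp (u * (x + y)) * g (x + y)) \<le> 2 * exp (2 * \<epsilon> * \<bar>u\<bar>) * indicator ?T y"
        proof (cases "y \<in> - {-\<epsilon>..\<epsilon>} \<and> \<bar>x + y\<bar> \<le> \<epsilon> / 2 + \<delta> * \<epsilon>")
          case True
          \<comment> \<open>By the triangle inequality |y| <= |x + y| + |x|, and the two halves of
            \<epsilon> add up.\<close>
          then have y: "y \<in> ?T" using x by (auto simp: abs_le_iff)
          have "\<delta> * \<epsilon> \<le> 1 * \<epsilon>" using \<delta> eps by (intro mult_right_mono) auto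
          then have "\<bar>x + y\<bar> \<le> 2 * \<epsilon>" using True eps by linarith
          then have "\<bar>u\<bar> * \<bar>x + y\<bar> \<le> \<bar>u\<bar> * (2 * \<epsilon>)" by (intro mult_left_mono) auto
          then have "u * (x + y) \<le> 2 * \<epsilon> * \<bar>u\<bar>"
            using abs_ge_self[of "u * (x + y)"] by (simp add: abs_mult mult.commute)
          moreover have "g (x + y) \<le> 2" using \<gamma>_le[of "(x + y) / \<epsilon>"] cos_le_one[of "(x + y) / \<epsilon>"] unfolding g_def by linarith
          ultimately have "exp (u * (x + y)) * g (x + y) \<le> exp (2 * \<epsilon> * \<bar>u\<bar>) * 2"
            by (intro mult_mono) (auto simp: g_def \<gamma>_nonneg)
          then show ?thesis using True y by simp
        next
          case False
          have "g (x + y) = 0" if "\<not> \<bar>x + y\<bar> \<le> \<epsilon> / 2 + \<delta> * \<epsilon>"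
          proof -
            have "1 / 2 + \<delta> < \<bar>(x + y) / \<epsilon>\<bar>" using that eps by (simp add: abs_divide pos_less_divide_eq distrib_right)
            then show ?thesis using \<phi>(5) by (simp add: g_def \<gamma>_def)
          qed
          then show ?thesis using False by auto
        qed
      qed
      also have "\<dots> = ?\<eta>" using T by simp
      finally show "(LINT y:- {-\<epsilon>..\<epsilon>}|\<nu>. exp (u * (x + y)) * g (x + y)) \<le> ?\<eta>" .
    qed
  qed (use eps in simp)
  moreover have "g 0 = 2" using \<phi>(4)[of 0] by (simp add: g_def \<gamma>_def)
  ultimately show ?thesis by simp
qed

text \<open>K does not depend on the cutoff, so only the collar mass changes as the collar shrinks.
  The shells exclude |y| = \<epsilon>, whose jumps count as small; hence they decrease to the empty
  set, and their finite mass tends to 0 even if \<nu> has an atom there.\<close>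

lemma small_ball_upper:
  assumes eps: "0 < \<epsilon>" and crit: "deriv (Lambda_eps \<nu> \<sigma>2 b \<epsilon>) u = 0"
  defines "K \<equiv> measure \<nu> (- {-\<epsilon>..\<epsilon>}) - Lambda_eps \<nu> \<sigma>2 b \<epsilon> u + 1 / 12 * F_bar \<nu> \<sigma>2 \<epsilon> u"
  shows "exp (- (\<epsilon> / 2 * \<bar>u\<bar>)) * (15 / 8) * prob {\<omega> \<in> space M. sup_norm_path X \<omega> \<le> \<epsilon> / 2} \<le> 2 * exp (- K)"
proof -
  define T where "T n = {y. \<epsilon> < \<bar>y\<bar> \<and> \<bar>y\<bar> \<le> \<epsilon> + 1 / real (Suc n) * \<epsilon>}" for n
  have "(\<lambda>n. measure \<nu> (T n)) \<longlonglongrightarrow> measure \<nu> (\<Inter>n. T n)"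
  proof (rule Lim_measure_decseq)
    show "range T \<subseteq> sets \<nu>" by (auto simp: T_def)
    show "decseq T"
    proof (rule decseq_SucI)
      fix n
      have "1 / real (Suc (Suc n)) * \<epsilon> \<le> 1 / real (Suc n) * \<epsilon>" using eps by (intro mult_right_mono frac_le) auto
      then show "T (Suc n) \<subseteq> T n" unfolding T_def by auto
    qed
    show "emeasure \<nu> (T n) \<noteq> \<infinity>" for n
    proof -
      have "emeasure \<nu> (T n) \<le> emeasure \<nu> (- {-\<epsilon>..\<epsilon>})" by (rule emeasure_mono) (auto simp: T_def)
      then show ?thesis using emeasure_levy_away_finite[OF eps] by auto
    qed
  qed
  also have "(\<Inter>n. T n) = {}"
  proof -
    have False if y: "\<epsilon> < \<bar>y\<bar>" and le: "\<And>n. \<bar>y\<bar> \<le> \<epsilon> + 1 / real (Suc n) * \<epsilon>" for y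
    proof -
      obtain n where "inverse (real (Suc n)) < (\<bar>y\<bar> - \<epsilon>) / \<epsilon>"
        using reals_Archimedean[of "(\<bar>y\<bar> - \<epsilon>) / \<epsilon>"] y eps by auto
      then have "1 / real (Suc n) * \<epsilon> < \<bar>y\<bar> - \<epsilon>" using eps by (simp add: inverse_eq_divide pos_less_divide_eq)
      then show False using le[of n] by linarith
    qed
    then show ?thesis unfolding T_def by blast
  qed
  finally have T: "(\<lambda>n. measure \<nu> (T n)) \<longlonglongrightarrow> 0" by simp
  have "(\<lambda>n. exp (- K) * 2 + 2 * exp (2 * \<epsilon> * \<bar>u\<bar>) * measure \<nu> (T n) * exp \<bar>K\<bar>) \<longlonglongrightarrow>
      exp (- K) * 2 + 2 * exp (2 * \<epsilon> * \<bar>u\<bar>) * 0 * exp \<bar>K\<bar>"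
    by (intro tendsto_intros T)
  then have "exp (- (\<epsilon> / 2 * \<bar>u\<bar>)) * (15 / 8) * prob {\<omega> \<in> space M. sup_norm_path X \<omega> \<le> \<epsilon> / 2}
      \<le> exp (- K) * 2 + 2 * exp (2 * \<epsilon> * \<bar>u\<bar>) * 0 * exp \<bar>K\<bar>"
  proof (rule LIMSEQ_le_const)
    have "exp (- (\<epsilon> / 2 * \<bar>u\<bar>)) * (15 / 8) * prob {\<omega> \<in> space M. sup_norm_path X \<omega> \<le> \<epsilon> / 2}
      \<le> exp (- K) * 2 + 2 * exp (2 * \<epsilon> * \<bar>u\<bar>) * measure \<nu> (T n) * exp \<bar>K\<bar>" for n
      using small_ball_upper_cutoff[OF eps crit, of "1 / real (Suc n)"] unfolding K_def T_def by simp
    then show "\<exists>N. \<forall>n\<ge>N. exp (- (\<epsilon> / 2 * \<bar>u\<bar>)) * (15 / 8) * prob {\<omega> \<in> space M. sup_norm_path X \<omega> \<le> \<epsilon> / 2}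
      \<le> exp (- K) * 2 + 2 * exp (2 * \<epsilon> * \<bar>u\<bar>) * measure \<nu> (T n) * exp \<bar>K\<bar>" by blast
  qed
  then show ?thesis by simp
qed

end

section \<open>Passage to logarithms\<close>

lemma neg_log_le:
  assumes "exp (- c) \<le> p"
  shows "neg_log p \<le> ereal c"
proof -
  have p: "0 < p" using assms exp_gt_zero[of "- c"] by linarith
  then have "- c \<le> ln p" using assms by (simp add: ln_ge_iff)
  then show ?thesis using p by (simp add: neg_log_def)
qed

lemma neg_log_ge:
  assumes "0 \<le> p" "p \<le> exp (- c)"
  shows "ereal c \<le> neg_log p"
proof (cases "p = 0")
  case False
  then have "ln p \<le> - c" using assms by (metis exp_gt_zero ln_exp ln_le_cancel_iff order_le_less)
  then show ?thesis using False by (simp add: neg_log_def)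
qed (simp add: neg_log_def)

theorem theorem1p5:
  fixes M :: "'a measure" and X :: "real \<Rightarrow> 'a \<Rightarrow> real"
    and \<nu> :: "real measure" and \<sigma>2 b \<epsilon> u :: real
  assumes "\<epsilon> > 0"
    and "levy_process M X \<nu> \<sigma>2 b"
    and "\<not> deterministic_process M X"
    and "deriv (Lambda_eps \<nu> \<sigma>2 b \<epsilon>) u = 0"
  shows "F_bar \<nu> \<sigma>2 \<epsilon> u = 1 / \<epsilon>\<^sup>2 * deriv (deriv (Lambda_eps \<nu> \<sigma>2 b \<epsilon>)) u
      \<and> neg_log (measure M {\<omega> \<in> space M. sup_norm_path X \<omega> \<le> 3 * \<epsilon>})
           \<le> ereal (measure \<nu> (- {-\<epsilon>..\<epsilon>}) - Lambda_eps \<nu> \<sigma>2 b \<epsilon> u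
                    + 3 * \<epsilon> * \<bar>u\<bar> + 10 * F_bar \<nu> \<sigma>2 \<epsilon> u + 3)
      \<and> neg_log (measure M {\<omega> \<in> space M. sup_norm_path X \<omega> \<le> \<epsilon> / 2})
           \<ge> ereal (measure \<nu> (- {-\<epsilon>..\<epsilon>}) - Lambda_eps \<nu> \<sigma>2 b \<epsilon> u
                    - \<epsilon> / 2 * \<bar>u\<bar> + 1 / 12 * F_bar \<nu> \<sigma>2 \<epsilon> u - 1)"
proof -
  interpret levy_triplet \<nu> \<sigma>2 b
    using assms(2) by unfold_locales (auto simp: levy_process_def)
  interpret prob_space M using assms(2) by (simp add: levy_process_def)
  interpret levy_paths M X \<nu> \<sigma>2 b by unfold_locales (rule assms(2))
  let ?m = "measure \<nu> (- {-\<epsilon>..\<epsilon>})" and ?\<Lambda> = "Lambda_eps \<nu> \<sigma>2 b \<epsilon> u" and ?F = "F_bar \<nu> \<sigma>2 \<epsilon> u"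
  have "F_bar \<nu> \<sigma>2 \<epsilon> u = 1 / \<epsilon>\<^sup>2 * deriv (deriv (Lambda_eps \<nu> \<sigma>2 b \<epsilon>)) u"
    unfolding F_bar_def deriv_deriv_Lambda_eps[OF assms(1)] ..
  moreover have "neg_log (prob {\<omega> \<in> space M. sup_norm_path X \<omega> \<le> 3 * \<epsilon>}) \<le> ereal (?m - ?\<Lambda> + 3 * \<epsilon> * \<bar>u\<bar> + 10 * ?F + 3)"
  proof (rule neg_log_le)
    \<comment> \<open>The summand 3 enters through exp (- 3) <= 1 only: the bump takes its maximum 1
      at the starting point.\<close>
    have "exp (- (?m - ?\<Lambda> + 3 * \<epsilon> * \<bar>u\<bar> + 10 * ?F + 3)) \<le> exp (- (3 * \<epsilon> * \<bar>u\<bar>)) * exp (- (?m - ?\<Lambda> + 10 * ?F))"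
      by (simp add: exp_add[symmetric])
    also have "\<dots> \<le> exp (- (3 * \<epsilon> * \<bar>u\<bar>)) * (exp (3 * \<epsilon> * \<bar>u\<bar>) * prob {\<omega> \<in> space M. sup_norm_path X \<omega> \<le> 3 * \<epsilon>})"
      by (intro mult_left_mono small_ball_lower assms) simp
    also have "\<dots> = prob {\<omega> \<in> space M. sup_norm_path X \<omega> \<le> 3 * \<epsilon>}" by (simp add: exp_minus)
    finally show "exp (- (?m - ?\<Lambda> + 3 * \<epsilon> * \<bar>u\<bar> + 10 * ?F + 3)) \<le> prob {\<omega> \<in> space M. sup_norm_path X \<omega> \<le> 3 * \<epsilon>}" .
  qed
  moreover have "ereal (?m - ?\<Lambda> - \<epsilon> / 2 * \<bar>u\<bar> + 1 / 12 * ?F - 1) \<le> neg_log (prob {\<omega> \<in> space M. sup_norm_path X \<omega> \<le> \<epsilon> / 2})"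
  proof (rule neg_log_ge)
    let ?p = "prob {\<omega> \<in> space M. sup_norm_path X \<omega> \<le> \<epsilon> / 2}" and ?e = "exp (\<epsilon> / 2 * \<bar>u\<bar>)"
    have "?e * (exp (- (\<epsilon> / 2 * \<bar>u\<bar>)) * (15 / 8) * ?p) \<le> ?e * (2 * exp (- (?m - ?\<Lambda> + 1 / 12 * ?F)))"
      by (intro mult_left_mono small_ball_upper assms) simp
    moreover have "?e * (exp (- (\<epsilon> / 2 * \<bar>u\<bar>)) * (15 / 8) * ?p) = 15 / 8 * ?p"
      unfolding mult.assoc[symmetric] exp_add[symmetric] by simp
    moreover have "?e * (2 * exp (- (?m - ?\<Lambda> + 1 / 12 * ?F))) = 2 * (?e * exp (- (?m - ?\<Lambda> + 1 / 12 * ?F)))"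
      by (rule mult.left_commute)
    ultimately have "?p \<le> 16 / 15 * (?e * exp (- (?m - ?\<Lambda> + 1 / 12 * ?F)))" by linarith
    \<comment> \<open>The summand 1 pays for 16/15, the ratio of the start value 2 of the test
      function to its lower bound 15/8 on the ball, both without the exponential weight.\<close>
    also have "\<dots> \<le> exp 1 * (?e * exp (- (?m - ?\<Lambda> + 1 / 12 * ?F)))"
      using exp_ge_add_one_self[of 1] by (intro mult_right_mono) auto
    also have "\<dots> = exp (- (?m - ?\<Lambda> - \<epsilon> / 2 * \<bar>u\<bar> + 1 / 12 * ?F - 1))"
      by (simp add: exp_add[symmetric] algebra_simps)
    finally show "?p \<le> exp (- (?m - ?\<Lambda> - \<epsilon> / 2 * \<bar>u\<bar> + 1 / 12 * ?F - 1))" .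
  qed simp
  ultimately show ?thesis by blast
qed

end
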